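(* Assume that $Q$ is a solution to the equivalent measure extension problem, and let $\Lambda$ be the nondecreasing predictable process in the multiplicative Doob--Meyer decomposition $Z_t=e^{-\Lambda_t}K_t$ of $Z_t=Q(\tau>t\mid\mathcal F_t)$ under $Q$. Then, $Q$-a.s., the random measure $d\Lambda_t$ is supported on the set $\{t: X_{t-}\in\overline{D_0}\}$ (i.e. it does not charge the complement of this set), where $\overline{D_0}$ is the closure in $D$ of $$D_0=\pi\circ h^{-1}(\{0\})=\{x\in D: x=\pi(y)\text{ for some }y\in E\text{ with }h(y)=0\}.$$
   Context: Path space. $E$ is a locally compact topological space with a countable base, $E_\Delta=E\cup\{\Delta\}$ where $\Delta\notin E$ is an isolated point. $\Omega$ is the set of all right-continuous paths $\omega:\mathbb R_+\to E_\Delta$ that are absorbed at $\Delta$ (if $\omega(s)=\Delta$ then $\omega(t)=\Delta$ for all $t\ge s$) and have left limits on $(0,\zeta(\omega))$, where $\zeta(\omega)=\inf\{t\ge0:\omega(t)=\Delta\}$. $Y_t(\omega)=\omega(t)$ is the coordinate process, $\mathcal G^o_t=\sigma(Y_s:s\le t)$, $\mathcal G_t=\bigcap_{u>t}\mathcal G^o_u$, $\mathbb G=(\mathcal G_t)_{t\ge0}$, $\mathcal G=\bigvee_{t\ge0}\mathcal G_t$; $P$ is a probability on $\mathcal G$. Filtrations are not augmented with nullsets. The local martingale. $h:E_\Delta\to[0,\infty)$ is continuous on $E$ with $h(Y_0)=1$ $P$-a.s.; $\tau_n=n\wedge\inf\{t\ge0: h(Y_t)\le 1/n\}$, $\tau=\lim_n\tau_n$.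 It is assumed that $N_t=\frac{1}{h(Y_t)}\mathbf 1_{\{\tau>t\}}$ is a càdlàg, $P$-a.s. strictly positive local martingale under $P$ (so $P(\tau<\infty)=0$). Subfiltration. $D$ is a metrizable topological space with $\Delta\notin D$, $D_\Delta=D\cup\{\Delta\}$, $\pi:E\to D$ is a continuous map, extended by $\pi(\Delta)=\Delta$. $X_t=\pi(Y_t)$, and $\mathbb F=(\mathcal F_t)_{t\ge0}$ with $\mathcal F_t=\bigcap_{u>t}\sigma(X_s:s\le u)$. Föllmer measure. $Q_n$ is the probability on $\mathcal G_{\tau_n}$ with $dQ_n=N_{\tau_n}\,dP$; $Q_0$ is the probability on $\mathcal G_{\tau-}=\bigvee_n\mathcal G_{\tau_n}$ that coincides with $Q_n$ on $\mathcal G_{\tau_n-}$ for each $n$. A probability $Q$ on $(\Omega,\mathcal G)$ solves the equivalent measure extension problem if (1) $Q=Q_0$ on $\mathcal G_{\tau-}$, and (2) the restrictions of $P$ and $Q$ to $\mathcal F_t$ are equivalent for each $t\ge0$. $Z_t=Q(\tau>t\mid\mathcal F_t)$ denotes the càdlàg modification of this $(\mathbb F,Q)$-supermartingale; when $Q$ solves the equivalent measure extension problem it is strictly positive and has a unique multiplicative decomposition $Z_t=e^{-\Lambda_t}K_t$ with $\Lambda$ nondecreasing and $\mathbb F$-predictable, $\Lambda_0=0$, and $K$ an $(\mathbb F,Q)$-local martingale with $K_0=1$.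
   Formalization: Added assumption: either ζ=∞ P-a.s., or Q-a.s. on {τ<∞} the left limit Y_{τ-} exists in E. Without it the claim fails when P kills paths: h may tend to 0 along a path leaving E although h has no zero. The τ_n are represented by a.s. equal stopping times. *)

theory Defs
  imports "HOL-Probability.Probability"
begin

section \<open>Path space\<close>

text \<open>
  The state space with cemetery is \<^typ>\<open>'e option\<close>: \<^const>\<open>None\<close> is the cemetery and is an
  isolated point.
\<close>

instantiation option :: (topological_space) topological_space
begin

definition open_option :: "'a option set \<Rightarrow> bool" where
  "open_option U \<longleftrightarrow> open (Some -` U)"

instance
  by standard (auto simp: open_option_def vimage_Union)

end

definition lifetime :: "(real \<Rightarrow> 'e option) \<Rightarrow> ennreal" where
  "lifetime \<omega> = Inf (ennreal ` {t. 0 \<le> t \<and> \<omega> t = None})"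

text \<open>
  Paths are functions on \<open>[0, \<infinity>)\<close>; the irrelevant values at negative times are fixed by
  \<^const>\<open>extensional\<close>.
\<close>

definition path_space :: "(real \<Rightarrow> 'e::topological_space option) set" where
  "path_space = {\<omega> \<in> extensional {0..}.
     (\<forall>t\<ge>0. (\<omega> \<longlongrightarrow> \<omega> t) (at_right t)) \<and>
     (\<forall>s t. 0 \<le> s \<and> s \<le> t \<and> \<omega> s = None \<longrightarrow> \<omega> t = None) \<and>
     (\<forall>t>0. ennreal t < lifetime \<omega> \<longrightarrow> (\<exists>l. (\<omega> \<longlongrightarrow> l) (at_left t)))}"


section \<open>Filtrations, martingales, predictable processes\<close>

text \<open>
  Filtrations are indexed by \<^typ>\<open>ennreal\<close> so that stopping times may take the value \<open>\<infinity>\<close>; the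
  \<open>\<sigma>\<close>-algebra at \<open>\<infinity>\<close> is the one generated by the whole process. Processes are indexed by
  \<^typ>\<open>real\<close>, and only their values at times \<open>t \<ge> 0\<close> are relevant.
\<close>

definition process_sigma ::
    "'w set \<Rightarrow> (real \<Rightarrow> 'w \<Rightarrow> 'a::topological_space) \<Rightarrow> real set \<Rightarrow> 'w measure" where
  "process_sigma \<Omega> V I = sigma \<Omega> (\<Union>s\<in>I. sets (vimage_algebra \<Omega> (V s) borel))"

definition right_filtration ::
    "'w set \<Rightarrow> (real \<Rightarrow> 'w \<Rightarrow> 'a::topological_space) \<Rightarrow> ennreal \<Rightarrow> 'w measure" where
  "right_filtration \<Omega> V t =
     (if t = \<infinity> then process_sigma \<Omega> V {0..}
      else sigma \<Omega> (\<Inter>u\<in>{u. t < ennreal u}. sets (process_sigma \<Omega> V {0..u})))"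

lemma space_process_sigma [simp]: "space (process_sigma \<Omega> V I) = \<Omega>"
  unfolding process_sigma_def using sets.space_closed
  by (subst space_measure_of) (auto, fastforce)

lemma sets_process_sigma_mono:
  assumes "I \<subseteq> J"
  shows "sets (process_sigma \<Omega> V I) \<subseteq> sets (process_sigma \<Omega> V J)"
proof -
  have *: "(\<Union>s\<in>L. sets (vimage_algebra \<Omega> (V s) borel)) \<subseteq> Pow \<Omega>" for L
    using sets.space_closed[of "vimage_algebra \<Omega> (V _) borel"] by auto
  show ?thesis
    unfolding process_sigma_def using assms
    by (subst (1 2) sets_measure_of[OF *]) (intro sigma_sets_mono', auto)
qed

lemma sets_right_filtration_finite:
  assumes "t < \<infinity>"
  shows "sets (right_filtration \<Omega> V t) =
    (\<Inter>u\<in>{u. t < ennreal u}. sets (process_sigma \<Omega> V {0..u}))"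
proof -
  have ne: "{u. t < ennreal u} \<noteq> {}"
    using assms ennreal_Ex_less_of_nat[of t] by (auto simp: ennreal_of_nat_eq_real_of_nat)
  have "sigma_algebra \<Omega> (\<Inter>u\<in>{u. t < ennreal u}. sets (process_sigma \<Omega> V {0..u}))"
    unfolding sigma_algebra_iff2
  proof (intro conjI)
    show "(\<Inter>u\<in>{u. t < ennreal u}. sets (process_sigma \<Omega> V {0..u})) \<subseteq> Pow \<Omega>"
      using ne sets.space_closed[of "process_sigma \<Omega> V _"] by fastforce
    show "\<forall>s\<in>\<Inter>u\<in>{u. t < ennreal u}. sets (process_sigma \<Omega> V {0..u}).
        \<Omega> - s \<in> (\<Inter>u\<in>{u. t < ennreal u}. sets (process_sigma \<Omega> V {0..u}))"
      using sets.compl_sets[where M = "process_sigma \<Omega> V _"] by auto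
  qed (auto intro!: sets.countable_UN)
  then show ?thesis
    using assms by (auto simp: right_filtration_def sigma_algebra.sets_measure_of_eq)
qed

lemma filtration_right_filtration: "filtration \<Omega> (right_filtration \<Omega> V)"
proof
  fix s t :: ennreal
  have ne: "{u. r < ennreal u} \<noteq> {}" if "r \<noteq> \<infinity>" for r
    using that ennreal_Ex_less_of_nat[of r]
    by (auto simp: ennreal_of_nat_eq_real_of_nat top.not_eq_extremum)
  show "space (right_filtration \<Omega> V t) = \<Omega>"
  proof (cases "t = \<infinity>")
    case False
    then have "(\<Inter>u\<in>{u. t < ennreal u}. sets (process_sigma \<Omega> V {0..u})) \<subseteq> Pow \<Omega>"
      using ne[of t] sets.space_closed[of "process_sigma \<Omega> V _"] by fastforce
    with False show ?thesis
      by (simp add: right_filtration_def space_measure_of)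
  qed (simp add: right_filtration_def)
  assume st: "s \<le> t"
  show "sets (right_filtration \<Omega> V s) \<subseteq> sets (right_filtration \<Omega> V t)"
  proof (cases "t = \<infinity>")
    case True
    show ?thesis
    proof (cases "s = \<infinity>")
      case False
      then obtain u where u: "s < ennreal u"
        using ne by auto
      have "sets (right_filtration \<Omega> V s) \<subseteq> sets (process_sigma \<Omega> V {0..u})"
        using False u
        by (subst sets_right_filtration_finite) (auto simp: top.not_eq_extremum)
      also have "\<dots> \<subseteq> sets (process_sigma \<Omega> V {0..})"
        by (rule sets_process_sigma_mono) auto
      finally show ?thesis
        using True by (simp add: right_filtration_def)
    qed (use True in simp)
  next
    case False
    then have "t < \<infinity>" "s < \<infinity>"
      using st by (auto simp: top.not_eq_extremum)
    then show ?thesis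
      using st by (simp add: sets_right_filtration_finite) (auto intro: le_less_trans)
  qed
qed

text \<open>
  \<open>strict_past \<Omega> F T\<close> is the \<open>\<sigma>\<close>-algebra \<open>F\<^sub>T\<^sub>-\<close> of events strictly before \<open>T\<close>; the
  \<open>\<sigma>\<close>-algebra \<open>F\<^sub>T\<close> is the library's \<^const>\<open>filtration.pre_sigma\<close>.
\<close>

definition strict_past ::
    "'w set \<Rightarrow> (ennreal \<Rightarrow> 'w measure) \<Rightarrow> ('w \<Rightarrow> ennreal) \<Rightarrow> 'w measure" where
  "strict_past \<Omega> F T =
     sigma \<Omega> (sets (F 0) \<union> {A \<inter> {\<omega> \<in> \<Omega>. t < T \<omega>} | A t. A \<in> sets (F t)})"

definition cadlag :: "(real \<Rightarrow> real) \<Rightarrow> bool" where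
  "cadlag f \<longleftrightarrow> (\<forall>t\<ge>0. (f \<longlongrightarrow> f t) (at_right t)) \<and> (\<forall>t>0. \<exists>l. (f \<longlongrightarrow> l) (at_left t))"

definition adapted :: "(ennreal \<Rightarrow> 'w measure) \<Rightarrow> (real \<Rightarrow> 'w \<Rightarrow> real) \<Rightarrow> bool" where
  "adapted F V \<longleftrightarrow> (\<forall>t\<ge>0. V t \<in> borel_measurable (F (ennreal t)))"

definition martingale ::
    "'w measure \<Rightarrow> (ennreal \<Rightarrow> 'w measure) \<Rightarrow> (real \<Rightarrow> 'w \<Rightarrow> real) \<Rightarrow> bool" where
  "martingale M F V \<longleftrightarrow> adapted F V \<and> (\<forall>t\<ge>0. integrable M (V t)) \<and>
     (\<forall>s t. 0 \<le> s \<and> s \<le> t \<longrightarrow> (AE \<omega> in M. real_cond_exp M (F (ennreal s)) (V t) \<omega> = V s \<omega>))"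

definition stopped :: "(real \<Rightarrow> 'w \<Rightarrow> real) \<Rightarrow> ('w \<Rightarrow> ennreal) \<Rightarrow> real \<Rightarrow> 'w \<Rightarrow> real" where
  "stopped V T t \<omega> = V (enn2real (min (ennreal t) (T \<omega>))) \<omega>"

text \<open>
  Filtrations are not completed, so path regularity is required almost surely. The process itself
  is localized, which amounts to the usual notion when the initial value is integrable.
\<close>

definition local_martingale ::
    "'w measure \<Rightarrow> (ennreal \<Rightarrow> 'w measure) \<Rightarrow> (real \<Rightarrow> 'w \<Rightarrow> real) \<Rightarrow> bool" where
  "local_martingale M F V \<longleftrightarrow> adapted F V \<and> (AE \<omega> in M. cadlag (\<lambda>t. V t \<omega>)) \<and>
     (\<exists>S :: nat \<Rightarrow> 'w \<Rightarrow> ennreal.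
        (\<forall>k. stopping_time F (S k)) \<and>
        (AE \<omega> in M. incseq (\<lambda>k. S k \<omega>) \<and> (SUP k. S k \<omega>) = \<infinity>) \<and>
        (\<forall>k. martingale M F (stopped V (S k))))"

definition predictable_sigma ::
    "'w set \<Rightarrow> (ennreal \<Rightarrow> 'w measure) \<Rightarrow> (real \<times> 'w) measure" where
  "predictable_sigma \<Omega> F =
     sigma ({0..} \<times> \<Omega>)
       ({{0} \<times> A | A. A \<in> sets (F 0)} \<union>
        {{s<..t} \<times> A | s t A. 0 \<le> s \<and> s \<le> t \<and> A \<in> sets (F (ennreal s))})"

definition predictable ::
    "'w set \<Rightarrow> (ennreal \<Rightarrow> 'w measure) \<Rightarrow> (real \<Rightarrow> 'w \<Rightarrow> real) \<Rightarrow> bool" where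
  "predictable \<Omega> F V \<longleftrightarrow> (\<lambda>(t, \<omega>). V t \<omega>) \<in> borel_measurable (predictable_sigma \<Omega> F)"


section \<open>The canonical filtration and the subfiltration\<close>

definition path_filtration ::
    "ennreal \<Rightarrow> (real \<Rightarrow> 'e::topological_space option) measure" where
  "path_filtration = right_filtration path_space (\<lambda>t \<omega>. \<omega> t)"

definition image_process :: "('e \<Rightarrow> 'd) \<Rightarrow> real \<Rightarrow> (real \<Rightarrow> 'e option) \<Rightarrow> 'd option" where
  "image_process \<pi> t \<omega> = map_option \<pi> (\<omega> t)"

definition image_filtration ::
    "('e::topological_space \<Rightarrow> 'd::topological_space) \<Rightarrow> ennreal \<Rightarrow> (real \<Rightarrow> 'e option) measure" where
  "image_filtration \<pi> = right_filtration path_space (image_process \<pi>)"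


section \<open>The local martingale and its Foellmer measure\<close>

definition tau_n :: "('e option \<Rightarrow> real) \<Rightarrow> nat \<Rightarrow> (real \<Rightarrow> 'e option) \<Rightarrow> ennreal" where
  "tau_n h n \<omega> = min (of_nat n) (Inf (ennreal ` {t. 0 \<le> t \<and> h (\<omega> t) \<le> 1 / real n}))"

definition tau :: "('e option \<Rightarrow> real) \<Rightarrow> (real \<Rightarrow> 'e option) \<Rightarrow> ennreal" where
  "tau h \<omega> = (SUP n\<in>{1..}. tau_n h n \<omega>)"

text \<open>
  If \<open>tau h \<omega> < \<infinity>\<close> coincides with \<^term>\<open>lifetime \<omega>\<close>, the path need not have a left limit at that time:
  \<open>h\<close> can tend to \<open>0\<close> along a path that leaves every compact set, even if \<open>h\<close> has no zero. The
  zero set of \<open>h\<close> then carries no information about the position at \<open>tau h\<close>.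
\<close>

definition recip_process :: "('e option \<Rightarrow> real) \<Rightarrow> real \<Rightarrow> (real \<Rightarrow> 'e option) \<Rightarrow> real" where
  "recip_process h t \<omega> = (if ennreal t < tau h \<omega> then 1 / h (\<omega> t) else 0)"

definition stopping_sigma ::
    "((real \<Rightarrow> 'e::topological_space option) \<Rightarrow> ennreal) \<Rightarrow> (real \<Rightarrow> 'e option) measure" where
  "stopping_sigma T = filtration.pre_sigma path_space path_filtration T"

text \<open>
  The hitting time \<^const>\<open>tau_n\<close> of a closed set by a right-continuous process need not be a stopping
  time of the uncompleted filtration \<^const>\<open>path_filtration\<close>. As usual, it is then represented by
  an almost surely equal stopping time. The definitions below therefore refer to a sequence
  \<open>T 1, T 2, \<dots>\<close> of stopping times.
\<close>

definition limit_sigma ::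
    "(nat \<Rightarrow> (real \<Rightarrow> 'e::topological_space option) \<Rightarrow> ennreal) \<Rightarrow> (real \<Rightarrow> 'e option) measure" where
  "limit_sigma T = sigma path_space (\<Union>n\<in>{1..}. sets (stopping_sigma (T n)))"

definition changed_measure ::
    "(real \<Rightarrow> 'e::topological_space option) measure \<Rightarrow> ('e option \<Rightarrow> real) \<Rightarrow>
     ((real \<Rightarrow> 'e option) \<Rightarrow> ennreal) \<Rightarrow> (real \<Rightarrow> 'e option) measure" where
  "changed_measure P h T =
     density (restr_to_subalg P (stopping_sigma T))
       (\<lambda>\<omega>. ennreal (recip_process h (enn2real (T \<omega>)) \<omega>))"

definition foellmer_measure ::
    "(real \<Rightarrow> 'e::topological_space option) measure \<Rightarrow> ('e option \<Rightarrow> real) \<Rightarrow>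
     (nat \<Rightarrow> (real \<Rightarrow> 'e option) \<Rightarrow> ennreal) \<Rightarrow> (real \<Rightarrow> 'e option) measure \<Rightarrow> bool" where
  "foellmer_measure P h T Q0 \<longleftrightarrow>
     prob_space Q0 \<and> sets Q0 = sets (limit_sigma T) \<and>
     (\<forall>n\<ge>1. \<forall>A\<in>sets (strict_past path_space path_filtration (T n)).
        emeasure Q0 A = emeasure (changed_measure P h (T n)) A)"

definition equivalent_measure_extension ::
    "(real \<Rightarrow> 'e::topological_space option) measure \<Rightarrow>
     (nat \<Rightarrow> (real \<Rightarrow> 'e option) \<Rightarrow> ennreal) \<Rightarrow> ('e \<Rightarrow> 'd::topological_space) \<Rightarrow>
     (real \<Rightarrow> 'e option) measure \<Rightarrow> (real \<Rightarrow> 'e option) measure \<Rightarrow> bool" where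
  "equivalent_measure_extension P T \<pi> Q0 Q \<longleftrightarrow>
     prob_space Q \<and> sets Q = sets (path_filtration \<infinity> :: (real \<Rightarrow> 'e option) measure) \<and>
     (\<forall>A\<in>sets (limit_sigma T). emeasure Q A = emeasure Q0 A) \<and>
     (\<forall>t\<ge>0.
        absolutely_continuous (restr_to_subalg P (image_filtration \<pi> (ennreal t)))
                              (restr_to_subalg Q (image_filtration \<pi> (ennreal t))) \<and>
        absolutely_continuous (restr_to_subalg Q (image_filtration \<pi> (ennreal t)))
                              (restr_to_subalg P (image_filtration \<pi> (ennreal t))))"

definition survival_process ::
    "(real \<Rightarrow> 'e::topological_space option) measure \<Rightarrow> ('e option \<Rightarrow> real) \<Rightarrow>
     ('e \<Rightarrow> 'd::topological_space) \<Rightarrow> (real \<Rightarrow> (real \<Rightarrow> 'e option) \<Rightarrow> real) \<Rightarrow> bool" where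
  "survival_process Q h \<pi> Z \<longleftrightarrow>
     adapted (image_filtration \<pi>) Z \<and> (AE \<omega> in Q. cadlag (\<lambda>t. Z t \<omega>)) \<and>
     (\<forall>t\<ge>0. AE \<omega> in Q. Z t \<omega> =
        real_cond_exp Q (image_filtration \<pi> (ennreal t)) (indicator {\<omega>. ennreal t < tau h \<omega>}) \<omega>)"

definition multiplicative_decomposition ::
    "'w measure \<Rightarrow> (ennreal \<Rightarrow> 'w measure) \<Rightarrow> (real \<Rightarrow> 'w \<Rightarrow> real) \<Rightarrow>
     (real \<Rightarrow> 'w \<Rightarrow> real) \<Rightarrow> (real \<Rightarrow> 'w \<Rightarrow> real) \<Rightarrow> bool" where
  "multiplicative_decomposition M F Z \<Lambda> K \<longleftrightarrow>
     predictable (space M) F \<Lambda> \<and>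
     (AE \<omega> in M. \<Lambda> 0 \<omega> = 0 \<and> mono_on {0..} (\<lambda>t. \<Lambda> t \<omega>) \<and> cadlag (\<lambda>t. \<Lambda> t \<omega>)) \<and>
     local_martingale M F K \<and> (AE \<omega> in M. K 0 \<omega> = 1) \<and>
     (AE \<omega> in M. \<forall>t\<ge>0. Z t \<omega> = exp (- \<Lambda> t \<omega>) * K t \<omega>)"

text \<open>
  The random measure of \<open>\<Lambda>\<close> has no mass on \<open>(-\<infinity>, 0]\<close> when \<open>\<Lambda>\<close> starts at \<open>0\<close> and is right-continuous.
\<close>

definition increment_measure :: "(real \<Rightarrow> 'w \<Rightarrow> real) \<Rightarrow> 'w \<Rightarrow> real measure" where
  "increment_measure \<Lambda> \<omega> = interval_measure (\<lambda>t. \<Lambda> (max 0 t) \<omega>)"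

definition zero_image :: "('e \<Rightarrow> 'd) \<Rightarrow> ('e option \<Rightarrow> real) \<Rightarrow> 'd set" where
  "zero_image \<pi> h = \<pi> ` {y. h (Some y) = 0}"

end

theory Submission
  imports Defs
begin

text \<open>
  Under \<open>Q\<close> the process \<open>\<Lambda>\<close> is, up to an equivalent change of its increments, the compensator of
  the explosion time \<open>\<tau>\<close> seen from the filtration of \<open>X\<close>, and a compensator does not charge a
  predictable set that \<open>\<tau>\<close> avoids. At a finite \<open>\<tau>\<close> the path has a left limit \<open>y\<close> in \<open>E\<close>, either
  by hypothesis or because an infinite lifetime is inherited from \<open>P\<close>, and \<open>h y = 0\<close> because \<open>h\<close>
  takes values below every \<open>1 / n\<close> at times strictly before \<open>\<tau>\<close> and close to \<open>\<tau>\<close>. Hence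
  \<open>X\<^sub>\<tau>\<^sub>- = \<pi> y\<close> lies in \<open>D\<^sub>0\<close>, so \<open>\<tau>\<close> avoids the complement of \<open>{t. X\<^sub>t\<^sub>- \<in> D\<^sub>0}\<close>, and it remains to
  see that this set is predictable. The measure \<open>d\<Lambda>\<close> is thus carried by \<open>{t. X\<^sub>t\<^sub>- \<in> D\<^sub>0}\<close>.

  The compensator property needs no stochastic integration, since \<open>K\<close> can serve as a density. If \<open>K\<close>
  is a martingale and \<open>A\<close> is an event of time \<open>s \<le> t \<le> r\<close>, then
  \<open>E[K\<^sub>r 1\<^sub>A (exp (-\<Lambda>\<^sub>s) - exp (-\<Lambda>\<^sub>t))] = E[1\<^sub>A (Z\<^sub>s - Z\<^sub>t)] = Q(A, s < \<tau> \<le> t)\<close>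
  by the martingale property and the identity \<open>Z = e\<^sup>-\<^sup>\<Lambda> K\<close>. Both ends
  are values at \<open>(s, t] \<times> A\<close> of measures on the predictable \<open>\<sigma>\<close>-algebra: the left one integrates the increments of \<open>1 - e\<^sup>-\<^sup>\<Lambda>\<close> with weight \<open>K\<^sub>r\<close>, the right one
  is the law of the graph of \<open>\<tau>\<close>. So they agree (\<open>predictable_duality\<close>), and where \<open>K\<^sub>r > 0\<close> the
  increments of \<open>1 - e\<^sup>-\<^sup>\<Lambda>\<close>, and then those of \<open>\<Lambda>\<close>, vanish on sets that \<open>\<tau>\<close> avoids. A local
  martingale \<open>K\<close> is stopped first; the second equation then becomes optional stopping for \<open>Z\<close>
  (\<open>survival_at_stopping_time\<close>). The outcome is \<open>compensator_null_on_avoided_set\<close>.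

  Three facts connect this with the Foellmer measure. First, \<open>Z > 0\<close>: an event of \<open>X\<close> up to time
  \<open>t\<close> without survivors is null under \<open>P\<close>, because \<open>Q\<close> has the strictly positive density \<open>N\<close>
  before \<open>\<tau>\<close>, and is then null under \<open>Q\<close> by equivalence (\<open>null_sets_Q_if_no_survivors\<close>). Second,
  \<open>\<tau>\<close> is not attained by any \<open>T\<^sub>n\<close>: for \<open>m \<ge> n\<close>, \<open>Q(T\<^sub>m \<le> T\<^sub>n)\<close> is the \<open>P\<close>-expectation of the single integrable variable
  \<open>N\<close> at \<open>T\<^sub>n\<close> over \<open>{T\<^sub>m \<le> T\<^sub>n}\<close>, which tends to \<open>0\<close> as \<open>m\<close> grows (\<open>T_less_tau\<close>). Third, \<open>D\<^sub>0\<close> is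
  \<open>\<sigma>\<close>-compact since \<open>E\<close> is; this makes the existence of a left limit in \<open>D\<^sub>0\<close> a condition on the
  values of \<open>X\<close> at rational times (\<open>predictable_left_limit\<close>), although \<open>D\<close> may be neither separable
  nor complete.
\<close>

section \<open>Right-continuous processes at random times\<close>

text \<open>
  Rounding up to a multiple of \<open>1 / (m + 1)\<close>: the approximation of a random time from the right by
  countably many values, all rational.
\<close>

definition grid :: "nat \<Rightarrow> real \<Rightarrow> real" where
  "grid m x = of_int \<lceil>x * real (Suc m)\<rceil> / real (Suc m)"

lemma grid_ge: "x \<le> grid m x"
  unfolding grid_def by (simp add: pos_le_divide_eq)

lemma grid_le: "grid m x \<le> x + inverse (real (Suc m))"
proof -
  have "of_int \<lceil>x * real (Suc m)\<rceil> \<le> x * real (Suc m) + 1"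
    by linarith
  then have "grid m x \<le> (x * real (Suc m) + 1) / real (Suc m)"
    unfolding grid_def by (intro divide_right_mono) auto
  also have "\<dots> = x + inverse (real (Suc m))"
    by (simp add: field_simps)
  finally show ?thesis .
qed

lemma grid_tendsto: "(\<lambda>m. grid m x) \<longlonglongrightarrow> x"
proof (rule tendsto_sandwich[of "\<lambda>_. x"])
  show "(\<lambda>m. x + inverse (real (Suc m))) \<longlonglongrightarrow> x"
    using tendsto_add[OF tendsto_const LIMSEQ_inverse_real_of_nat, of x] by simp
qed (auto intro!: always_eventually grid_ge grid_le tendsto_const simp del: of_nat_Suc)

lemma grid_rational: "grid m x \<in> \<rat>"
  unfolding grid_def by simp

lemma right_continuous_along_sequence:
  fixes f :: "real \<Rightarrow> 'a::topological_space"
  assumes f: "(f \<longlongrightarrow> f x) (at_right x)" and X: "X \<longlonglongrightarrow> x" "\<And>m. x \<le> X m"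
  shows "(\<lambda>m. f (X m)) \<longlonglongrightarrow> f x"
proof (rule topological_tendstoI)
  fix S assume S: "open S" "f x \<in> S"
  with f obtain b where b: "b > x" "\<And>y. x < y \<Longrightarrow> y < b \<Longrightarrow> f y \<in> S"
    by (metis (no_types, lifting) topological_tendstoD eventually_at_right_field)
  have "eventually (\<lambda>m. X m < b) sequentially"
    using order_tendstoD(2)[OF X(1) b(1)] .
  then show "eventually (\<lambda>m. f (X m) \<in> S) sequentially"
  proof eventually_elim
    case (elim m)
    then show ?case using b(2)[of "X m"] S X(2)[of m] by (cases "X m = x") auto
  qed
qed

locale filtered_prob_space = prob_space M + filtration "space M" F
  for M :: "'w measure" and F :: "ennreal \<Rightarrow> 'w measure" +
  assumes sets_F: "\<And>t. sets (F t) \<subseteq> sets M"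
begin

lemma subalgebra_F: "subalgebra M (F t)"
  using sets_F by (auto simp: subalgebra_def space_F)

lemma measurable_F: "f \<in> measurable (F t) N \<Longrightarrow> f \<in> measurable M N"
  using measurable_from_subalg[OF subalgebra_F] .

lemma sets_F_D: "A \<in> sets (F t) \<Longrightarrow> A \<in> sets M"
  using sets_F by auto

lemma sets_F_le: "A \<in> sets (F s) \<Longrightarrow> s \<le> t \<Longrightarrow> A \<in> sets (F t)"
  using sets_F_mono by auto

lemma integral_real_cond_exp_mult:
  fixes f g :: "'w \<Rightarrow> real"
  assumes "integrable M (\<lambda>\<omega>. f \<omega> * g \<omega>)" "f \<in> borel_measurable (F t)" "g \<in> borel_measurable M"
  shows "(\<integral>\<omega>. f \<omega> * real_cond_exp M (F t) g \<omega> \<partial>M) = (\<integral>\<omega>. f \<omega> * g \<omega> \<partial>M)"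
proof -
  interpret finite_measure_subalgebra M "F t"
    by unfold_locales (rule subalgebra_F)
  show ?thesis using real_cond_exp_intg(2)[OF assms] .
qed

lemma real_cond_exp_indicator_bounds:
  assumes "(indicator A :: 'w \<Rightarrow> real) \<in> borel_measurable M"
  shows "AE \<omega> in M. real_cond_exp M (F t) (indicator A) \<omega> \<in> {0..1}"
proof -
  interpret finite_measure_subalgebra M "F t"
    by unfold_locales (rule subalgebra_F)
  have i: "integrable M (indicator A :: _ \<Rightarrow> real)"
    using assms by (intro integrable_const_bound[where B = 1]) (auto simp: indicator_def)
  have "AE \<omega> in M. real_cond_exp M (F t) (indicator A) \<omega> \<le> real_cond_exp M (F t) (\<lambda>_. 1) \<omega>"
    using i by (intro real_cond_exp_mono) (auto simp: indicator_def)
  moreover have "AE \<omega> in M. real_cond_exp M (F t) (\<lambda>_. 1) \<omega> = 1"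
    by (rule real_cond_exp_F_meas) auto
  moreover have "AE \<omega> in M. 0 \<le> real_cond_exp M (F t) (indicator A) \<omega>"
    using assms by (intro real_cond_exp_pos) auto
  ultimately show ?thesis by eventually_elim auto
qed

end

lemma capped_time_bounds:
  assumes "0 \<le> t"
  shows "0 \<le> enn2real (min (ennreal t) x)" "enn2real (min (ennreal t) x) \<le> t"
    "ennreal (enn2real (min (ennreal t) x)) = min (ennreal t) x"
proof -
  show "ennreal (enn2real (min (ennreal t) x)) = min (ennreal t) x"
    by (simp add: min_less_iff_disj)
  have "enn2real (min (ennreal t) x) \<le> enn2real (ennreal t)"
    by (intro enn2real_mono) auto
  then show "enn2real (min (ennreal t) x) \<le> t" using assms by simp
qed simp

lemma measurable_capped_time:
  fixes F' :: "ennreal \<Rightarrow> 'a measure" and S :: "'a \<Rightarrow> ennreal"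
  assumes F': "filtration \<Omega> F'" and S: "stopping_time F' S" and t: "0 \<le> t" "t \<le> u"
  shows "(\<lambda>\<omega>. enn2real (min (ennreal t) (S \<omega>))) \<in> borel_measurable (F' (ennreal u))"
proof -
  interpret F': filtration \<Omega> F' by fact
  have "(\<lambda>\<omega>. min (ennreal t) (S \<omega>)) \<in> borel_measurable (F' (ennreal u))"
  proof (rule borel_measurableI_le)
    fix a :: ennreal
    show "{\<omega> \<in> space (F' (ennreal u)). min (ennreal t) (S \<omega>) \<le> a} \<in> sets (F' (ennreal u))"
    proof (cases "ennreal t \<le> a")
      case True
      then have "{\<omega> \<in> space (F' (ennreal u)). min (ennreal t) (S \<omega>) \<le> a} = space (F' (ennreal u))"
        by (auto simp: min_le_iff_disj)
      then show ?thesis by (simp only: sets.top)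
    next
      case False
      have "{\<omega> \<in> space (F' a). S \<omega> \<le> a} \<in> sets (F' a)"
        using S by (auto simp: stopping_time_def pred_def)
      moreover have "a \<le> ennreal u"
        using False t by (meson ennreal_leI le_less_trans less_imp_le not_le order_trans)
      ultimately have "{\<omega> \<in> space (F' a). S \<omega> \<le> a} \<in> sets (F' (ennreal u))"
        using F'.sets_F_mono by auto
      moreover have "{\<omega> \<in> space (F' (ennreal u)). min (ennreal t) (S \<omega>) \<le> a} = {\<omega> \<in> space (F' a). S \<omega> \<le> a}"
        using False by (auto simp: F'.space_F min_le_iff_disj)
      ultimately show ?thesis by simp
    qed
  qed
  then show ?thesis by measurable
qed

text \<open>
  The rounded times are cut off at \<open>t\<close>. They then use only the past of \<open>t\<close>, so the
  limit belongs to the \<open>\<sigma>\<close>-algebra of time \<open>t\<close> itself and not merely to a later one.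
\<close>

lemma measurable_at_bounded_random_time:
  fixes V :: "real \<Rightarrow> 'w \<Rightarrow> real" and F :: "ennreal \<Rightarrow> 'w measure"
  assumes F: "filtration \<Omega> F" and V: "adapted F V"
    and rc: "\<And>\<omega> s. \<omega> \<in> \<Omega> \<Longrightarrow> 0 \<le> s \<Longrightarrow> ((\<lambda>t. V t \<omega>) \<longlongrightarrow> V s \<omega>) (at_right s)"
    and t: "0 \<le> t"
    and \<sigma>: "\<sigma> \<in> borel_measurable (F (ennreal t))" "\<And>\<omega>. \<omega> \<in> \<Omega> \<Longrightarrow> 0 \<le> \<sigma> \<omega> \<and> \<sigma> \<omega> \<le> t"
  shows "(\<lambda>\<omega>. V (\<sigma> \<omega>) \<omega>) \<in> borel_measurable (F (ennreal t))"
proof (rule borel_measurable_LIMSEQ_real)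
  interpret filtration \<Omega> F by fact
  let ?d = "\<lambda>m (i::int). max 0 (min t (of_int i / real (Suc m)))"
  fix m
  show "(\<lambda>\<omega>. V (max 0 (min t (of_int \<lceil>\<sigma> \<omega> * real (Suc m)\<rceil> / real (Suc m)))) \<omega>)
      \<in> borel_measurable (F (ennreal t))"
  proof (rule measurable_compose_countable[where f = "\<lambda>i. V (?d m i)" and g = "\<lambda>\<omega>. \<lceil>\<sigma> \<omega> * real (Suc m)\<rceil>"])
    show "V (?d m i) \<in> borel_measurable (F (ennreal t))" for i
    proof -
      have "V (?d m i) \<in> borel_measurable (F (ennreal (?d m i)))"
        using V unfolding adapted_def by (meson max.cobounded1)
      moreover have "subalgebra (F (ennreal t)) (F (ennreal (?d m i)))"
        using sets_F_mono[of "ennreal (?d m i)" "ennreal t"] t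
        by (auto simp: subalgebra_def space_F intro!: ennreal_leI)
      ultimately show ?thesis by (rule measurable_from_subalg[rotated])
    qed
    show "(\<lambda>\<omega>. \<lceil>\<sigma> \<omega> * real (Suc m)\<rceil>) \<in> F (ennreal t) \<rightarrow>\<^sub>M count_space UNIV"
      using \<sigma>(1) by measurable
  qed
next
  interpret filtration \<Omega> F by fact
  fix \<omega> assume "\<omega> \<in> space (F (ennreal t))"
  then have \<omega>: "\<omega> \<in> \<Omega>" by (simp add: space_F)
  let ?X = "\<lambda>m. max 0 (min t (grid m (\<sigma> \<omega>)))"
  have "(\<lambda>m. V (?X m) \<omega>) \<longlonglongrightarrow> V (\<sigma> \<omega>) \<omega>"
  proof (rule right_continuous_along_sequence[where f = "\<lambda>t. V t \<omega>" and X = ?X])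
    have "?X \<longlonglongrightarrow> max 0 (min t (\<sigma> \<omega>))"
      by (intro tendsto_intros grid_tendsto)
    then show "?X \<longlonglongrightarrow> \<sigma> \<omega>" using \<sigma>(2)[OF \<omega>] by simp
    show "\<sigma> \<omega> \<le> ?X m" for m
      using \<sigma>(2)[OF \<omega>] grid_ge[of "\<sigma> \<omega>" m] by auto
  qed (use rc \<omega> \<sigma>(2) in auto)
  then show "(\<lambda>m. V (max 0 (min t (of_int \<lceil>\<sigma> \<omega> * real (Suc m)\<rceil> / real (Suc m)))) \<omega>) \<longlonglongrightarrow> V (\<sigma> \<omega>) \<omega>"
    by (simp add: grid_def)
qed

lemma measurable_at_stopping_time:
  fixes V :: "real \<Rightarrow> 'w \<Rightarrow> real" and F :: "ennreal \<Rightarrow> 'w measure"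
  assumes F: "filtration \<Omega> F" and V: "adapted F V"
    and rc: "\<And>\<omega> s. \<omega> \<in> \<Omega> \<Longrightarrow> 0 \<le> s \<Longrightarrow> ((\<lambda>t. V t \<omega>) \<longlongrightarrow> V s \<omega>) (at_right s)"
    and T: "stopping_time F T"
  shows "(\<lambda>\<omega>. V (enn2real (T \<omega>)) \<omega>) \<in> borel_measurable (filtration.pre_sigma \<Omega> F T)"
proof (rule measurableI)
  interpret filtration \<Omega> F by fact
  fix B :: "real set" assume B: "B \<in> sets borel"
  let ?f = "\<lambda>\<omega>. V (enn2real (T \<omega>)) \<omega>"
  have fin: "{\<omega> \<in> \<Omega>. ?f \<omega> \<in> B \<and> T \<omega> \<le> ennreal r} \<in> sets (F (ennreal r))" if r: "0 \<le> r" for r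
  proof -
    let ?\<sigma> = "\<lambda>\<omega>. enn2real (min (ennreal r) (T \<omega>))"
    have "(\<lambda>\<omega>. V (?\<sigma> \<omega>) \<omega>) \<in> borel_measurable (F (ennreal r))"
    proof (rule measurable_at_bounded_random_time[OF F V rc])
      show "?\<sigma> \<in> borel_measurable (F (ennreal r))"
        by (rule measurable_capped_time[OF F T]) (use r in auto)
      show "0 \<le> ?\<sigma> \<omega> \<and> ?\<sigma> \<omega> \<le> r" for \<omega>
        using capped_time_bounds[OF r] by auto
    qed (use r in auto)
    then have "(\<lambda>\<omega>. V (?\<sigma> \<omega>) \<omega>) -` B \<inter> space (F (ennreal r)) \<in> sets (F (ennreal r))"
      using B by (rule measurable_sets)
    moreover have "{\<omega> \<in> space (F (ennreal r)). T \<omega> \<le> ennreal r} \<in> sets (F (ennreal r))"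
      using T by (auto simp: stopping_time_def pred_def)
    ultimately have "((\<lambda>\<omega>. V (?\<sigma> \<omega>) \<omega>) -` B \<inter> space (F (ennreal r))) \<inter>
        {\<omega> \<in> space (F (ennreal r)). T \<omega> \<le> ennreal r} \<in> sets (F (ennreal r))" by auto
    also have "((\<lambda>\<omega>. V (?\<sigma> \<omega>) \<omega>) -` B \<inter> space (F (ennreal r))) \<inter>
        {\<omega> \<in> space (F (ennreal r)). T \<omega> \<le> ennreal r} = {\<omega> \<in> \<Omega>. ?f \<omega> \<in> B \<and> T \<omega> \<le> ennreal r}"
      by (auto simp: space_F min_absorb2)
    finally show ?thesis .
  qed
  show "?f -` B \<inter> space (pre_sigma T) \<in> sets (pre_sigma T)"
  proof (rule sets_pre_sigmaI[OF T])
    fix t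
    show "{\<omega> \<in> ?f -` B \<inter> space (pre_sigma T). T \<omega> \<le> t} \<in> sets (F t)"
    proof (cases t)
      case (real r)
      then show ?thesis using fin[of r] by (simp add: space_pre_sigma Int_def conj_ac vimage_def)
    next
      case top
      have le: "sets (F s) \<subseteq> sets (F top)" for s by (rule sets_F_mono) simp
      have A: "{\<omega> \<in> \<Omega>. ?f \<omega> \<in> B \<and> T \<omega> \<le> ennreal (real k)} \<in> sets (F top)" for k :: nat
        using fin[of "real k"] le by auto
      have T': "T \<in> borel_measurable (F top)"
        using le by (intro measurable_stopping_time[OF T]) (auto simp: space_F)
      have "V 0 \<in> borel_measurable (F 0)"
        using V by (auto simp: adapted_def dest: spec[of _ 0])
      then have V0: "V 0 \<in> borel_measurable (F top)"
        using le[of 0] by (intro measurable_from_subalg[of "F top" "F 0"]) (auto simp: subalgebra_def space_F)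
      have "{\<omega> \<in> space (F top). T \<omega> = top \<and> V 0 \<omega> \<in> B} \<in> sets (F top)"
        using T' V0 B by measurable
      then have "(\<Union>k. {\<omega> \<in> \<Omega>. ?f \<omega> \<in> B \<and> T \<omega> \<le> ennreal (real k)}) \<union>
          {\<omega> \<in> space (F top). T \<omega> = top \<and> V 0 \<omega> \<in> B} \<in> sets (F top)"
        using A by auto
      also have "(\<Union>k. {\<omega> \<in> \<Omega>. ?f \<omega> \<in> B \<and> T \<omega> \<le> ennreal (real k)}) \<union>
          {\<omega> \<in> space (F top). T \<omega> = top \<and> V 0 \<omega> \<in> B} = {\<omega> \<in> ?f -` B \<inter> space (pre_sigma T). T \<omega> \<le> t}"
      proof -
        have "\<exists>k. x \<le> ennreal (real k)" if "x \<noteq> top" for x :: ennreal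
          using ennreal_Ex_less_of_nat[of x] that less_imp_le
          by (auto simp: top.not_eq_extremum ennreal_of_nat_eq_real_of_nat)
        then show ?thesis
          by (force simp: space_pre_sigma space_F top)
      qed
      finally show ?thesis by (simp add: top)
    qed
  qed
qed simp

context filtered_prob_space
begin

text \<open>
  Optional stopping for \<open>Z\<^sub>t = E[1{t < \<theta>} | F\<^sub>t]\<close>. For the rounded times \<open>D m \<ge> \<sigma>\<close> the identity is
  a finite sum of the defining property of \<open>Z\<close>. As \<open>D m\<close> tends to \<open>\<sigma>\<close> from above, the left-hand side
  converges by right continuity of \<open>Z\<close>, and the events \<open>D m < \<theta>\<close> fill up \<open>\<sigma> < \<theta>\<close>; rounding in the
  other direction would produce \<open>\<sigma> \<le> \<theta>\<close> instead. The variable \<open>W\<close> is a measurable version of \<open>Z\<close> at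
  \<open>\<sigma>\<close>, which is itself a limit of measurable functions only almost surely.
\<close>

lemma survival_at_stopping_time:
  fixes Z :: "real \<Rightarrow> 'w \<Rightarrow> real" and \<theta> :: "'w \<Rightarrow> ennreal" and \<sigma> :: "'w \<Rightarrow> real"
  assumes \<theta>: "\<theta> \<in> borel_measurable M"
    and Z_adapted: "adapted F Z"
    and Z_bounds: "AE \<omega> in M. \<forall>t\<ge>0. 0 \<le> Z t \<omega> \<and> Z t \<omega> \<le> 1"
    and Z_rc: "AE \<omega> in M. \<forall>t\<ge>0. ((\<lambda>s. Z s \<omega>) \<longlongrightarrow> Z t \<omega>) (at_right t)"
    and Z_int: "\<And>t A. 0 \<le> t \<Longrightarrow> A \<in> sets (F (ennreal t)) \<Longrightarrow>
        (\<integral>\<omega>. indicator A \<omega> * Z t \<omega> \<partial>M) = measure M {\<omega>\<in>A. ennreal t < \<theta> \<omega>}"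
    and r: "0 \<le> r" and \<sigma>: "\<And>\<omega>. \<omega> \<in> space M \<Longrightarrow> 0 \<le> \<sigma> \<omega> \<and> \<sigma> \<omega> \<le> r" "\<sigma> \<in> borel_measurable M"
    and G: "\<And>q. 0 \<le> q \<Longrightarrow> q \<le> r \<Longrightarrow> {\<omega>\<in>G. \<sigma> \<omega> \<le> q} \<in> sets (F (ennreal q))"
      "G \<subseteq> space M"
    and W: "W \<in> borel_measurable M" "AE \<omega> in M. W \<omega> = Z (\<sigma> \<omega>) \<omega>"
  shows "(\<integral>\<omega>. indicator G \<omega> * W \<omega> \<partial>M) = measure M {\<omega>\<in>G. ennreal (\<sigma> \<omega>) < \<theta> \<omega>}"
proof -
  define d where "d m i = min r (real i / real (Suc m))" for m i
  define idx where "idx m \<omega> = nat \<lceil>\<sigma> \<omega> * real (Suc m)\<rceil>" for m \<omega>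
  define D where "D m \<omega> = min r (grid m (\<sigma> \<omega>))" for m \<omega>
  define N where "N m = nat \<lceil>r * real (Suc m)\<rceil>" for m
  define GG where "GG m i = {\<omega>\<in>G. idx m \<omega> = i}" for m i
  have G': "{\<omega>\<in>G. \<sigma> \<omega> \<le> c} \<in> sets (F (ennreal q))" if "0 \<le> q" "q \<le> r" "c \<le> q" for c q
  proof (cases "c < 0")
    case True
    then have empty: "{\<omega>\<in>G. \<sigma> \<omega> \<le> c} = {}"
      using \<sigma>(1) G(2) by force
    show ?thesis unfolding empty by (rule sets.empty_sets)
  next
    case False
    have "{\<omega>\<in>G. \<sigma> \<omega> \<le> c} \<in> sets (F (ennreal c))"
      by (rule G(1)) (use that False in linarith)+
    then show ?thesis
      by (rule sets_F_le) (use that in \<open>intro ennreal_leI\<close>)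
  qed
  have "{\<omega>\<in>G. \<sigma> \<omega> \<le> r} = G" using \<sigma>(1) G(2) by auto
  with G'[of r r] r have GM: "G \<in> sets M" by (auto dest: sets_F_D)
  have idx: "D m \<omega> = d m (idx m \<omega>)" "idx m \<omega> \<le> N m" if "\<omega> \<in> G" for m \<omega>
  proof -
    have *: "0 \<le> \<sigma> \<omega>" "\<sigma> \<omega> \<le> r" using \<sigma>(1) G(2) that by auto
    then have "0 \<le> \<lceil>\<sigma> \<omega> * real (Suc m)\<rceil>"
      by (metis ceiling_mono ceiling_zero mult_nonneg_nonneg of_nat_0_le_iff)
    then show "D m \<omega> = d m (idx m \<omega>)"
      by (simp add: D_def d_def idx_def grid_def)
    show "idx m \<omega> \<le> N m" unfolding idx_def N_def
      using * by (intro nat_mono ceiling_mono mult_right_mono) auto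
  qed
  have d: "0 \<le> d m i" "d m i \<le> r" for m i using r by (auto simp: d_def)
  \<comment> \<open>The event that the rounded time is \<open>d m i\<close> must be decided at time \<open>d m i\<close>; this is why times are
    rounded up.\<close>
  have GG: "GG m i \<in> sets (F (ennreal (d m i)))" if i: "i \<le> N m" for m i
  proof -
    let ?c = "(real i - 1) / real (Suc m)"
    have le1: "?c \<le> d m i"
    proof -
      have "0 \<le> r * real (Suc m)" using r by simp
      moreover have "real i \<le> of_int \<lceil>r * real (Suc m)\<rceil>"
      proof -
        have "0 \<le> \<lceil>r * real (Suc m)\<rceil>"
          using \<open>0 \<le> r * real (Suc m)\<close> by (metis ceiling_mono ceiling_zero)
        then have "int i \<le> \<lceil>r * real (Suc m)\<rceil>" using i unfolding N_def by linarith
        then show ?thesis by linarith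
      qed
      ultimately have "real i - 1 \<le> r * real (Suc m)" by linarith
      then have "?c \<le> r" by (simp add: divide_le_eq)
      moreover have "?c \<le> real i / real (Suc m)" by (intro divide_right_mono) auto
      ultimately show ?thesis by (simp add: d_def)
    qed
    have "GG m i = {\<omega>\<in>G. \<sigma> \<omega> \<le> d m i} - {\<omega>\<in>G. \<sigma> \<omega> \<le> ?c}"
    proof -
      have "idx m \<omega> = i \<longleftrightarrow> \<sigma> \<omega> \<le> d m i \<and> \<not> \<sigma> \<omega> \<le> ?c" if "\<omega> \<in> G" for \<omega>
      proof -
        have *: "0 \<le> \<sigma> \<omega>" "\<sigma> \<omega> \<le> r" using \<sigma>(1) G(2) that by auto
        then have nn: "0 \<le> \<lceil>\<sigma> \<omega> * real (Suc m)\<rceil>"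
          by (metis ceiling_mono ceiling_zero mult_nonneg_nonneg of_nat_0_le_iff)
        have "idx m \<omega> = i \<longleftrightarrow> \<lceil>\<sigma> \<omega> * real (Suc m)\<rceil> = int i"
          using nn by (auto simp: idx_def)
        also have "\<dots> \<longleftrightarrow> real i - 1 < \<sigma> \<omega> * real (Suc m) \<and> \<sigma> \<omega> * real (Suc m) \<le> real i"
          by (auto simp: ceiling_eq_iff)
        also have "\<dots> \<longleftrightarrow> ?c < \<sigma> \<omega> \<and> \<sigma> \<omega> \<le> real i / real (Suc m)"
          by (simp add: divide_less_eq le_divide_eq)
        finally show ?thesis using * by (auto simp: d_def)
      qed
      then show ?thesis by (auto simp: GG_def)
    qed
    then show ?thesis using G'[of "d m i"] d le1 by auto
  qed
  have Zm: "Z (d m i) \<in> borel_measurable M" for m i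
    using Z_adapted d[of m i] by (intro measurable_F[of _ "ennreal (d m i)"]) (auto simp: adapted_def)
  have GGM: "GG m i \<in> sets M" if "i \<le> N m" for m i using GG[OF that] sets_F_D by auto
  have decomp: "indicator G \<omega> * Z (D m \<omega>) \<omega> = (\<Sum>i\<le>N m. indicator (GG m i) \<omega> * Z (d m i) \<omega>)" for m \<omega>
  proof (cases "\<omega> \<in> G")
    case True
    have "(\<Sum>i\<le>N m. indicator (GG m i) \<omega> * Z (d m i) \<omega>) =
        (\<Sum>i\<le>N m. if i = idx m \<omega> then Z (d m i) \<omega> else 0)"
      using True by (intro sum.cong) (auto simp: GG_def)
    then show ?thesis using True idx[of \<omega> m] by simp
  qed (auto simp: GG_def)
  have Zint: "integrable M (\<lambda>\<omega>. indicator (GG m i) \<omega> * Z (d m i) \<omega>)" if "i \<le> N m" for m i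
  proof (rule integrable_const_bound[where B = 1])
    show "AE \<omega> in M. norm (indicator (GG m i) \<omega> * Z (d m i) \<omega>) \<le> 1"
      using Z_bounds by eventually_elim (use d in \<open>auto simp: indicator_def\<close>)
  qed (use Zm GGM that in measurable)
  have step: "(\<integral>\<omega>. indicator G \<omega> * Z (D m \<omega>) \<omega> \<partial>M) = measure M {\<omega>\<in>G. ennreal (D m \<omega>) < \<theta> \<omega>}" for m
  proof -
    have "(\<integral>\<omega>. indicator G \<omega> * Z (D m \<omega>) \<omega> \<partial>M) =
        (\<Sum>i\<le>N m. \<integral>\<omega>. indicator (GG m i) \<omega> * Z (d m i) \<omega> \<partial>M)"
      unfolding decomp using Zint by (intro Bochner_Integration.integral_sum) auto
    also have "\<dots> = (\<Sum>i\<le>N m. measure M {\<omega>\<in>GG m i. ennreal (d m i) < \<theta> \<omega>})"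
      using GG d by (intro sum.cong Z_int) auto
    also have "\<dots> = measure M (\<Union>i\<le>N m. {\<omega>\<in>GG m i. ennreal (d m i) < \<theta> \<omega>})"
    proof (rule finite_measure_finite_Union[symmetric])
      have "GG m i \<inter> {\<omega>\<in>space M. ennreal (d m i) < \<theta> \<omega>} \<in> sets M" if "i \<le> N m" for i
        using GGM[OF that] \<theta> by measurable
      moreover have "{\<omega>\<in>GG m i. ennreal (d m i) < \<theta> \<omega>} = GG m i \<inter> {\<omega>\<in>space M. ennreal (d m i) < \<theta> \<omega>}" for i
        using G(2) by (auto simp: GG_def)
      ultimately show "(\<lambda>i. {\<omega> \<in> GG m i. ennreal (d m i) < \<theta> \<omega>}) ` {..N m} \<subseteq> sets M" by auto
      show "disjoint_family_on (\<lambda>i. {\<omega> \<in> GG m i. ennreal (d m i) < \<theta> \<omega>}) {..N m}"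
        by (auto simp: disjoint_family_on_def GG_def)
    qed auto
    also have "(\<Union>i\<le>N m. {\<omega>\<in>GG m i. ennreal (d m i) < \<theta> \<omega>}) = {\<omega>\<in>G. ennreal (D m \<omega>) < \<theta> \<omega>}"
      using idx by (auto simp: GG_def)
    finally show ?thesis .
  qed
  have Dlim: "(\<lambda>m. D m \<omega>) \<longlonglongrightarrow> \<sigma> \<omega>" and Dge: "\<sigma> \<omega> \<le> D m \<omega>" "D m \<omega> \<le> r" if "\<omega> \<in> space M" for \<omega> m
  proof -
    have "(\<lambda>m. D m \<omega>) \<longlonglongrightarrow> min r (\<sigma> \<omega>)"
      unfolding D_def by (intro tendsto_intros grid_tendsto)
    then show "(\<lambda>m. D m \<omega>) \<longlonglongrightarrow> \<sigma> \<omega>" using \<sigma>(1)[OF that] by simp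
    show "\<sigma> \<omega> \<le> D m \<omega>" "D m \<omega> \<le> r" using \<sigma>(1)[OF that] grid_ge[of "\<sigma> \<omega>" m] by (auto simp: D_def)
  qed
  have Dmeas: "D m \<in> borel_measurable M" for m
    unfolding D_def grid_def using \<sigma>(2) by measurable
  have set_eq: "{\<omega>\<in>G. ennreal (h \<omega>) < \<theta> \<omega>} = G \<inter> {\<omega>\<in>space M. ennreal (h \<omega>) < \<theta> \<omega>}" for h :: "'w \<Rightarrow> real"
    using G(2) by auto
  have Gset: "{\<omega>\<in>G. ennreal (h \<omega>) < \<theta> \<omega>} \<in> sets M" if "h \<in> borel_measurable M" for h
    unfolding set_eq using that GM \<theta> by measurable
  have L1: "(\<lambda>m. \<integral>\<omega>. indicator G \<omega> * Z (D m \<omega>) \<omega> \<partial>M) \<longlonglongrightarrow> (\<integral>\<omega>. indicator G \<omega> * W \<omega> \<partial>M)"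
  proof (rule integral_dominated_convergence[where w = "\<lambda>_. 1"])
    show "AE \<omega> in M. (\<lambda>m. indicator G \<omega> * Z (D m \<omega>) \<omega>) \<longlonglongrightarrow> indicator G \<omega> * W \<omega>"
      using Z_rc W(2) AE_space
    proof eventually_elim
      case (elim \<omega>)
      have "(\<lambda>m. Z (D m \<omega>) \<omega>) \<longlonglongrightarrow> Z (\<sigma> \<omega>) \<omega>"
        by (rule right_continuous_along_sequence[where f = "\<lambda>t. Z t \<omega>"]) (use elim Dlim Dge \<sigma> in auto)
      then show ?case using elim by (auto intro!: tendsto_intros)
    qed
    show "AE \<omega> in M. norm (indicator G \<omega> * Z (D m \<omega>) \<omega>) \<le> 1" for m
      using Z_bounds AE_space
    proof eventually_elim
      case (elim \<omega>)
      have "0 \<le> D m \<omega>" using elim Dge(1)[of \<omega> m] \<sigma>(1)[of \<omega>] by auto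
      then show ?case using elim by (auto simp: indicator_def)
    qed
    show "(\<lambda>\<omega>. indicator G \<omega> * Z (D m \<omega>) \<omega>) \<in> borel_measurable M" for m
      unfolding decomp using Zm GGM by (intro borel_measurable_sum) auto
  qed (use GM W in auto)
  have L2: "(\<lambda>m. \<integral>\<omega>. indicator {\<omega>\<in>G. ennreal (D m \<omega>) < \<theta> \<omega>} \<omega> \<partial>M) \<longlonglongrightarrow>
      (\<integral>\<omega>. indicator {\<omega>\<in>G. ennreal (\<sigma> \<omega>) < \<theta> \<omega>} \<omega> \<partial>M :: real)"
  proof (rule integral_dominated_convergence[where w = "\<lambda>_. 1"])
    show "AE \<omega> in M. (\<lambda>m. indicator {\<omega>\<in>G. ennreal (D m \<omega>) < \<theta> \<omega>} \<omega> :: real) \<longlonglongrightarrow>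
        indicator {\<omega>\<in>G. ennreal (\<sigma> \<omega>) < \<theta> \<omega>} \<omega>"
    proof (rule AE_I2)
      fix \<omega> assume \<omega>: "\<omega> \<in> space M"
      show "(\<lambda>m. indicator {\<omega>\<in>G. ennreal (D m \<omega>) < \<theta> \<omega>} \<omega> :: real) \<longlonglongrightarrow>
        indicator {\<omega>\<in>G. ennreal (\<sigma> \<omega>) < \<theta> \<omega>} \<omega>"
      proof (cases "ennreal (\<sigma> \<omega>) < \<theta> \<omega>")
        case True
        have "(\<lambda>m. ennreal (D m \<omega>)) \<longlonglongrightarrow> ennreal (\<sigma> \<omega>)"
          by (intro tendsto_ennrealI Dlim \<omega>)
        from order_tendstoD(2)[OF this True]
        have "eventually (\<lambda>m. indicator {\<omega>\<in>G. ennreal (D m \<omega>) < \<theta> \<omega>} \<omega> =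
            (indicator {\<omega>\<in>G. ennreal (\<sigma> \<omega>) < \<theta> \<omega>} \<omega> :: real)) sequentially"
          by eventually_elim (use True in \<open>auto simp: indicator_def\<close>)
        then show ?thesis by (rule tendsto_eventually)
      next
        case False
        then have "\<not> ennreal (D m \<omega>) < \<theta> \<omega>" for m
          using ennreal_leI[OF Dge(1)[OF \<omega>, of m]] by (meson le_less_trans)
        then show ?thesis using False by simp
      qed
    qed
  qed (use Gset \<sigma> Dmeas in auto)
  show ?thesis
    using LIMSEQ_unique[OF L1[unfolded step]] L2 Gset[OF \<sigma>(2)] Gset[OF Dmeas] by simp
qed

lemma right_continuous_AE_bounds:
  fixes Z :: "real \<Rightarrow> 'w \<Rightarrow> real"
  assumes Z: "\<And>t. 0 \<le> t \<Longrightarrow> AE \<omega> in M. Z t \<omega> \<in> {a..b}"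
    and rc: "AE \<omega> in M. \<forall>t\<ge>0. ((\<lambda>s. Z s \<omega>) \<longlongrightarrow> Z t \<omega>) (at_right t)"
  shows "AE \<omega> in M. \<forall>t\<ge>0. a \<le> Z t \<omega> \<and> Z t \<omega> \<le> b"
proof -
  have "AE \<omega> in M. \<forall>q\<in>{q\<in>\<rat>. 0 \<le> q}. Z q \<omega> \<in> {a..b}"
    using Z by (subst AE_ball_countable) (auto intro: countable_subset[OF _ countable_rat])
  with rc show ?thesis
  proof eventually_elim
    case (elim \<omega>)
    show ?case
    proof (intro allI impI)
      fix t :: real assume t: "0 \<le> t"
      have lim: "(\<lambda>m. Z (grid m t) \<omega>) \<longlonglongrightarrow> Z t \<omega>"
        by (rule right_continuous_along_sequence[where f = "\<lambda>t. Z t \<omega>"]) (use elim t grid_tendsto grid_ge in auto)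
      have "Z (grid m t) \<omega> \<in> {a..b}" for m
        using elim(2) grid_rational[of m t] order_trans[OF t grid_ge[of t m]] by blast
      then show "a \<le> Z t \<omega> \<and> Z t \<omega> \<le> b"
        using LIMSEQ_le_const[OF lim] LIMSEQ_le_const2[OF lim] by auto
    qed
  qed
qed

end

section \<open>Measures on the predictable sets\<close>

lemma sets_predictable_sigma:
  assumes "filtration \<Omega> F"
  shows "sets (predictable_sigma \<Omega> F) = sigma_sets ({0..} \<times> \<Omega>)
    ({{0} \<times> A | A. A \<in> sets (F 0)} \<union>
     {{s<..t} \<times> A | s t A. 0 \<le> s \<and> s \<le> t \<and> A \<in> sets (F (ennreal s))})"
    "space (predictable_sigma \<Omega> F) = {0..} \<times> \<Omega>"
proof -
  interpret filtration \<Omega> F by fact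
  have "A \<subseteq> \<Omega>" if "A \<in> sets (F t)" for A t
    using sets.sets_into_space[OF that] by (simp add: space_F)
  then have "{{0} \<times> A | A. A \<in> sets (F 0)} \<union>
     {{s<..t} \<times> A | s t A. 0 \<le> s \<and> s \<le> t \<and> A \<in> sets (F (ennreal s))} \<subseteq> Pow ({0..} \<times> \<Omega>)"
    by fastforce
  then show "sets (predictable_sigma \<Omega> F) = sigma_sets ({0..} \<times> \<Omega>)
    ({{0} \<times> A | A. A \<in> sets (F 0)} \<union>
     {{s<..t} \<times> A | s t A. 0 \<le> s \<and> s \<le> t \<and> A \<in> sets (F (ennreal s))})"
    "space (predictable_sigma \<Omega> F) = {0..} \<times> \<Omega>"
    unfolding predictable_sigma_def by (simp_all add: sets_measure_of space_measure_of)
qed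

lemma sets_predictable_sigma_Ioc:
  assumes "filtration \<Omega> F" "0 \<le> s" "A \<in> sets (F (ennreal s))"
  shows "{s<..t} \<times> A \<in> sets (predictable_sigma \<Omega> F)"
proof (cases "s \<le> t")
  case True
  then show ?thesis
    using assms unfolding sets_predictable_sigma(1)[OF assms(1)] by (intro sigma_sets.Basic) auto
qed auto

text \<open>
  A capped stopping time, paired with the identity, is measurable from \<open>F\<^sub>t\<close> into the predictable
  \<open>\<sigma>\<close>-algebra: generating rectangles pull back to \<open>F\<^sub>t\<close>. Predictability of \<open>\<Lambda>\<close> is applied through this
  lemma, which covers paths on which \<open>\<Lambda>\<close> fails to be right continuous.
\<close>

lemma measurable_predictable_at_capped_time:
  assumes F: "filtration \<Omega> F" and S: "stopping_time F S" and t: "0 \<le> t"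
    and L: "predictable \<Omega> F L"
  shows "(\<lambda>\<omega>. L (enn2real (min (ennreal t) (S \<omega>))) \<omega>) \<in> borel_measurable (F (ennreal t))"
proof -
  interpret filtration \<Omega> F by fact
  let ?\<sigma> = "\<lambda>\<omega>. enn2real (min (ennreal t) (S \<omega>))"
  let ?G = "{{0} \<times> A | A. A \<in> sets (F 0)} \<union>
     {{s<..u} \<times> A | s u A. 0 \<le> s \<and> s \<le> u \<and> A \<in> sets (F (ennreal s))}"
  have \<sigma>: "?\<sigma> \<in> borel_measurable (F (ennreal t))"
    by (rule measurable_capped_time[OF F S]) (use t in auto)
  have mono: "A \<in> sets (F (ennreal t))" if "A \<in> sets (F s)" "s \<le> ennreal t" for A s
    using sets_F_mono[OF that(2)] that(1) by auto
  have sub: "A \<subseteq> \<Omega>" if "A \<in> sets (F s)" for A s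
    using sets.sets_into_space[OF that] by (simp add: space_F)
  have pre: "{\<omega>\<in>\<Omega>. ?\<sigma> \<omega> \<in> B} \<in> sets (F (ennreal t))" if "B \<in> sets borel" for B
  proof -
    have "?\<sigma> -` B \<inter> space (F (ennreal t)) \<in> sets (F (ennreal t))"
      using \<sigma> that by (rule measurable_sets)
    moreover have "?\<sigma> -` B \<inter> space (F (ennreal t)) = {\<omega>\<in>\<Omega>. ?\<sigma> \<omega> \<in> B}"
      by (auto simp: space_F)
    ultimately show ?thesis by simp
  qed
  have "(\<lambda>\<omega>. (?\<sigma> \<omega>, \<omega>)) \<in> measurable (F (ennreal t)) (predictable_sigma \<Omega> F)"
  proof (rule measurable_sigma_sets[OF sets_predictable_sigma(1)[OF F]])
    show "?G \<subseteq> Pow ({0..} \<times> \<Omega>)" using sub by fastforce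
    show "(\<lambda>\<omega>. (?\<sigma> \<omega>, \<omega>)) \<in> space (F (ennreal t)) \<rightarrow> {0..} \<times> \<Omega>" by (auto simp: space_F)
    fix y assume "y \<in> ?G"
    then consider (zero) A where "y = {0} \<times> A" "A \<in> sets (F 0)"
      | (Ioc) s u A where "y = {s<..u} \<times> A" "0 \<le> s" "s \<le> u" "A \<in> sets (F (ennreal s))"
      by blast
    then show "(\<lambda>\<omega>. (?\<sigma> \<omega>, \<omega>)) -` y \<inter> space (F (ennreal t)) \<in> sets (F (ennreal t))"
    proof cases
      case zero
      have "(\<lambda>\<omega>. (?\<sigma> \<omega>, \<omega>)) -` y \<inter> space (F (ennreal t)) = A \<inter> {\<omega>\<in>\<Omega>. ?\<sigma> \<omega> \<in> {0}}"
        using zero by (auto simp: space_F)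
      then show ?thesis using mono[OF zero(2)] pre[of "{0}"] by auto
    next
      case Ioc
      have eq: "(\<lambda>\<omega>. (?\<sigma> \<omega>, \<omega>)) -` y \<inter> space (F (ennreal t)) = A \<inter> {\<omega>\<in>\<Omega>. ?\<sigma> \<omega> \<in> {s<..u}}"
        using Ioc by (auto simp: space_F)
      show ?thesis
      proof (cases "s \<le> t")
        case True
        then show ?thesis unfolding eq using mono[OF Ioc(4)] pre[of "{s<..u}"] by (auto intro: ennreal_leI)
      next
        case False
        have "\<not> s < ?\<sigma> \<omega>" for \<omega> using capped_time_bounds(2)[OF t, of "S \<omega>"] False by linarith
        then show ?thesis unfolding eq by simp
      qed
    qed
  qed
  moreover have "(\<lambda>(t, \<omega>). L t \<omega>) \<in> borel_measurable (predictable_sigma \<Omega> F)"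
    using L by (simp add: predictable_def)
  ultimately show ?thesis by (auto dest: measurable_compose)
qed

lemma predictable_section:
  assumes "filtration \<Omega> F" and B: "B \<in> sets (predictable_sigma \<Omega> F)"
  shows "{u. 0 < u \<and> (u, \<omega>) \<in> B} \<in> sets borel"
  using B unfolding sets_predictable_sigma(1)[OF assms(1)]
proof induction
  case (Basic B)
  then consider A where "B = {0} \<times> A" | s t A where "B = {s<..t} \<times> A" "0 \<le> s" by blast
  then show ?case
  proof cases
    case 1
    then have "{u. 0 < u \<and> (u, \<omega>) \<in> B} = {}" by auto
    then show ?thesis by (simp only: sets.empty_sets)
  next
    case 2
    then have "{u. 0 < u \<and> (u, \<omega>) \<in> B} = (if \<omega> \<in> A then {s<..t} else {})" by auto
    then show ?thesis by simp
  qed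
next
  case (Compl B)
  have "{u. 0 < u \<and> (u, \<omega>) \<in> {0..} \<times> \<Omega> - B} = (if \<omega> \<in> \<Omega> then {0<..} - {u. 0 < u \<and> (u, \<omega>) \<in> B} else {})"
    by auto
  then show ?case using Compl by simp
next
  case (Union A)
  have "{u. 0 < u \<and> (u, \<omega>) \<in> (\<Union>i. A i)} = (\<Union>i. {u. 0 < u \<and> (u, \<omega>) \<in> A i})" by auto
  then show ?case using Union by simp
qed simp

text \<open>
  Uniqueness of measures on the predictable \<open>\<sigma>\<close>-algebra, with the mixture of the random measures
  \<open>interval_measure (c \<omega>)\<close> with weight \<open>k\<close> on one side and the law of the graph of \<open>\<theta>\<close> on \<open>R\<close> on
  the other. Measurability of the mixed masses is carried along in the induction, so that no transition
  kernel has to be constructed. Times \<open>u \<le> 0\<close> are removed from the sections because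
  \<open>interval_measure (c \<omega>)\<close> is not controlled there by the rectangles \<open>(s, t] \<times> A\<close>.
\<close>

lemma (in filtered_prob_space) predictable_duality:
  fixes c :: "'w \<Rightarrow> real \<Rightarrow> real" and k :: "'w \<Rightarrow> ennreal" and \<theta> :: "'w \<Rightarrow> real" and R :: "'w set"
  assumes c_mono: "\<And>\<omega> x y. \<omega> \<in> space M \<Longrightarrow> x \<le> y \<Longrightarrow> c \<omega> x \<le> c \<omega> y"
    and c_rc: "\<And>\<omega> x. \<omega> \<in> space M \<Longrightarrow> continuous (at_right x) (c \<omega>)"
    and c_bd: "\<And>\<omega> x. \<omega> \<in> space M \<Longrightarrow> 0 \<le> c \<omega> x \<and> c \<omega> x \<le> 1"
    and c_meas: "\<And>x. (\<lambda>\<omega>. c \<omega> x) \<in> borel_measurable M"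
    and k: "k \<in> borel_measurable M" and \<theta>: "\<theta> \<in> borel_measurable M" and R: "R \<in> sets M"
    and base: "\<And>s t A. 0 \<le> s \<Longrightarrow> s \<le> t \<Longrightarrow> A \<in> sets (F (ennreal s)) \<Longrightarrow>
      (\<integral>\<^sup>+\<omega>. k \<omega> * (indicator A \<omega> * ennreal (c \<omega> t - c \<omega> s)) \<partial>M) =
      emeasure M {\<omega>\<in>R. 0 < \<theta> \<omega> \<and> (\<theta> \<omega>, \<omega>) \<in> {s<..t} \<times> A}"
    and B: "B \<in> sets (predictable_sigma (space M) F)"
  shows "(\<lambda>\<omega>. emeasure (interval_measure (c \<omega>)) {u. 0 < u \<and> (u, \<omega>) \<in> B}) \<in> borel_measurable M \<and>
    (\<integral>\<^sup>+\<omega>. k \<omega> * emeasure (interval_measure (c \<omega>)) {u. 0 < u \<and> (u, \<omega>) \<in> B} \<partial>M) =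
    emeasure M {\<omega>\<in>R. 0 < \<theta> \<omega> \<and> (\<theta> \<omega>, \<omega>) \<in> B}"
proof -
  let ?J = "\<lambda>\<omega>. interval_measure (c \<omega>)"
  define sec where "sec B \<omega> = {u. 0 < u \<and> (u, \<omega>) \<in> B}" for B :: "(real \<times> 'w) set" and \<omega>
  define hit where "hit B = {\<omega>\<in>R. 0 < \<theta> \<omega> \<and> (\<theta> \<omega>, \<omega>) \<in> B}" for B :: "(real \<times> 'w) set"
  define good where "good B \<longleftrightarrow> (\<lambda>\<omega>. emeasure (?J \<omega>) (sec B \<omega>)) \<in> borel_measurable M \<and>
    (\<forall>\<omega>\<in>space M. sec B \<omega> \<in> sets borel) \<and> hit B \<in> sets M \<and>
    (\<integral>\<^sup>+\<omega>. k \<omega> * emeasure (?J \<omega>) (sec B \<omega>) \<partial>M) = emeasure M (hit B)" for B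
  have space_F': "A \<subseteq> space M" if "A \<in> sets (F s)" for A s
    using sets.sets_into_space[OF that] by (simp add: space_F)
  have Ioc: "good ({s<..t} \<times> A)" if st: "0 \<le> s" "s \<le> t" and A: "A \<in> sets (F (ennreal s))" for s t A
  proof -
    have sec: "sec ({s<..t} \<times> A) \<omega> = (if \<omega> \<in> A then {s<..t} else {})" for \<omega>
      using st by (auto simp: sec_def)
    have em: "emeasure (?J \<omega>) (sec ({s<..t} \<times> A) \<omega>) = indicator A \<omega> * ennreal (c \<omega> t - c \<omega> s)"
      if "\<omega> \<in> space M" for \<omega>
      using emeasure_interval_measure_Ioc[OF st(2), of "c \<omega>"] c_mono c_rc that by (simp add: sec)
    have AM: "A \<in> sets M" using A sets_F_D by blast
    have "hit ({s<..t} \<times> A) = {\<omega>\<in>space M. s < \<theta> \<omega> \<and> \<theta> \<omega> \<le> t} \<inter> R \<inter> A"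
      using st space_F'[OF A] by (auto simp: hit_def)
    then have "hit ({s<..t} \<times> A) \<in> sets M" using R AM \<theta> by auto
    moreover have "(\<lambda>\<omega>. emeasure (?J \<omega>) (sec ({s<..t} \<times> A) \<omega>)) \<in> borel_measurable M"
      using AM c_meas em by (subst measurable_cong[OF em]) auto
    moreover have "(\<integral>\<^sup>+\<omega>. k \<omega> * emeasure (?J \<omega>) (sec ({s<..t} \<times> A) \<omega>) \<partial>M) = emeasure M (hit ({s<..t} \<times> A))"
      using base[OF st A] em unfolding hit_def by (subst nn_integral_cong) (auto simp del: mem_Sigma_iff)
    ultimately show ?thesis by (auto simp: good_def sec)
  qed
  have no_pos: "good B" if "\<And>\<omega> u. 0 < u \<Longrightarrow> (u, \<omega>) \<notin> B" for B
  proof -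
    have "sec B \<omega> = {}" "hit B = {}" for \<omega> using that by (auto simp: sec_def hit_def)
    then show ?thesis by (simp add: good_def)
  qed
  have Union: "good (\<Union>i. A i)" if A: "disjoint_family A" "\<And>i. good (A i)" for A :: "nat \<Rightarrow> _"
  proof -
    have sec: "sec (\<Union>i. A i) \<omega> = (\<Union>i. sec (A i) \<omega>)" for \<omega> by (auto simp: sec_def)
    have hit: "hit (\<Union>i. A i) = (\<Union>i. hit (A i))" by (auto simp: hit_def)
    have em: "emeasure (?J \<omega>) (sec (\<Union>i. A i) \<omega>) = (\<Sum>i. emeasure (?J \<omega>) (sec (A i) \<omega>))"
      if "\<omega> \<in> space M" for \<omega>
      unfolding sec using A that
      by (intro suminf_emeasure[symmetric]) (auto simp: good_def disjoint_family_on_def sec_def)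
    have emM: "emeasure M (hit (\<Union>i. A i)) = (\<Sum>i. emeasure M (hit (A i)))"
      unfolding hit using A
      by (intro suminf_emeasure[symmetric]) (auto simp: good_def disjoint_family_on_def hit_def)
    have m: "(\<lambda>\<omega>. emeasure (?J \<omega>) (sec (A i) \<omega>)) \<in> borel_measurable M" for i
      using A by (auto simp: good_def)
    have "(\<lambda>\<omega>. emeasure (?J \<omega>) (sec (\<Union>i. A i) \<omega>)) \<in> borel_measurable M"
      using m by (subst measurable_cong[OF em]) auto
    moreover have "(\<integral>\<^sup>+\<omega>. k \<omega> * emeasure (?J \<omega>) (sec (\<Union>i. A i) \<omega>) \<partial>M) =
        (\<integral>\<^sup>+\<omega>. (\<Sum>i. k \<omega> * emeasure (?J \<omega>) (sec (A i) \<omega>)) \<partial>M)"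
      by (intro nn_integral_cong) (simp add: em)
    moreover have "\<dots> = (\<Sum>i. \<integral>\<^sup>+\<omega>. k \<omega> * emeasure (?J \<omega>) (sec (A i) \<omega>) \<partial>M)"
      using k m by (intro nn_integral_suminf) auto
    ultimately show ?thesis using A emM by (auto simp: good_def sec hit)
  qed
  have whole: "good ({0..} \<times> space M)"
  proof -
    define D where "D n = (if n = 0 then {0} \<times> space M else {real n - 1<..real n} \<times> space M)" for n :: nat
    have "good (\<Union>n. D n)"
    proof (rule Union)
      show "disjoint_family D"
        unfolding disjoint_family_on_def
      proof (intro ballI impI)
        fix i j :: nat assume "i \<noteq> j"
        then consider "i < j" | "j < i" by linarith
        then show "D i \<inter> D j = {}" by cases (auto simp: D_def)
      qed
      have spF: "space M \<in> sets (F s)" for s using sets.top[of "F s"] by (simp add: space_F)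
      show "good (D n)" for n
        using Ioc[of "real n - 1" "real n"] spF by (cases "n = 0") (auto simp: D_def intro!: no_pos)
    qed
    moreover have "(\<Union>n. D n) = {0..} \<times> space M"
    proof (intro set_eqI iffI)
      fix x :: "real \<times> 'w" assume "x \<in> {0..} \<times> space M"
      then obtain u \<omega> where x: "x = (u, \<omega>)" "0 \<le> u" "\<omega> \<in> space M" by auto
      then have "x \<in> D (nat \<lceil>u\<rceil>)"
        unfolding D_def by (auto simp: nat_eq_iff2) linarith+
      then show "x \<in> (\<Union>n. D n)" by blast
    qed (auto simp: D_def split: if_splits)
    ultimately show ?thesis by simp
  qed
  have fin: "emeasure (?J \<omega>) X \<noteq> \<infinity>" if "\<omega> \<in> space M" for \<omega> X
  proof -
    have "emeasure (?J \<omega>) (\<Union>n. {-real n<..real n}) = (SUP n. emeasure (?J \<omega>) {-real n<..real n})"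
      by (rule SUP_emeasure_incseq[symmetric]) (auto simp: incseq_def)
    also have "\<dots> \<le> 1"
    proof (rule SUP_least)
      fix n :: nat
      have "emeasure (?J \<omega>) {-real n<..real n} = ennreal (c \<omega> (real n) - c \<omega> (- real n))"
        using c_mono c_rc that by (intro emeasure_interval_measure_Ioc) auto
      also have "\<dots> \<le> 1" using c_bd[OF that, of "real n"] c_bd[OF that, of "- real n"]
        by (simp add: ennreal_le_1)
      finally show "emeasure (?J \<omega>) {-real n<..real n} \<le> 1" .
    qed
    also have "(\<Union>n. {-real n<..real n}) = UNIV"
    proof -
      have "x \<in> (\<Union>n. {-real n<..real n})" for x
      proof -
        obtain n where "\<bar>x\<bar> < real n" using reals_Archimedean2 by blast
        then show ?thesis by (auto intro!: exI[of _ n])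
      qed
      then show ?thesis by auto
    qed
    finally have "emeasure (?J \<omega>) UNIV \<le> 1" .
    moreover have "emeasure (?J \<omega>) X \<le> emeasure (?J \<omega>) UNIV"
      by (rule emeasure_mono) auto
    ultimately have "emeasure (?J \<omega>) X \<le> 1" by (rule order_trans[rotated])
    then show ?thesis by (auto simp: top_unique)
  qed
  have compl: "good ({0..} \<times> space M - A)" if A: "good A" for A
  proof -
    let ?U = "{0..} \<times> space M"
    have sec: "sec (?U - A) \<omega> = {0<..} - sec A \<omega>" "sec A \<omega> \<subseteq> {0<..}" "sec ?U \<omega> = {0<..}"
      if "\<omega> \<in> space M" for \<omega>
      using that by (auto simp: sec_def)
    have em: "emeasure (?J \<omega>) (sec (?U - A) \<omega>) = emeasure (?J \<omega>) (sec ?U \<omega>) - emeasure (?J \<omega>) (sec A \<omega>)"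
      if "\<omega> \<in> space M" for \<omega>
      using A that fin sec[OF that] by (auto simp: good_def emeasure_Diff)
    have em': "emeasure (?J \<omega>) (sec (?U - A) \<omega>) + emeasure (?J \<omega>) (sec A \<omega>) = emeasure (?J \<omega>) (sec ?U \<omega>)"
      if "\<omega> \<in> space M" for \<omega>
    proof -
      have "emeasure (?J \<omega>) (sec A \<omega>) \<le> emeasure (?J \<omega>) (sec ?U \<omega>)"
        using sec[OF that] by (intro emeasure_mono) auto
      then show ?thesis using em[OF that] fin[OF that] by (simp add: diff_add_cancel_ennreal)
    qed
    have m: "(\<lambda>\<omega>. emeasure (?J \<omega>) (sec (?U - A) \<omega>)) \<in> borel_measurable M"
      using A whole by (subst measurable_cong[OF em]) (auto simp: good_def)
    have hit: "hit (?U - A) = hit ?U - hit A"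
      using sets.sets_into_space[OF R] by (auto simp: hit_def)
    have hitM: "hit A \<in> sets M" "hit ?U \<in> sets M" using A whole by (auto simp: good_def)
    then have hM: "hit (?U - A) \<in> sets M" by (simp add: hit)
    have "hit A \<subseteq> hit ?U" using sets.sets_into_space[OF R] by (auto simp: hit_def)
    then have "emeasure M (hit ?U) = emeasure M (hit (?U - A)) + emeasure M (hit A)"
      using hitM hM by (subst plus_emeasure) (auto simp: hit intro!: arg_cong[where f = "emeasure M"])
    moreover have "(\<integral>\<^sup>+\<omega>. k \<omega> * emeasure (?J \<omega>) (sec ?U \<omega>) \<partial>M) =
        (\<integral>\<^sup>+\<omega>. k \<omega> * emeasure (?J \<omega>) (sec (?U - A) \<omega>) + k \<omega> * emeasure (?J \<omega>) (sec A \<omega>) \<partial>M)"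
      by (intro nn_integral_cong) (simp add: em'[symmetric] distrib_left)
    moreover have "\<dots> = (\<integral>\<^sup>+\<omega>. k \<omega> * emeasure (?J \<omega>) (sec (?U - A) \<omega>) \<partial>M) +
        (\<integral>\<^sup>+\<omega>. k \<omega> * emeasure (?J \<omega>) (sec A \<omega>) \<partial>M)"
      using k m A by (intro nn_integral_add) (auto simp: good_def)
    ultimately have "(\<integral>\<^sup>+\<omega>. k \<omega> * emeasure (?J \<omega>) (sec (?U - A) \<omega>) \<partial>M) + emeasure M (hit A) =
        emeasure M (hit (?U - A)) + emeasure M (hit A)"
      using A whole by (auto simp: good_def)
    then have "(\<integral>\<^sup>+\<omega>. k \<omega> * emeasure (?J \<omega>) (sec (?U - A) \<omega>) \<partial>M) = emeasure M (hit (?U - A))"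
      by (simp add: add.commute[of _ "emeasure M (hit A)"] ennreal_add_left_cancel)
    moreover have "sec (?U - A) \<omega> \<in> sets borel" if "\<omega> \<in> space M" for \<omega>
      using A that sec[OF that] by (auto simp: good_def)
    ultimately show ?thesis using m hM by (auto simp: good_def)
  qed
  let ?G = "{{0} \<times> A | A. A \<in> sets (F 0)} \<union>
     {{s<..t} \<times> A | s t A. 0 \<le> s \<and> s \<le> t \<and> A \<in> sets (F (ennreal s))}"
  have filt: "filtration (space M) F" by unfold_locales
  have "good B"
  proof (rule sigma_sets_induct_disjoint[of ?G "{0..} \<times> space M" B good])
    show "B \<in> sigma_sets ({0..} \<times> space M) ?G"
      using B sets_predictable_sigma(1)[OF filt] by simp
    show "?G \<subseteq> Pow ({0..} \<times> space M)" using space_F' by fastforce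
    show "Int_stable ?G"
    proof (rule Int_stableI)
      have emp: "{} \<in> ?G" by (rule UnI1) (auto intro!: exI[of _ "{}"])
      fix a b assume a: "a \<in> ?G" and b: "b \<in> ?G"
      consider (zz) A A' where "a = {0} \<times> A" "A \<in> sets (F 0)" "b = {0} \<times> A'" "A' \<in> sets (F 0)"
        | (mix) s t A A' where "0 \<le> s" "a = {0} \<times> A \<and> b = {s<..t} \<times> A' \<or> b = {0} \<times> A \<and> a = {s<..t} \<times> A'"
        | (II) s t A s' t' A' where "a = {s<..t} \<times> A" "0 \<le> s" "s \<le> t" "A \<in> sets (F (ennreal s))"
            "b = {s'<..t'} \<times> A'" "0 \<le> s'" "s' \<le> t'" "A' \<in> sets (F (ennreal s'))"
        using a b by blast
      then show "a \<inter> b \<in> ?G"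
      proof cases
        case zz
        then have "a \<inter> b = {0} \<times> (A \<inter> A')" "A \<inter> A' \<in> sets (F 0)" by auto
        then show ?thesis by blast
      next
        case mix
        then have "a \<inter> b = {}" by auto
        then show ?thesis using emp by simp
      next
        case II
        show ?thesis
        proof (cases "max s s' \<le> min t t'")
          case True
          have "A \<in> sets (F (ennreal (max s s')))" "A' \<in> sets (F (ennreal (max s s')))"
            using sets_F_le[OF II(4), of "ennreal (max s s')"] sets_F_le[OF II(8), of "ennreal (max s s')"]
            by (auto simp: ennreal_leI)
          then have "A \<inter> A' \<in> sets (F (ennreal (max s s')))" by auto
          moreover have "a \<inter> b = {max s s'<..min t t'} \<times> (A \<inter> A')" using II by auto
          moreover have "0 \<le> max s s'" using II by auto
          ultimately show ?thesis using True by blast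
        next
          case False
          then have "a \<inter> b = {}" using II by auto
          then show ?thesis using emp by simp
        qed
      qed
    qed
    show "good A" if "A \<in> ?G" for A
    proof -
      from that consider (zero) A' where "A = {0} \<times> A'"
        | (Ioc) s t A' where "A = {s<..t} \<times> A'" "0 \<le> s" "s \<le> t" "A' \<in> sets (F (ennreal s))"
        by blast
      then show ?thesis
        by cases (auto intro: no_pos Ioc)
    qed
    show "good {}" by (auto intro!: no_pos)
    show "good ({0..} \<times> space M - A)" if "good A" for A using compl that .
    show "good (\<Union>i. A i)" if "disjoint_family A" "\<And>i. good (A i)" for A :: "nat \<Rightarrow> _"
      using Union that by blast
  qed
  then show ?thesis by (simp add: good_def sec_def hit_def)
qed

lemma right_continuous_clip:
  fixes e :: "real \<Rightarrow> real"
  assumes e: "\<And>x. 0 \<le> x \<Longrightarrow> x < r \<Longrightarrow> (e \<longlongrightarrow> e x) (at_right x)"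
  shows "continuous (at_right x) (\<lambda>x. e (max 0 (min r x)))"
proof (cases "x < 0 \<or> r \<le> x")
  case True
  have "eventually (\<lambda>y. e (max 0 (min r y)) = e (max 0 (min r x))) (at_right x)"
  proof (cases "r \<le> x")
    case True
    then show ?thesis
      by (intro eventually_at_right_less[THEN eventually_mono]) auto
  next
    case False
    then have "x < 0" using True by auto
    then show ?thesis
      unfolding eventually_at_right_field by (intro exI[of _ 0]) auto
  qed
  then show ?thesis unfolding continuous_within by (rule tendsto_eventually)
next
  case False
  then have "(e \<longlongrightarrow> e x) (at_right x)" using e[of x] by simp
  moreover have "eventually (\<lambda>y. e y = e (max 0 (min r y))) (at_right x)"
    unfolding eventually_at_right_field
    by (intro exI[of _ r]) (use False in auto)
  moreover have "max 0 (min r x) = x" using False by auto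
  ultimately show ?thesis unfolding continuous_within by (auto intro: Lim_transform_eventually)
qed

text \<open>
  If the increments of \<open>f\<close> are at most \<open>C\<close> times those of \<open>g\<close>, then \<open>h = C g - f\<close> is nondecreasing,
  and the measures of \<open>f\<close> and \<open>h\<close> add up to \<open>C\<close> times the measure of \<open>g\<close>. It is applied with
  \<open>f = \<Lambda>\<close> and \<open>g = 1 - e\<^sup>-\<^sup>\<Lambda>\<close>.
\<close>

lemma interval_measure_null_transfer:
  fixes f g :: "real \<Rightarrow> real"
  assumes f: "\<And>x y. x \<le> y \<Longrightarrow> f x \<le> f y" "\<And>x. continuous (at_right x) f"
    and g: "\<And>x y. x \<le> y \<Longrightarrow> g x \<le> g y" "\<And>x. continuous (at_right x) g"
    and r: "0 \<le> r" and C: "0 \<le> C"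
    and le: "\<And>x y. 0 \<le> x \<Longrightarrow> x \<le> y \<Longrightarrow> y \<le> r \<Longrightarrow> f y - f x \<le> C * (g y - g x)"
    and B: "B \<in> sets borel" "emeasure (interval_measure g) (B \<inter> {0<..r}) = 0"
  shows "emeasure (interval_measure f) (B \<inter> {0<..r}) = 0"
proof -
  define clip where "clip x = max 0 (min r x)" for x :: real
  have clip: "0 \<le> clip x" "clip x \<le> r" for x using r by (auto simp: clip_def)
  have clip_mono: "clip x \<le> clip y" if "x \<le> y" for x y using that by (auto simp: clip_def)
  define h where "h x = C * g (clip x) - f (clip x)" for x
  have h_mono: "h x \<le> h y" if "x \<le> y" for x y
    using le[OF clip(1) clip_mono[OF that] clip(2)] by (simp add: h_def algebra_simps)
  have rc_clip: "continuous (at_right x) (\<lambda>x. e (clip x))"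
    if "\<And>x. continuous (at_right x) e" for e :: "real \<Rightarrow> real" and x
    unfolding clip_def using that by (intro right_continuous_clip) (auto simp: continuous_within)
  have h_rc: "continuous (at_right x) h" for x
    unfolding h_def using rc_clip[OF f(2)] rc_clip[OF g(2)] by (intro continuous_intros)
  let ?I = "{0<..r}"
  define good where "good B \<longleftrightarrow> emeasure (interval_measure f) (B \<inter> ?I) + emeasure (interval_measure h) (B \<inter> ?I) =
      ennreal C * emeasure (interval_measure g) (B \<inter> ?I)" for B
  have fin: "emeasure (interval_measure e) (X \<inter> ?I) \<noteq> \<infinity>"
    if "\<And>x y. x \<le> y \<Longrightarrow> e x \<le> e y" "\<And>x. continuous (at_right x) e" for e :: "real \<Rightarrow> real" and X
  proof -
    have "emeasure (interval_measure e) (X \<inter> ?I) \<le> emeasure (interval_measure e) ?I"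
      by (rule emeasure_mono) auto
    also have "\<dots> = ennreal (e r - e 0)" using that r by (intro emeasure_interval_measure_Ioc)
    finally show ?thesis by (auto simp: top_unique)
  qed
  have "good B"
  proof (rule sigma_sets_induct_disjoint[of "range (\<lambda>(a, b). {a<..b})" UNIV B good])
    show "B \<in> sigma_sets UNIV (range (\<lambda>(a, b). {a<..b}))"
      using B(1) unfolding borel_sigma_sets_Ioc by (simp add: sets_measure_of)
    show "Int_stable (range (\<lambda>(a, b). {a<..b}) :: real set set)"
    proof (rule Int_stableI)
      fix a b :: "real set" assume "a \<in> range (\<lambda>(a, b). {a<..b})" "b \<in> range (\<lambda>(a, b). {a<..b})"
      then obtain x y x' y' where "a = {x<..y}" "b = {x'<..y'}" by auto
      then have "a \<inter> b = (\<lambda>(a, b). {a<..b}) (max x x', min y y')" by auto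
      then show "a \<inter> b \<in> range (\<lambda>(a, b). {a<..b})" by blast
    qed
    have Ioc: "good {a<..b}" for a b
    proof (cases "max a 0 \<le> min b r")
      case True
      let ?a = "max a 0" and ?b = "min b r"
      have eq: "{a<..b} \<inter> ?I = {?a<..?b}" by auto
      have cl: "clip ?a = ?a" "clip ?b = ?b" using True by (auto simp: clip_def)
      have em: "emeasure (interval_measure e) {?a<..?b} = ennreal (e ?b - e ?a)"
        if "\<And>x y. x \<le> y \<Longrightarrow> e x \<le> e y" "\<And>x. continuous (at_right x) e" for e :: "real \<Rightarrow> real"
        using that True by (intro emeasure_interval_measure_Ioc)
      have "ennreal (f ?b - f ?a) + ennreal (h ?b - h ?a) = ennreal (f ?b - f ?a + (h ?b - h ?a))"
        using f(1)[OF True] h_mono[OF True] by (intro ennreal_plus[symmetric]) auto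
      also have "f ?b - f ?a + (h ?b - h ?a) = C * (g ?b - g ?a)"
        unfolding h_def cl by (simp add: algebra_simps)
      also have "ennreal \<dots> = ennreal C * ennreal (g ?b - g ?a)"
        using C by (rule ennreal_mult') 
      finally show ?thesis
        using em[of f, OF f] em[of g, OF g] em[of h, OF h_mono h_rc] unfolding good_def eq by simp
    next
      case False
      then have "{a<..b} \<inter> ?I = {}" by auto
      then show ?thesis by (simp only: good_def) simp
    qed
    show "good A" if "A \<in> range (\<lambda>(a, b). {a<..b})" for A using that Ioc by auto
    have UNIV: "good UNIV" using Ioc[of 0 r] by (simp add: good_def)
    show "good {}" by (simp add: good_def)
    show "good (UNIV - A)" if A: "A \<in> sigma_sets UNIV (range (\<lambda>(a, b). {a<..b}))" "good A" for A
    proof -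
      have Ab: "A \<in> sets borel" using A(1) unfolding borel_sigma_sets_Ioc by (simp add: sets_measure_of)
      have split: "emeasure (interval_measure e) ((UNIV - A) \<inter> ?I) + emeasure (interval_measure e) (A \<inter> ?I) =
          emeasure (interval_measure e) (UNIV \<inter> ?I)" for e
        using Ab by (subst plus_emeasure) (auto intro!: arg_cong[where f = "emeasure _"])
      let ?m = "\<lambda>e X. emeasure (interval_measure e) (X \<inter> ?I)"
      have "ennreal C * ?m g A + (?m f (UNIV - A) + ?m h (UNIV - A)) =
          (?m f A + ?m h A) + (?m f (UNIV - A) + ?m h (UNIV - A))"
        using A(2) by (simp only: good_def)
      also have "\<dots> = (?m f (UNIV - A) + ?m f A) + (?m h (UNIV - A) + ?m h A)"
        by (simp only: ac_simps)
      also have "\<dots> = ennreal C * (?m g (UNIV - A) + ?m g A)"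
        using UNIV by (simp only: good_def split)
      also have "\<dots> = ennreal C * ?m g A + ennreal C * ?m g (UNIV - A)"
        by (simp only: distrib_left ac_simps)
      finally have "ennreal C * ?m g A + (?m f (UNIV - A) + ?m h (UNIV - A)) =
          ennreal C * ?m g A + ennreal C * ?m g (UNIV - A)" .
      moreover have "ennreal C * emeasure (interval_measure g) (A \<inter> ?I) \<noteq> \<infinity>"
        using fin[OF g] by (simp add: ennreal_mult_eq_top_iff)
      ultimately show ?thesis unfolding good_def by (simp add: ennreal_add_left_cancel)
    qed
    show "good (\<Union>i. A i)" if A: "disjoint_family A" "range A \<subseteq> sigma_sets UNIV (range (\<lambda>(a, b). {a<..b}))"
      "\<And>i. good (A i)" for A :: "nat \<Rightarrow> _"
    proof -
      have Ab: "A i \<in> sets borel" for i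
        using A(2) unfolding borel_sigma_sets_Ioc by (auto simp: sets_measure_of)
      have sum: "emeasure (interval_measure e) ((\<Union>i. A i) \<inter> ?I) = (\<Sum>i. emeasure (interval_measure e) (A i \<inter> ?I))" for e
      proof -
        have "(\<Union>i. A i) \<inter> ?I = (\<Union>i. A i \<inter> ?I)" by auto
        then show ?thesis using Ab A(1)
          by (simp only:) (intro suminf_emeasure[symmetric], auto simp: disjoint_family_on_def)
      qed
      let ?m = "\<lambda>e X. emeasure (interval_measure e) (X \<inter> ?I)"
      have "(\<Sum>i. ?m f (A i)) + (\<Sum>i. ?m h (A i)) = (\<Sum>i. ?m f (A i) + ?m h (A i))"
        by (rule suminf_add) auto
      also have "\<dots> = (\<Sum>i. ennreal C * ?m g (A i))"
        using A(3) unfolding good_def by simp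
      also have "\<dots> = ennreal C * (\<Sum>i. ?m g (A i))" by simp
      finally show ?thesis unfolding good_def sum .
    qed
  qed auto
  then show ?thesis using B(2) by (simp add: good_def)
qed

section \<open>The compensator of a random time\<close>

text \<open>
  Cutting a path off at \<open>r \<and> S\<close> and reading it at time \<open>u\<close> is the same as reading it at \<open>S\<close> capped by
  the deterministic time \<open>u\<close> clipped to \<open>[0, r]\<close>. The first form is right continuous in \<open>u\<close>, the
  second is measurable in \<open>\<omega>\<close>.
\<close>

lemma clip_capped_time:
  assumes "0 \<le> r"
  shows "max 0 (min (enn2real (min (ennreal r) x)) u) = enn2real (min (ennreal (max 0 (min r u))) x)"
proof (cases x)
  case (real b)
  have "min (ennreal a) (ennreal b) = ennreal (min a b)" if "0 \<le> a" for a
    using that real by (auto simp: min_def ennreal_le_iff)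
  then show ?thesis using assms real by (simp add: min_def max_def)
next
  case top
  then show ?thesis using assms by (auto simp: min_def max_def)
qed

lemma capped_time_mono:
  assumes "0 \<le> s" "s \<le> t"
  shows "enn2real (min (ennreal s) x) \<le> enn2real (min (ennreal t) x)"
proof (rule enn2real_mono)
  show "min (ennreal s) x \<le> min (ennreal t) x"
    using ennreal_leI[OF assms(2)] by (intro min.mono) auto
qed (simp add: min_less_iff_disj)

text \<open>
  The duality is applied with weight \<open>K\<close> at \<open>r \<and> S\<close> and with the increments of \<open>1 - e\<^sup>-\<^sup>\<Lambda>\<close> stopped at
  \<open>r \<and> S\<close>. On \<open>{S \<ge> r}\<close> the weight is \<open>K\<^sub>r = e\<^sup>\<Lambda> Z\<^sub>r > 0\<close>, hence the inner integral vanishes there. This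
  restriction to \<open>{S \<ge> r}\<close> costs nothing, since a localizing sequence exceeds every \<open>r\<close>.
\<close>

lemma (in filtered_prob_space) compensator_null_before_stopping:
  fixes Z \<Lambda> K :: "real \<Rightarrow> 'w \<Rightarrow> real" and \<theta> S :: "'w \<Rightarrow> ennreal" and r :: real
  assumes \<theta>: "\<theta> \<in> borel_measurable M"
    and Z_adapted: "adapted F Z"
    and Z_bounds: "AE \<omega> in M. \<forall>t\<ge>0. 0 \<le> Z t \<omega> \<and> Z t \<omega> \<le> 1"
    and Z_rc: "AE \<omega> in M. \<forall>t\<ge>0. ((\<lambda>s. Z s \<omega>) \<longlongrightarrow> Z t \<omega>) (at_right t)"
    and Z_int: "\<And>t A. 0 \<le> t \<Longrightarrow> A \<in> sets (F (ennreal t)) \<Longrightarrow>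
        (\<integral>\<omega>. indicator A \<omega> * Z t \<omega> \<partial>M) = measure M {\<omega>\<in>A. ennreal t < \<theta> \<omega>}"
    and Z_pos: "\<And>t. 0 \<le> t \<Longrightarrow> AE \<omega> in M. 0 < Z t \<omega>"
    and \<Lambda>: "predictable (space M) F \<Lambda>"
      "AE \<omega> in M. \<Lambda> 0 \<omega> = 0 \<and> mono_on {0..} (\<lambda>t. \<Lambda> t \<omega>) \<and> cadlag (\<lambda>t. \<Lambda> t \<omega>)"
    and factor: "AE \<omega> in M. \<forall>t\<ge>0. Z t \<omega> = exp (- \<Lambda> t \<omega>) * K t \<omega>"
    and S: "stopping_time F S" and K: "martingale M F (stopped K S)"
    and r: "0 \<le> r"
    and B: "B \<in> sets (predictable_sigma (space M) F)"
      "AE \<omega> in M. 0 < \<theta> \<omega> \<and> \<theta> \<omega> < \<infinity> \<longrightarrow> (enn2real (\<theta> \<omega>), \<omega>) \<notin> B"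
  shows "AE \<omega> in M. ennreal r \<le> S \<omega> \<longrightarrow>
    emeasure (increment_measure \<Lambda> \<omega>) ({u. 0 < u \<and> (u, \<omega>) \<in> B} \<inter> {0<..r}) = 0"
proof -
  define \<sigma> where "\<sigma> t \<omega> = enn2real (min (ennreal t) (S \<omega>))" for t \<omega>
  define V where "V t \<omega> = K (\<sigma> t \<omega>) \<omega>" for t \<omega>
  define L where "L t \<omega> = \<Lambda> (\<sigma> t \<omega>) \<omega>" for t \<omega>
  have filt: "filtration (space M) F" by unfold_locales
  have V_stopped: "V = stopped K S" by (auto simp: fun_eq_iff V_def \<sigma>_def stopped_def)
  have \<sigma>: "0 \<le> \<sigma> t \<omega>" "\<sigma> t \<omega> \<le> t" "ennreal (\<sigma> t \<omega>) = min (ennreal t) (S \<omega>)" if "0 \<le> t" for t \<omega>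
    using capped_time_bounds[OF that] by (auto simp: \<sigma>_def)
  have \<sigma>_mono: "\<sigma> s \<omega> \<le> \<sigma> t \<omega>" if "0 \<le> s" "s \<le> t" for s t \<omega>
    using capped_time_mono[OF that] by (simp add: \<sigma>_def)
  have \<sigma>_meas: "\<sigma> t \<in> borel_measurable (F (ennreal t))" if "0 \<le> t" for t
    unfolding \<sigma>_def using measurable_capped_time[OF filt S that order_refl] .
  have L_meas: "L t \<in> borel_measurable (F (ennreal t))" if "0 \<le> t" for t
    unfolding L_def \<sigma>_def using measurable_predictable_at_capped_time[OF filt S that \<Lambda>(1)] .
  have V_meas: "V t \<in> borel_measurable (F (ennreal t))" if "0 \<le> t" for t
    using K that by (auto simp: V_stopped martingale_def adapted_def)
  have V_int: "integrable M (V t)" if "0 \<le> t" for t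
    using K that by (auto simp: V_stopped martingale_def)
  have V_cond: "AE \<omega> in M. real_cond_exp M (F (ennreal s)) (V t) \<omega> = V s \<omega>" if "0 \<le> s" "s \<le> t" for s t
    using K that by (auto simp: V_stopped martingale_def)
  obtain N where N: "{\<omega>\<in>space M. \<not> ((\<Lambda> 0 \<omega> = 0 \<and> mono_on {0..} (\<lambda>t. \<Lambda> t \<omega>) \<and> cadlag (\<lambda>t. \<Lambda> t \<omega>)) \<and>
      (\<forall>t\<ge>0. Z t \<omega> = exp (- \<Lambda> t \<omega>) * K t \<omega>) \<and> (\<forall>t\<ge>0. 0 \<le> Z t \<omega> \<and> Z t \<omega> \<le> 1))} \<subseteq> N"
    "N \<in> null_sets M"
  proof -
    have "AE \<omega> in M. (\<Lambda> 0 \<omega> = 0 \<and> mono_on {0..} (\<lambda>t. \<Lambda> t \<omega>) \<and> cadlag (\<lambda>t. \<Lambda> t \<omega>)) \<and>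
      (\<forall>t\<ge>0. Z t \<omega> = exp (- \<Lambda> t \<omega>) * K t \<omega>) \<and> (\<forall>t\<ge>0. 0 \<le> Z t \<omega> \<and> Z t \<omega> \<le> 1)"
      using \<Lambda>(2) factor Z_bounds by eventually_elim blast
    then show ?thesis using that by (elim AE_E) (blast intro: null_setsI)
  qed
  \<comment> \<open>The path properties hold only almost surely, but the random measure has to be defined and measurable
    for every \<open>\<omega>\<close>; outside \<open>\<Omega>0\<close> it is set to zero.\<close>
  define \<Omega>0 where "\<Omega>0 = space M - N"
  have \<Omega>0: "\<Omega>0 \<in> sets M" "AE \<omega> in M. \<omega> \<in> \<Omega>0"
    using N(2) AE_not_in[OF N(2)] AE_space by (auto simp: \<Omega>0_def elim: eventually_elim2)
  have \<Lambda>0: "\<Lambda> 0 \<omega> = 0" "\<And>s t. 0 \<le> s \<Longrightarrow> s \<le> t \<Longrightarrow> \<Lambda> s \<omega> \<le> \<Lambda> t \<omega>"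
      "\<And>t. 0 \<le> t \<Longrightarrow> ((\<lambda>s. \<Lambda> s \<omega>) \<longlongrightarrow> \<Lambda> t \<omega>) (at_right t)" "\<And>t. 0 \<le> t \<Longrightarrow> 0 \<le> \<Lambda> t \<omega>"
    and fac: "\<And>t. 0 \<le> t \<Longrightarrow> Z t \<omega> = exp (- \<Lambda> t \<omega>) * K t \<omega>"
    and Z01: "\<And>t. 0 \<le> t \<Longrightarrow> 0 \<le> Z t \<omega>" "\<And>t. 0 \<le> t \<Longrightarrow> Z t \<omega> \<le> 1" if "\<omega> \<in> \<Omega>0" for \<omega>
  proof -
    have *: "(\<Lambda> 0 \<omega> = 0 \<and> mono_on {0..} (\<lambda>t. \<Lambda> t \<omega>) \<and> cadlag (\<lambda>t. \<Lambda> t \<omega>)) \<and>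
      (\<forall>t\<ge>0. Z t \<omega> = exp (- \<Lambda> t \<omega>) * K t \<omega>) \<and> (\<forall>t\<ge>0. 0 \<le> Z t \<omega> \<and> Z t \<omega> \<le> 1)"
      using that N(1) unfolding \<Omega>0_def by blast
    then have mono: "mono_on {0..} (\<lambda>t. \<Lambda> t \<omega>)" and cad: "cadlag (\<lambda>t. \<Lambda> t \<omega>)" and zero: "\<Lambda> 0 \<omega> = 0"
      and rest: "\<forall>t\<ge>0. Z t \<omega> = exp (- \<Lambda> t \<omega>) * K t \<omega>" "\<forall>t\<ge>0. 0 \<le> Z t \<omega> \<and> Z t \<omega> \<le> 1"
      by blast+
    show m: "\<Lambda> s \<omega> \<le> \<Lambda> t \<omega>" if "0 \<le> s" "s \<le> t" for s t
      using mono_onD[OF mono, of s t] that by simp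
    show "\<Lambda> 0 \<omega> = 0" by (rule zero)
    show "0 \<le> \<Lambda> t \<omega>" if "0 \<le> t" for t using m[OF order_refl that] zero by simp
    show "((\<lambda>s. \<Lambda> s \<omega>) \<longlongrightarrow> \<Lambda> t \<omega>) (at_right t)" if "0 \<le> t" for t
      using cad that unfolding cadlag_def by blast
    show "Z t \<omega> = exp (- \<Lambda> t \<omega>) * K t \<omega>" "0 \<le> Z t \<omega>" "Z t \<omega> \<le> 1" if "0 \<le> t" for t
      using rest that by blast+
  qed
  define clip where "clip u = max 0 (min r u)" for u
  have clip: "0 \<le> clip u" "clip u \<le> r" "\<And>v. u \<le> v \<Longrightarrow> clip u \<le> clip v" for u
    using r by (auto simp: clip_def)
  define c where "c \<omega> u = (if \<omega> \<in> \<Omega>0 then 1 - exp (- L (clip u) \<omega>) else 0)" for \<omega> u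
  have c_alt: "c \<omega> = (\<lambda>u. 1 - exp (- \<Lambda> (max 0 (min (\<sigma> r \<omega>) u)) \<omega>))" if "\<omega> \<in> \<Omega>0" for \<omega>
    using that clip_capped_time[OF r] by (auto simp: fun_eq_iff c_def L_def clip_def \<sigma>_def)
  \<comment> \<open>\<open>W q\<close> equals \<open>Z\<close> at time \<open>q \<and> S\<close> almost surely and is measurable at time \<open>q\<close>.\<close>
  define W where "W q \<omega> = exp (- L q \<omega>) * V q \<omega>" for q \<omega>
  have W_meas: "W q \<in> borel_measurable (F (ennreal q))" if "0 \<le> q" for q
    unfolding W_def using L_meas[OF that] V_meas[OF that] by measurable
  have W_eq: "W q \<omega> = Z (\<sigma> q \<omega>) \<omega>" if "0 \<le> q" "\<omega> \<in> \<Omega>0" for q \<omega>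
    using fac[OF that(2)] \<sigma>(1)[OF that(1)] by (simp add: W_def L_def V_def)
  have L_nonneg: "0 \<le> L q \<omega>" if "0 \<le> q" "\<omega> \<in> \<Omega>0" for q \<omega>
    using \<Lambda>0(4)[OF that(2)] \<sigma>(1)[OF that(1)] by (simp add: L_def)
  have V_nonneg: "0 \<le> V q \<omega>" if "0 \<le> q" "\<omega> \<in> \<Omega>0" for q \<omega>
  proof -
    have "0 \<le> exp (- L q \<omega>) * V q \<omega>"
      using W_eq[OF that] Z01(1)[OF that(2)] \<sigma>(1)[OF that(1)] by (simp add: W_def)
    then show ?thesis by (simp add: zero_le_mult_iff)
  qed

  define R where "R = {\<omega>\<in>space M. 0 < \<theta> \<omega> \<and> \<theta> \<omega> \<le> min (ennreal r) (S \<omega>)}"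
  have S_meas: "S \<in> borel_measurable M"
    using sets_F by (intro measurable_stopping_time[OF S]) (auto simp: space_F)
  have duality: "(\<integral>\<^sup>+\<omega>. ennreal (V r \<omega>) * (indicator A \<omega> * ennreal (c \<omega> t - c \<omega> s)) \<partial>M) =
      emeasure M {\<omega>\<in>R. 0 < enn2real (\<theta> \<omega>) \<and> (enn2real (\<theta> \<omega>), \<omega>) \<in> {s<..t} \<times> A}"
    if st: "0 \<le> s" "s \<le> t" and A: "A \<in> sets (F (ennreal s))" for s t A
  proof (cases "s < r")
    case False
    then have "clip s = r" "clip t = r" using st r by (auto simp: clip_def max_absorb2)
    then have c0: "c \<omega> t - c \<omega> s = 0" for \<omega> by (simp add: c_def)
    have empty: "{\<omega>\<in>R. 0 < enn2real (\<theta> \<omega>) \<and> (enn2real (\<theta> \<omega>), \<omega>) \<in> {s<..t} \<times> A} = {}"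
    proof -
      have "enn2real (\<theta> \<omega>) \<le> s" if "\<omega> \<in> R" for \<omega>
      proof -
        have "\<theta> \<omega> \<le> ennreal r" using that by (simp add: R_def)
        then have "enn2real (\<theta> \<omega>) \<le> enn2real (ennreal r)" by (intro enn2real_mono) auto
        then show ?thesis using False r by simp
      qed
      then show ?thesis by (auto simp: not_less[symmetric])
    qed
    show ?thesis unfolding empty c0 by simp
  next
    case True
    define t' where "t' = min r t"
    have t': "s \<le> t'" "t' \<le> r" "0 \<le> t'" using True st by (auto simp: t'_def)
    have cl: "clip s = s" "clip t = t'" using True st t' by (auto simp: clip_def t'_def)
    \<comment> \<open>On \<open>{S \<le> s}\<close> nothing moves between \<open>s \<and> S\<close> and \<open>t' \<and> S\<close>. Removing this part leaves an event \<open>G\<close>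
      to which optional stopping applies at both times.\<close>
    define G where "G = A \<inter> {\<omega>\<in>space M. ennreal s < S \<omega>}"
    have AM: "A \<in> sets M" "A \<subseteq> space M" using sets_F_D[OF A] sets.sets_into_space by auto
    have Af: "A \<in> sets (F (ennreal q))" if "s \<le> q" for q
      by (rule sets_F_le[OF A]) (use that in \<open>intro ennreal_leI\<close>)
    have G_in: "G \<in> sets (F (ennreal q))" if "s \<le> q" for q
    proof (rule sets_F_le)
      have "{\<omega>\<in>space (F (ennreal s)). ennreal s < S \<omega>} \<in> sets (F (ennreal s))"
        using stopping_timeD2[OF S] by (simp add: pred_def)
      then show "G \<in> sets (F (ennreal s))" using A by (auto simp: G_def space_F)
    qed (use that in \<open>intro ennreal_leI\<close>)
    have G_sub: "G \<subseteq> space M" by (auto simp: G_def)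
    have optional: "(\<integral>\<omega>. indicator G \<omega> * W q \<omega> \<partial>M) = measure M {\<omega>\<in>G. ennreal (\<sigma> q \<omega>) < \<theta> \<omega>}"
      if q: "s \<le> q" for q
    proof (rule survival_at_stopping_time[OF \<theta> Z_adapted Z_bounds Z_rc Z_int])
      have q0: "0 \<le> q" using st q by simp
      show "0 \<le> q" by fact
      show "0 \<le> \<sigma> q \<omega> \<and> \<sigma> q \<omega> \<le> q" for \<omega> using \<sigma>[OF q0] by auto
      show "\<sigma> q \<in> borel_measurable M" "W q \<in> borel_measurable M"
        using measurable_F[OF \<sigma>_meas[OF q0]] measurable_F[OF W_meas[OF q0]] by auto
      show "AE \<omega> in M. W q \<omega> = Z (\<sigma> q \<omega>) \<omega>"
        using \<Omega>0(2) by eventually_elim (rule W_eq[OF q0])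
      show "{\<omega>\<in>G. \<sigma> q \<omega> \<le> p} \<in> sets (F (ennreal p))" if p: "0 \<le> p" "p \<le> q" for p
      proof (cases "s \<le> p")
        case True
        show ?thesis
        proof (cases "p = q")
          case True
          then have "{\<omega>\<in>G. \<sigma> q \<omega> \<le> p} = G" using \<sigma>(2)[OF q0] by auto
          then show ?thesis using G_in[OF \<open>s \<le> p\<close>] by simp
        next
          case False
          have "\<sigma> q \<omega> \<le> p \<longleftrightarrow> S \<omega> \<le> ennreal p" for \<omega>
          proof -
            have "\<sigma> q \<omega> \<le> p \<longleftrightarrow> ennreal (\<sigma> q \<omega>) \<le> ennreal p" using p by (simp add: ennreal_le_iff)
            also have "\<dots> \<longleftrightarrow> S \<omega> \<le> ennreal p"
              using \<sigma>(3)[OF q0] False p by (auto simp: min_le_iff_disj ennreal_le_iff)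
            finally show ?thesis .
          qed
          then have "{\<omega>\<in>G. \<sigma> q \<omega> \<le> p} = G \<inter> {\<omega>\<in>space (F (ennreal p)). S \<omega> \<le> ennreal p}"
            using G_sub by (auto simp: space_F)
          moreover have "{\<omega>\<in>space (F (ennreal p)). S \<omega> \<le> ennreal p} \<in> sets (F (ennreal p))"
            using stopping_timeD[OF S] by (simp add: pred_def)
          ultimately show ?thesis using G_in[OF \<open>s \<le> p\<close>] by auto
        qed
      next
        case False
        have "\<not> \<sigma> q \<omega> \<le> p" if "\<omega> \<in> G" for \<omega>
        proof
          assume "\<sigma> q \<omega> \<le> p"
          then have "ennreal (\<sigma> q \<omega>) \<le> ennreal p" by (rule ennreal_leI)
          then have "min (ennreal q) (S \<omega>) \<le> ennreal p" using \<sigma>(3)[OF q0] by simp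
          moreover have "ennreal s < S \<omega>" using that by (simp add: G_def)
          moreover have "ennreal p < ennreal s" using False st p by (simp add: ennreal_less_iff)
          ultimately show False using q False p st
            by (auto simp: min_le_iff_disj ennreal_le_iff)
        qed
        then have "{\<omega>\<in>G. \<sigma> q \<omega> \<le> p} = {}" by auto
        then show ?thesis by (simp only: sets.empty_sets)
      qed
    qed (use G_sub in auto)

    have W_int: "integrable M (\<lambda>\<omega>. indicator A' \<omega> * exp (- L q \<omega>) * V p \<omega>)"
      if "A' \<in> sets M" "0 \<le> q" "0 \<le> p" for A' q p
    proof (rule Bochner_Integration.integrable_bound[OF V_int[OF that(3)]])
      show "(\<lambda>\<omega>. indicator A' \<omega> * exp (- L q \<omega>) * V p \<omega>) \<in> borel_measurable M"
        using that(1) measurable_F[OF L_meas[OF that(2)]] measurable_F[OF V_meas[OF that(3)]] by measurable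
      show "AE \<omega> in M. norm (indicator A' \<omega> * exp (- L q \<omega>) * V p \<omega>) \<le> norm (V p \<omega>)"
        using \<Omega>0(2)
      proof eventually_elim
        case (elim \<omega>)
        have "exp (- L q \<omega>) \<le> 1" using L_nonneg[OF that(2) elim] by simp
        then show ?case by (auto simp: indicator_def abs_mult intro!: mult_left_le_one_le)
      qed
    qed
    \<comment> \<open>The only use of the martingale property: \<open>V r\<close> may be replaced by \<open>V q\<close> against the bounded
      \<open>F\<^sub>q\<close>-measurable factor.\<close>
    have mart: "(\<integral>\<omega>. indicator A \<omega> * exp (- L q \<omega>) * V r \<omega> \<partial>M) = (\<integral>\<omega>. indicator A \<omega> * W q \<omega> \<partial>M)"
      if q: "s \<le> q" "q \<le> r" for q
    proof -
      have q0: "0 \<le> q" using st q by simp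
      have "(\<integral>\<omega>. indicator A \<omega> * exp (- L q \<omega>) * V r \<omega> \<partial>M) =
          (\<integral>\<omega>. indicator A \<omega> * exp (- L q \<omega>) * real_cond_exp M (F (ennreal q)) (V r) \<omega> \<partial>M)"
      proof (rule integral_real_cond_exp_mult[symmetric])
        note [measurable] = L_meas[OF q0] Af[OF q(1)]
        show "(\<lambda>\<omega>. indicator A \<omega> * exp (- L q \<omega>)) \<in> borel_measurable (F (ennreal q))"
          by measurable
      qed (use W_int[OF AM(1) q0 r] measurable_F[OF V_meas[OF r]] in auto)
      also have "\<dots> = (\<integral>\<omega>. indicator A \<omega> * W q \<omega> \<partial>M)"
      proof (rule integral_cong_AE)
        have "real_cond_exp M (F (ennreal q)) (V r) \<in> borel_measurable M" by simp
        then show "(\<lambda>\<omega>. indicator A \<omega> * exp (- L q \<omega>) * real_cond_exp M (F (ennreal q)) (V r) \<omega>)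
            \<in> borel_measurable M"
          using AM(1) measurable_F[OF L_meas[OF q0]] by measurable
        show "(\<lambda>\<omega>. indicator A \<omega> * W q \<omega>) \<in> borel_measurable M"
          using AM(1) measurable_F[OF W_meas[OF q0]] by measurable
        show "AE \<omega> in M. indicator A \<omega> * exp (- L q \<omega>) * real_cond_exp M (F (ennreal q)) (V r) \<omega> =
            indicator A \<omega> * W q \<omega>"
          using V_cond[OF q0 q(2)] by eventually_elim (simp add: W_def)
      qed
      finally show ?thesis .
    qed
    have WA_int: "integrable M (\<lambda>\<omega>. indicator A' \<omega> * W q \<omega>)" if "A' \<in> sets M" "0 \<le> q" for A' q
      using W_int[OF that(1,2,2)] by (simp add: W_def mult.assoc)
    define g where "g \<omega> = indicator A \<omega> * exp (- L s \<omega>) * V r \<omega> - indicator A \<omega> * exp (- L t' \<omega>) * V r \<omega>" for \<omega>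
    have g_int: "integrable M g"
      unfolding g_def using W_int[OF AM(1) st(1) r] W_int[OF AM(1) t'(3) r] by (intro Bochner_Integration.integrable_diff)
    have g_pos: "AE \<omega> in M. 0 \<le> g \<omega>"
      and g_eq: "AE \<omega> in M. ennreal (V r \<omega>) * (indicator A \<omega> * ennreal (c \<omega> t - c \<omega> s)) = ennreal (g \<omega>)"
    proof -
      have main: "0 \<le> g \<omega> \<and> ennreal (V r \<omega>) * (indicator A \<omega> * ennreal (c \<omega> t - c \<omega> s)) = ennreal (g \<omega>)"
        if \<omega>: "\<omega> \<in> \<Omega>0" for \<omega>
      proof -
        have "L s \<omega> \<le> L t' \<omega>"
          unfolding L_def using \<Lambda>0(2)[OF \<omega> \<sigma>(1)[OF st(1)] \<sigma>_mono[OF st(1) t'(1)]] .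
        then have le: "0 \<le> exp (- L s \<omega>) - exp (- L t' \<omega>)" by simp
        have cc: "c \<omega> t - c \<omega> s = exp (- L s \<omega>) - exp (- L t' \<omega>)" using \<omega> by (simp add: c_def cl)
        have g: "g \<omega> = V r \<omega> * (indicator A \<omega> * (exp (- L s \<omega>) - exp (- L t' \<omega>)))"
          by (simp add: g_def algebra_simps)
        show ?thesis
          unfolding g cc using le V_nonneg[OF r \<omega>] by (auto simp: indicator_def ennreal_mult)
      qed
      show "AE \<omega> in M. 0 \<le> g \<omega>" using \<Omega>0(2) by eventually_elim (use main in blast)
      show "AE \<omega> in M. ennreal (V r \<omega>) * (indicator A \<omega> * ennreal (c \<omega> t - c \<omega> s)) = ennreal (g \<omega>)"
        using \<Omega>0(2) by eventually_elim (use main in blast)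
    qed
    have "(\<integral>\<^sup>+\<omega>. ennreal (V r \<omega>) * (indicator A \<omega> * ennreal (c \<omega> t - c \<omega> s)) \<partial>M) = (\<integral>\<^sup>+\<omega>. ennreal (g \<omega>) \<partial>M)"
      using g_eq by (rule nn_integral_cong_AE)
    also have "\<dots> = ennreal (\<integral>\<omega>. g \<omega> \<partial>M)"
      using g_int g_pos by (rule nn_integral_eq_integral)
    also have "(\<integral>\<omega>. g \<omega> \<partial>M) = (\<integral>\<omega>. indicator A \<omega> * W s \<omega> \<partial>M) - (\<integral>\<omega>. indicator A \<omega> * W t' \<omega> \<partial>M)"
      unfolding g_def
      by (subst Bochner_Integration.integral_diff)
        (use W_int[OF AM(1) st(1) r] W_int[OF AM(1) t'(3) r] mart[of s] mart[of t'] True t' in auto)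
    also have "\<dots> = (\<integral>\<omega>. indicator A \<omega> * W s \<omega> - indicator A \<omega> * W t' \<omega> \<partial>M)"
      using WA_int[OF AM(1) st(1)] WA_int[OF AM(1) t'(3)] by simp
    also have "\<dots> = (\<integral>\<omega>. indicator G \<omega> * W s \<omega> - indicator G \<omega> * W t' \<omega> \<partial>M)"
    proof (rule Bochner_Integration.integral_cong[OF refl])
      fix \<omega> assume \<omega>: "\<omega> \<in> space M"
      show "indicator A \<omega> * W s \<omega> - indicator A \<omega> * W t' \<omega> = indicator G \<omega> * W s \<omega> - indicator G \<omega> * W t' \<omega>"
      proof (cases "ennreal s < S \<omega>")
        case False
        then have "S \<omega> \<le> ennreal s" by simp
        moreover have "ennreal s \<le> ennreal t'" using t' by (intro ennreal_leI)
        ultimately have "\<sigma> s \<omega> = \<sigma> t' \<omega>" by (simp add: \<sigma>_def min_absorb2)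
        then have "W s \<omega> = W t' \<omega>" by (simp add: W_def L_def V_def)
        then show ?thesis by simp
      qed (use \<omega> in \<open>simp add: G_def indicator_def\<close>)
    qed
    also have "\<dots> = (\<integral>\<omega>. indicator G \<omega> * W s \<omega> \<partial>M) - (\<integral>\<omega>. indicator G \<omega> * W t' \<omega> \<partial>M)"
      using WA_int[OF sets_F_D[OF G_in[OF order_refl]] st(1)] WA_int[OF sets_F_D[OF G_in[OF order_refl]] t'(3)]
      by simp
    also have "\<dots> = measure M {\<omega>\<in>G. ennreal (\<sigma> s \<omega>) < \<theta> \<omega>} - measure M {\<omega>\<in>G. ennreal (\<sigma> t' \<omega>) < \<theta> \<omega>}"
      using optional[of s] optional[of t'] t' by simp
    also have "\<dots> = measure M ({\<omega>\<in>G. ennreal (\<sigma> s \<omega>) < \<theta> \<omega>} - {\<omega>\<in>G. ennreal (\<sigma> t' \<omega>) < \<theta> \<omega>})"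
    proof (rule finite_measure_Diff[symmetric])
      have "{\<omega>\<in>G. ennreal (\<sigma> q \<omega>) < \<theta> \<omega>} \<in> sets M" if "0 \<le> q" for q
      proof -
        have "{\<omega>\<in>G. ennreal (\<sigma> q \<omega>) < \<theta> \<omega>} = G \<inter> {\<omega>\<in>space M. ennreal (\<sigma> q \<omega>) < \<theta> \<omega>}"
          using G_sub by auto
        moreover have "{\<omega>\<in>space M. ennreal (\<sigma> q \<omega>) < \<theta> \<omega>} \<in> sets M"
          using measurable_F[OF \<sigma>_meas[OF that]] \<theta> by measurable
        ultimately show ?thesis using sets_F_D[OF G_in[OF order_refl]] by auto
      qed
      then show "{\<omega>\<in>G. ennreal (\<sigma> s \<omega>) < \<theta> \<omega>} \<in> sets M" "{\<omega>\<in>G. ennreal (\<sigma> t' \<omega>) < \<theta> \<omega>} \<in> sets M"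
        using st t' by auto
      show "{\<omega>\<in>G. ennreal (\<sigma> t' \<omega>) < \<theta> \<omega>} \<subseteq> {\<omega>\<in>G. ennreal (\<sigma> s \<omega>) < \<theta> \<omega>}"
        using ennreal_leI[OF \<sigma>_mono[OF st(1) t'(1)]] by (auto intro: le_less_trans)
    qed
    also have "{\<omega>\<in>G. ennreal (\<sigma> s \<omega>) < \<theta> \<omega>} - {\<omega>\<in>G. ennreal (\<sigma> t' \<omega>) < \<theta> \<omega>} =
        {\<omega>\<in>R. 0 < enn2real (\<theta> \<omega>) \<and> (enn2real (\<theta> \<omega>), \<omega>) \<in> {s<..t} \<times> A}"
    proof -
      have "\<omega> \<in> G \<and> ennreal (\<sigma> s \<omega>) < \<theta> \<omega> \<and> \<not> ennreal (\<sigma> t' \<omega>) < \<theta> \<omega> \<longleftrightarrow>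
          \<omega> \<in> R \<and> 0 < enn2real (\<theta> \<omega>) \<and> s < enn2real (\<theta> \<omega>) \<and> enn2real (\<theta> \<omega>) \<le> t \<and> \<omega> \<in> A" (is "?l \<longleftrightarrow> ?r") for \<omega>
      proof
        assume l: ?l
        then have "ennreal s < \<theta> \<omega>" "\<theta> \<omega> \<le> ennreal t'" "\<theta> \<omega> \<le> S \<omega>" "\<omega> \<in> A"
          using \<sigma>(3)[OF st(1), of \<omega>] \<sigma>(3)[OF t'(3), of \<omega>] by (auto simp: G_def not_less min_def split: if_splits)
        moreover from this obtain x where x: "\<theta> \<omega> = ennreal x" "0 \<le> x"
          by (cases "\<theta> \<omega>") (auto simp: top_unique)
        ultimately show ?r using st t' AM(2)
          by (auto simp: R_def ennreal_less_iff ennreal_le_iff t'_def)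
      next
        assume rr: ?r
        then have "\<theta> \<omega> \<le> ennreal r" "\<theta> \<omega> \<le> S \<omega>" by (auto simp: R_def)
        moreover from this obtain x where x: "\<theta> \<omega> = ennreal x" "0 \<le> x"
          by (cases "\<theta> \<omega>") (auto simp: top_unique)
        ultimately have "x \<le> t'" "s < x" using rr r by (auto simp: t'_def)
        then have "ennreal s < ennreal x" "ennreal x \<le> ennreal t'" using st by (auto simp: ennreal_less_iff ennreal_leI)
        moreover from this have "ennreal s < S \<omega>" using \<open>\<theta> \<omega> \<le> S \<omega>\<close> x by simp
        ultimately show ?l using rr x \<open>\<theta> \<omega> \<le> S \<omega>\<close> AM(2)
          by (auto simp: G_def \<sigma>(3)[OF st(1)] \<sigma>(3)[OF t'(3)] not_less min_less_iff_disj)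
      qed
      then show ?thesis by auto
    qed
    finally show ?thesis by (simp add: emeasure_eq_measure)
  qed
  have R_meas: "R \<in> sets M" unfolding R_def using \<theta> S_meas by measurable
  have dual: "(\<lambda>\<omega>. emeasure (interval_measure (c \<omega>)) {u. 0 < u \<and> (u, \<omega>) \<in> B}) \<in> borel_measurable M \<and>
    (\<integral>\<^sup>+\<omega>. ennreal (V r \<omega>) * emeasure (interval_measure (c \<omega>)) {u. 0 < u \<and> (u, \<omega>) \<in> B} \<partial>M) =
    emeasure M {\<omega>\<in>R. 0 < enn2real (\<theta> \<omega>) \<and> (enn2real (\<theta> \<omega>), \<omega>) \<in> B}"
  proof (rule predictable_duality)
    fix \<omega> x y assume "\<omega> \<in> space M"
    show "c \<omega> x \<le> c \<omega> y" if "x \<le> y"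
      using \<Lambda>0(2)[of \<omega>, OF _ \<sigma>(1) \<sigma>_mono] clip that by (auto simp: c_def L_def)
    show "0 \<le> c \<omega> x \<and> c \<omega> x \<le> 1"
      using L_nonneg[OF clip(1)] by (auto simp: c_def)
    show "continuous (at_right x) (c \<omega>)"
    proof (cases "\<omega> \<in> \<Omega>0")
      case True
      have "continuous (at_right x) (\<lambda>u. \<Lambda> (max 0 (min (\<sigma> r \<omega>) u)) \<omega>)"
        using \<Lambda>0(3)[OF True] by (intro right_continuous_clip)
      then show ?thesis unfolding c_alt[OF True] by (intro continuous_intros)
    next
      case False
      then have "c \<omega> = (\<lambda>_. 0)" by (auto simp: c_def fun_eq_iff)
      then show ?thesis by simp
    qed
  next
    show "(\<lambda>\<omega>. c \<omega> x) \<in> borel_measurable M" for x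
      unfolding c_def using \<Omega>0(1) measurable_F[OF L_meas[OF clip(1)]] by measurable
    show "(\<lambda>\<omega>. ennreal (V r \<omega>)) \<in> borel_measurable M"
      using measurable_F[OF V_meas[OF r]] by measurable
    show "(\<lambda>\<omega>. enn2real (\<theta> \<omega>)) \<in> borel_measurable M" using \<theta> by measurable
  qed (use R_meas duality B(1) in auto)
  have "emeasure M {\<omega>\<in>R. 0 < enn2real (\<theta> \<omega>) \<and> (enn2real (\<theta> \<omega>), \<omega>) \<in> B} = 0"
  proof -
    have "AE \<omega> in M. \<not> (\<omega> \<in> R \<and> 0 < enn2real (\<theta> \<omega>) \<and> (enn2real (\<theta> \<omega>), \<omega>) \<in> B)"
      using B(2)
    proof eventually_elim
      case (elim \<omega>)
      have "\<theta> \<omega> < \<infinity>" if "\<omega> \<in> R"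
        using that by (auto simp: R_def intro: le_less_trans[OF _ ennreal_less_top])
      then show ?case using elim by (auto simp: R_def zero_less_iff_neq_zero)
    qed
    then have "emeasure M {\<omega>\<in>space M. \<omega> \<in> R \<and> 0 < enn2real (\<theta> \<omega>) \<and> (enn2real (\<theta> \<omega>), \<omega>) \<in> B} = 0"
      by (rule emeasure_eq_0_AE)
    moreover have "{\<omega>\<in>space M. \<omega> \<in> R \<and> 0 < enn2real (\<theta> \<omega>) \<and> (enn2real (\<theta> \<omega>), \<omega>) \<in> B} =
        {\<omega>\<in>R. 0 < enn2real (\<theta> \<omega>) \<and> (enn2real (\<theta> \<omega>), \<omega>) \<in> B}"
      by (auto simp: R_def)
    ultimately show ?thesis by simp
  qed
  with dual have "(\<integral>\<^sup>+\<omega>. ennreal (V r \<omega>) * emeasure (interval_measure (c \<omega>)) {u. 0 < u \<and> (u, \<omega>) \<in> B} \<partial>M) = 0"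
    by simp
  then have "AE \<omega> in M. ennreal (V r \<omega>) * emeasure (interval_measure (c \<omega>)) {u. 0 < u \<and> (u, \<omega>) \<in> B} = 0"
    using dual measurable_F[OF V_meas[OF r]] by (subst (asm) nn_integral_0_iff_AE) auto
  with \<Omega>0(2) Z_pos[OF r] AE_space show ?thesis
  proof eventually_elim
    case (elim \<omega>)
    let ?sec = "{u. 0 < u \<and> (u, \<omega>) \<in> B}"
    show ?case
    proof
      assume rS: "ennreal r \<le> S \<omega>"
      then have \<sigma>r: "\<sigma> r \<omega> = r" using r by (simp add: \<sigma>_def min_absorb1)
      have "0 < V r \<omega>"
      proof -
        have "Z r \<omega> = exp (- \<Lambda> r \<omega>) * V r \<omega>" using fac[OF elim(1) r] by (simp add: V_def \<sigma>r)
        then show ?thesis using elim(2) by (simp add: zero_less_mult_iff)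
      qed
      then have J0: "emeasure (interval_measure (c \<omega>)) ?sec = 0" using elim(4) by auto
      have secB: "?sec \<in> sets borel" by (rule predictable_section[OF filt B(1)])
      have c_eq: "c \<omega> = (\<lambda>u. 1 - exp (- \<Lambda> (max 0 (min r u)) \<omega>))" using c_alt[OF elim(1)] by (simp add: \<sigma>r)
      show "emeasure (increment_measure \<Lambda> \<omega>) (?sec \<inter> {0<..r}) = 0"
        unfolding increment_measure_def
      proof (rule interval_measure_null_transfer[where g = "c \<omega>" and C = "exp (\<Lambda> r \<omega>)"])
        show "emeasure (interval_measure (c \<omega>)) (?sec \<inter> {0<..r}) = 0"
          by (rule emeasure_eq_0[OF _ J0]) (use secB in auto)
        show "continuous (at_right x) (\<lambda>t. \<Lambda> (max 0 t) \<omega>)" for x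
        proof -
          have "continuous (at_right x) (\<lambda>t. \<Lambda> (max 0 (min (\<bar>x\<bar> + 1) t)) \<omega>)"
            using \<Lambda>0(3)[OF elim(1)] by (intro right_continuous_clip)
          moreover have "eventually (\<lambda>t. \<Lambda> (max 0 (min (\<bar>x\<bar> + 1) t)) \<omega> = \<Lambda> (max 0 t) \<omega>) (at_right x)"
            unfolding eventually_at_right_field by (intro exI[of _ "\<bar>x\<bar> + 1"]) auto
          ultimately show ?thesis
            unfolding continuous_within by (auto intro: Lim_transform_eventually)
        qed
        have "continuous (at_right x) (\<lambda>u. \<Lambda> (max 0 (min r u)) \<omega>)" for x
          using \<Lambda>0(3)[OF elim(1)] by (intro right_continuous_clip)
        then show "continuous (at_right x) (c \<omega>)" for x unfolding c_eq by (intro continuous_intros)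
        show "c \<omega> x \<le> c \<omega> y" if "x \<le> y" for x y
          unfolding c_eq using that r \<Lambda>0(2)[OF elim(1)] by simp
        show "\<Lambda> (max 0 x) \<omega> \<le> \<Lambda> (max 0 y) \<omega>" if "x \<le> y" for x y
          using that \<Lambda>0(2)[OF elim(1)] by simp
        show "\<Lambda> (max 0 y) \<omega> - \<Lambda> (max 0 x) \<omega> \<le> exp (\<Lambda> r \<omega>) * (c \<omega> y - c \<omega> x)"
          if xy: "0 \<le> x" "x \<le> y" "y \<le> r" for x y
        proof -
          have le: "\<Lambda> x \<omega> \<le> \<Lambda> y \<omega>" "\<Lambda> y \<omega> \<le> \<Lambda> r \<omega>" using \<Lambda>0(2)[OF elim(1)] xy by auto
          \<comment> \<open>Convexity of the exponential bounds \<open>d\<Lambda>\<close> by \<open>e\<^sup>\<Lambda> d(1 - e\<^sup>-\<^sup>\<Lambda>)\<close>, at jumps of \<open>\<Lambda>\<close> as well.\<close>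
          have "\<Lambda> y \<omega> - \<Lambda> x \<omega> \<le> exp (\<Lambda> y \<omega> - \<Lambda> x \<omega>) - 1"
            using exp_ge_add_one_self[of "\<Lambda> y \<omega> - \<Lambda> x \<omega>"] by linarith
          also have "\<dots> = 1 * (exp (\<Lambda> y \<omega> - \<Lambda> x \<omega>) - 1)" by simp
          also have "\<dots> \<le> exp (\<Lambda> r \<omega> - \<Lambda> y \<omega>) * (exp (\<Lambda> y \<omega> - \<Lambda> x \<omega>) - 1)"
            using le by (intro mult_right_mono) auto
          also have "\<dots> = exp (\<Lambda> r \<omega>) * (exp (- \<Lambda> x \<omega>) - exp (- \<Lambda> y \<omega>))"
            by (simp add: algebra_simps flip: exp_add)
          also have "exp (- \<Lambda> x \<omega>) - exp (- \<Lambda> y \<omega>) = c \<omega> y - c \<omega> x"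
            unfolding c_eq using xy by simp
          finally show ?thesis using xy by simp
        qed
      qed (use r secB in auto)
    qed
  qed
qed

text \<open>
  The random time \<open>\<theta>\<close> is seen from \<open>F\<close> only through its conditional survival probability \<open>Z\<close>. The
  local statements are combined over integer \<open>r\<close> and over a localizing sequence, which involves
  countably many exceptional sets.
\<close>

lemma (in filtered_prob_space) compensator_null_on_avoided_set:
  fixes Z \<Lambda> K :: "real \<Rightarrow> 'w \<Rightarrow> real" and \<theta> :: "'w \<Rightarrow> ennreal"
  assumes \<theta>: "\<theta> \<in> borel_measurable M"
    and Z_adapted: "adapted F Z"
    and Z_bounds: "AE \<omega> in M. \<forall>t\<ge>0. 0 \<le> Z t \<omega> \<and> Z t \<omega> \<le> 1"
    and Z_rc: "AE \<omega> in M. \<forall>t\<ge>0. ((\<lambda>s. Z s \<omega>) \<longlongrightarrow> Z t \<omega>) (at_right t)"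
    and Z_int: "\<And>t A. 0 \<le> t \<Longrightarrow> A \<in> sets (F (ennreal t)) \<Longrightarrow>
        (\<integral>\<omega>. indicator A \<omega> * Z t \<omega> \<partial>M) = measure M {\<omega>\<in>A. ennreal t < \<theta> \<omega>}"
    and Z_pos: "\<And>t. 0 \<le> t \<Longrightarrow> AE \<omega> in M. 0 < Z t \<omega>"
    and decomposition: "multiplicative_decomposition M F Z \<Lambda> K"
    and B: "B \<in> sets (predictable_sigma (space M) F)"
      "AE \<omega> in M. 0 < \<theta> \<omega> \<and> \<theta> \<omega> < \<infinity> \<longrightarrow> (enn2real (\<theta> \<omega>), \<omega>) \<notin> B"
  shows "AE \<omega> in M. AE t in increment_measure \<Lambda> \<omega>. 0 < t \<longrightarrow> (t, \<omega>) \<notin> B"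
proof -
  have \<Lambda>: "predictable (space M) F \<Lambda>"
      "AE \<omega> in M. \<Lambda> 0 \<omega> = 0 \<and> mono_on {0..} (\<lambda>t. \<Lambda> t \<omega>) \<and> cadlag (\<lambda>t. \<Lambda> t \<omega>)"
    and factor: "AE \<omega> in M. \<forall>t\<ge>0. Z t \<omega> = exp (- \<Lambda> t \<omega>) * K t \<omega>"
    and K: "local_martingale M F K"
    using decomposition by (auto simp: multiplicative_decomposition_def)
  obtain S :: "nat \<Rightarrow> 'w \<Rightarrow> ennreal" where S: "\<And>k. stopping_time F (S k)"
      "AE \<omega> in M. incseq (\<lambda>k. S k \<omega>) \<and> (SUP k. S k \<omega>) = \<infinity>"
      "\<And>k. martingale M F (stopped K (S k))"
    using K unfolding local_martingale_def by blast
  have "AE \<omega> in M. \<forall>k (n::nat). ennreal (real n) \<le> S k \<omega> \<longrightarrow>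
      emeasure (increment_measure \<Lambda> \<omega>) ({u. 0 < u \<and> (u, \<omega>) \<in> B} \<inter> {0<..real n}) = 0"
    unfolding AE_all_countable
    by (intro allI compensator_null_before_stopping[OF \<theta> Z_adapted Z_bounds Z_rc Z_int Z_pos \<Lambda> factor S(1) S(3) _ B]) auto
  with S(2) AE_space show ?thesis
  proof eventually_elim
    case (elim \<omega>)
    let ?sec = "{u. 0 < u \<and> (u, \<omega>) \<in> B}"
    have sec_meas: "?sec \<in> sets borel"
      using predictable_section[OF _ B(1)] filtration_axioms by blast
    have "?sec \<inter> {0<..real n} \<in> null_sets (increment_measure \<Lambda> \<omega>)" for n :: nat
    proof -
      have "ennreal (real n) < (SUP k. S k \<omega>)"
        using elim(1) by (metis ennreal_less_top infinity_ennreal_def)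
      then obtain k where "ennreal (real n) < S k \<omega>" by (auto simp: less_SUP_iff)
      then have "emeasure (increment_measure \<Lambda> \<omega>) (?sec \<inter> {0<..real n}) = 0"
        using elim(3) by (auto dest: less_imp_le)
      then show ?thesis using sec_meas by (auto simp: null_sets_def increment_measure_def)
    qed
    then have "(\<Union>n. ?sec \<inter> {0<..real n}) \<in> null_sets (increment_measure \<Lambda> \<omega>)"
      by (intro null_sets_UN)
    also have "(\<Union>n. ?sec \<inter> {0<..real n}) = ?sec"
      using real_arch_simple by auto
    finally show ?case
      by (intro AE_I[of _ _ ?sec]) (auto simp: null_sets_def)
  qed
qed

section \<open>Continuity and compactness in the state spaces\<close>

lemma open_singleton_None: "open {None :: 'a::topological_space option}"
proof -
  have "Some -` {None} = ({} :: 'a set)" by auto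
  then show ?thesis unfolding open_option_def by simp
qed

text \<open>
  The cemetery is isolated, so continuity is decided on the state space alone.
\<close>

lemma continuous_on_option:
  fixes f :: "'a::topological_space option \<Rightarrow> 'b::topological_space"
  assumes "continuous_on UNIV (\<lambda>y. f (Some y))"
  shows "continuous_on UNIV f"
proof -
  have "open (f -` U)" if "open U" for U
  proof -
    have "open ((\<lambda>y. f (Some y)) -` U)"
      using assms that by (simp add: continuous_on_open_vimage)
    also have "(\<lambda>y. f (Some y)) -` U = Some -` (f -` U)" by auto
    finally show ?thesis by (simp add: open_option_def)
  qed
  then show ?thesis by (simp add: continuous_on_open_vimage)
qed

lemma continuous_on_map_option:
  assumes "continuous_on UNIV f"
  shows "continuous_on UNIV (map_option f)"
proof (rule continuous_on_option)
  have "open ((\<lambda>y. Some (f y)) -` U)" if "open U" for U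
  proof -
    have "open (f -` (Some -` U))"
      using assms that by (simp add: continuous_on_open_vimage open_option_def)
    also have "f -` (Some -` U) = (\<lambda>y. Some (f y)) -` U" by auto
    finally show ?thesis .
  qed
  then show "continuous_on UNIV (\<lambda>y. map_option f (Some y))"
    by (simp add: continuous_on_open_vimage)
qed

lemma tendsto_continuous_UNIV:
  assumes "continuous_on UNIV f" "(g \<longlongrightarrow> l) F"
  shows "((\<lambda>x. f (g x)) \<longlongrightarrow> f l) F"
  using continuous_on_tendsto_compose[OF assms] by simp

lemma sigma_compact_second_countable:
  assumes "locally_compact_space (euclidean :: ('a::second_countable_topology) topology)"
  obtains K :: "nat \<Rightarrow> 'a::second_countable_topology set" where "\<And>n. compact (K n)" "(\<Union>n. K n) = UNIV"
proof -
  have "\<exists>U C. open U \<and> compact C \<and> x \<in> U \<and> U \<subseteq> C" for x :: 'a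
    using assms unfolding locally_compact_space_def by (simp flip: open_openin)
  then obtain U C where UC: "\<And>x::'a. open (U x)" "\<And>x. compact (C x)" "\<And>x. x \<in> U x" "\<And>x. U x \<subseteq> C x"
    by metis
  obtain F' where F': "F' \<subseteq> range U" "countable F'" "\<Union>F' = \<Union>(range U)"
    using Lindelof[of "range U"] UC(1) by auto
  then obtain X where X: "countable X" "F' = U ` X"
    by (metis countable_subset_image)
  have cover: "(\<Union>x\<in>X. C x) = UNIV"
  proof -
    have "x \<in> (\<Union>x\<in>X. C x)" for x
    proof -
      have "x \<in> \<Union>F'" using F'(3) UC(3) by blast
      then show ?thesis using X(2) UC(4) by blast
    qed
    then show ?thesis by auto
  qed
  then have "X \<noteq> {}" by auto
  then have "range (from_nat_into X) = X" using X(1) by (rule range_from_nat_into)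
  then have "(\<Union>n. C (from_nat_into X n)) = UNIV" using cover by (metis image_image)
  then show ?thesis using that[of "\<lambda>n. C (from_nat_into X n)"] UC(2) by blast
qed

section \<open>Events of the canonical filtrations\<close>

lemma space_right_filtration: "space (right_filtration \<Omega> V t) = \<Omega>"
  using filtration.space_F[OF filtration_right_filtration] .

lemma sets_process_sigma_coordinate:
  assumes "s \<in> I" "B \<in> sets borel"
  shows "{\<omega>\<in>\<Omega>. V s \<omega> \<in> B} \<in> sets (process_sigma \<Omega> V I)"
proof -
  have "V s -` B \<inter> \<Omega> \<in> sets (vimage_algebra \<Omega> (V s) borel)"
    using assms(2) by (rule in_vimage_algebra)
  then have "V s -` B \<inter> \<Omega> \<in> (\<Union>s\<in>I. sets (vimage_algebra \<Omega> (V s) borel))"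
    using assms(1) by blast
  moreover have "(\<Union>s\<in>I. sets (vimage_algebra \<Omega> (V s) borel)) \<subseteq> Pow \<Omega>"
    using sets.space_closed[of "vimage_algebra \<Omega> (V _) borel"] by auto
  moreover have "V s -` B \<inter> \<Omega> = {\<omega>\<in>\<Omega>. V s \<omega> \<in> B}" by auto
  ultimately show ?thesis unfolding process_sigma_def by (simp add: sets_measure_of)
qed

lemma sets_right_filtration_coordinate:
  assumes "0 \<le> s" "B \<in> sets borel"
  shows "{\<omega>\<in>\<Omega>. V s \<omega> \<in> B} \<in> sets (right_filtration \<Omega> V (ennreal s))"
proof -
  have "{\<omega>\<in>\<Omega>. V s \<omega> \<in> B} \<in> sets (process_sigma \<Omega> V {0..u})" if "ennreal s < ennreal u" for u
    using that assms by (intro sets_process_sigma_coordinate) (auto simp: ennreal_less_iff)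
  then show ?thesis by (subst sets_right_filtration_finite) auto
qed

lemma sets_image_filtration_subset:
  assumes \<pi>: "continuous_on UNIV \<pi>"
  shows "sets (image_filtration \<pi> t) \<subseteq> sets (path_filtration t)"
proof -
  have sub: "sets (process_sigma path_space (image_process \<pi>) I) \<subseteq>
      sets (process_sigma path_space (\<lambda>t \<omega>. \<omega> t) I)" for I
  proof -
    have "A \<in> sets (process_sigma path_space (\<lambda>t \<omega>. \<omega> t) I)"
      if sI: "s \<in> I" and A: "A \<in> sets (vimage_algebra path_space (image_process \<pi> s) borel)" for s A
    proof -
      have "sets (vimage_algebra path_space (image_process \<pi> s) (borel :: 'b option measure)) =
          {image_process \<pi> s -` B \<inter> path_space | B. B \<in> sets borel}"
        by (intro sets_vimage_algebra2) auto
      then obtain B where B: "B \<in> sets borel" "A = image_process \<pi> s -` B \<inter> path_space"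
        using A by auto
      have "map_option \<pi> \<in> borel_measurable borel"
        by (rule borel_measurable_continuous_onI[OF continuous_on_map_option[OF \<pi>]])
      then have "map_option \<pi> -` B \<in> sets borel" using B(1) measurable_sets_borel by blast
      from sets_process_sigma_coordinate[OF sI this, of path_space "\<lambda>t \<omega>. \<omega> t"]
      show ?thesis using B(2) by (simp add: image_process_def vimage_def Int_def conj_commute)
    qed
    then have "(\<Union>s\<in>I. sets (vimage_algebra path_space (image_process \<pi> s) borel)) \<subseteq>
        sets (process_sigma path_space (\<lambda>t \<omega>. \<omega> t) I)" by auto
    from sets.sigma_sets_subset[OF this] show ?thesis
      unfolding process_sigma_def[of _ "image_process \<pi>"]
      using sets.space_closed[of "vimage_algebra path_space (image_process \<pi> _) borel"]
      by (subst sets_measure_of) auto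
  qed
  show ?thesis
  proof (cases "t = \<infinity>")
    case True
    then show ?thesis using sub by (simp add: image_filtration_def path_filtration_def right_filtration_def)
  next
    case False
    then have "t < \<infinity>" by (simp add: top.not_eq_extremum)
    then show ?thesis using sub unfolding image_filtration_def path_filtration_def
      by (fastforce simp: sets_right_filtration_finite)
  qed
qed

lemma filtration_path: "filtration path_space path_filtration"
  unfolding path_filtration_def by (rule filtration_right_filtration)

lemma filtration_image: "filtration path_space (image_filtration \<pi>)"
  unfolding image_filtration_def by (rule filtration_right_filtration)

text \<open>
  A generator \<open>A \<inter> {t < T}\<close> meets \<open>{T \<le> s}\<close> only if \<open>t < s\<close>, and \<open>A\<close> is known at time \<open>s\<close> in that
  case.
\<close>

lemma sets_strict_past_subset_pre_sigma:
  fixes F :: "ennreal \<Rightarrow> 'w measure"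
  assumes F: "filtration \<Omega> F" and T: "stopping_time F T"
  shows "sets (strict_past \<Omega> F T) \<subseteq> sets (filtration.pre_sigma \<Omega> F T)"
proof -
  interpret filtration \<Omega> F by fact
  have sub: "A \<subseteq> \<Omega>" if "A \<in> sets (F s)" for A s
    using sets.sets_into_space[OF that] by (simp add: space_F)
  let ?G = "sets (F 0) \<union> {A \<inter> {\<omega> \<in> \<Omega>. t < T \<omega>} | A t. A \<in> sets (F t)}"
  have S: "{\<omega>\<in>\<Omega>. T \<omega> \<le> s} \<in> sets (F s)" "{\<omega>\<in>\<Omega>. s < T \<omega>} \<in> sets (F s)" for s
    using stopping_timeD[OF T, of s] stopping_timeD2[OF T, of s] by (auto simp: pred_def space_F)
  have "?G \<subseteq> sets (pre_sigma T)"
  proof (intro subsetI)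
    fix B assume "B \<in> ?G"
    then consider "B \<in> sets (F 0)" | A t where "B = A \<inter> {\<omega> \<in> \<Omega>. t < T \<omega>}" "A \<in> sets (F t)" by blast
    then show "B \<in> sets (pre_sigma T)"
    proof cases
      case 1
      show ?thesis
      proof (rule sets_pre_sigmaI[OF T])
        fix t
        have "{\<omega>\<in>B. T \<omega> \<le> t} = B \<inter> {\<omega>\<in>\<Omega>. T \<omega> \<le> t}" using sub[OF 1] by auto
        then show "{\<omega>\<in>B. T \<omega> \<le> t} \<in> sets (F t)" using 1 sets_F_mono[of 0 t] S(1)[of t] by auto
      qed
    next
      case 2
      show ?thesis
      proof (rule sets_pre_sigmaI[OF T])
        fix s
        show "{\<omega>\<in>B. T \<omega> \<le> s} \<in> sets (F s)"
        proof (cases "t \<le> s")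
          case True
          then have "A \<in> sets (F s)" "{\<omega>\<in>\<Omega>. t < T \<omega>} \<in> sets (F s)"
            using 2 S(2)[of t] sets_F_mono[OF True] by auto
          moreover have "{\<omega>\<in>B. T \<omega> \<le> s} = A \<inter> {\<omega>\<in>\<Omega>. t < T \<omega>} \<inter> {\<omega>\<in>\<Omega>. T \<omega> \<le> s}"
            using 2 by auto
          ultimately show ?thesis using S(1)[of s] by auto
        next
          case False
          then have empty: "{\<omega>\<in>B. T \<omega> \<le> s} = {}" using 2 by auto
          show ?thesis unfolding empty by (rule sets.empty_sets)
        qed
      qed
    qed
  qed
  from sets.sigma_sets_subset[OF this] show ?thesis
    unfolding strict_past_def using sub by (subst sets_measure_of) (auto simp: space_pre_sigma)
qed

lemma sets_strict_pastI:
  fixes F :: "ennreal \<Rightarrow> 'w measure"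
  assumes F: "filtration \<Omega> F" and A: "A \<in> sets (F t)"
  shows "A \<inter> {\<omega> \<in> \<Omega>. t < T \<omega>} \<in> sets (strict_past \<Omega> F T)"
proof -
  interpret filtration \<Omega> F by fact
  have "B \<subseteq> \<Omega>" if "B \<in> sets (F s)" for B s
    using sets.sets_into_space[OF that] by (simp add: space_F)
  then have "sets (F 0) \<union> {A \<inter> {\<omega> \<in> \<Omega>. t < T \<omega>} | A t. A \<in> sets (F t)} \<subseteq> Pow \<Omega>" by blast
  then show ?thesis unfolding strict_past_def using A
    by (subst sets_measure_of) (auto intro!: sigma_sets.Basic)
qed

lemma space_strict_past:
  fixes F :: "ennreal \<Rightarrow> 'w measure"
  assumes F: "filtration \<Omega> F"
  shows "space (strict_past \<Omega> F T) = \<Omega>"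
proof -
  interpret filtration \<Omega> F by fact
  have "B \<subseteq> \<Omega>" if "B \<in> sets (F s)" for B s
    using sets.sets_into_space[OF that] by (simp add: space_F)
  then have "sets (F 0) \<union> {A \<inter> {\<omega> \<in> \<Omega>. t < T \<omega>} | A t. A \<in> sets (F t)} \<subseteq> Pow \<Omega>" by blast
  then show ?thesis unfolding strict_past_def by (simp add: space_measure_of)
qed

section \<open>Left limits as a predictable condition\<close>

lemma image_process_right_continuous:
  assumes "continuous_on UNIV \<pi>" "\<omega> \<in> path_space" "0 \<le> s"
  shows "((\<lambda>t. image_process \<pi> t \<omega>) \<longlongrightarrow> image_process \<pi> s \<omega>) (at_right s)"
  unfolding image_process_def
  using assms by (intro tendsto_continuous_UNIV[OF continuous_on_map_option]) (auto simp: path_space_def)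

text \<open>
  At all rational times of the window \<open>[t - 1 / (m + 1), t)\<close> the path of \<open>X\<close> is in \<open>W\<close>. Among the
  positive times \<open>t\<close>, the complement is a countable union of rectangles
  \<open>(q, q + 1 / (m + 1)] \<times> {X\<^sub>q \<notin> W}\<close> over rational \<open>q\<close>, and these are generators of the
  predictable \<open>\<sigma>\<close>-algebra.
\<close>

lemma predictable_left_window:
  fixes \<pi> :: "'e::topological_space \<Rightarrow> 'd::topological_space"
  assumes W: "closed W"
  shows "{(t, \<omega>). 0 < t \<and> \<omega> \<in> path_space \<and>
      (\<forall>q\<in>\<rat>. 0 \<le> q \<and> t - 1 / real (Suc m) \<le> q \<and> q < t \<longrightarrow> image_process \<pi> q \<omega> \<in> W)}
    \<in> sets (predictable_sigma path_space (image_filtration \<pi>))" (is "?N \<in> _")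
proof -
  note Ioc = sets_predictable_sigma_Ioc[OF filtration_image[of \<pi>]]
  let ?out = "\<lambda>q. {\<omega>\<in>path_space. image_process \<pi> q \<omega> \<in> - W}"
  have "path_space \<in> sets (image_filtration \<pi> (ennreal 0))"
    using sets.top[of "image_filtration \<pi> (ennreal 0)"]
    by (simp only: filtration.space_F[OF filtration_image])
  then have A: "(\<Union>n. {0<..real n} \<times> path_space) \<in> sets (predictable_sigma path_space (image_filtration \<pi>))"
    using Ioc[of 0] by blast
  have "?out q \<in> sets (image_filtration \<pi> (ennreal q))" if "0 \<le> q" for q
    unfolding image_filtration_def using W that by (intro sets_right_filtration_coordinate) auto
  then have "{q<..q + 1 / real (Suc m)} \<times> ?out q \<in> sets (predictable_sigma path_space (image_filtration \<pi>))"
    if "0 \<le> q" for q using Ioc that by blast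
  then have B: "(\<Union>q\<in>{q\<in>\<rat>. 0 \<le> q}. {q<..q + 1 / real (Suc m)} \<times> ?out q)
      \<in> sets (predictable_sigma path_space (image_filtration \<pi>))"
    by (intro sets.countable_UN') (auto intro: countable_subset[OF _ countable_rat])
  have "?N = (\<Union>n. {0<..real n} \<times> path_space) - (\<Union>q\<in>{q\<in>\<rat>. 0 \<le> q}. {q<..q + 1 / real (Suc m)} \<times> ?out q)"
  proof (intro set_eqI)
    fix x :: "real \<times> (real \<Rightarrow> 'e option)"
    obtain t \<omega> where x: "x = (t, \<omega>)" by (cases x)
    have "\<exists>n. t \<le> real n" by (rule real_arch_simple)
    moreover have "t - 1 / real (Suc m) \<le> q \<longleftrightarrow> t \<le> q + 1 / real (Suc m)" for q by linarith
    ultimately show "x \<in> ?N \<longleftrightarrow> x \<in> (\<Union>n. {0<..real n} \<times> path_space) -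
        (\<Union>q\<in>{q\<in>\<rat>. 0 \<le> q}. {q<..q + 1 / real (Suc m)} \<times> ?out q)"
      unfolding x by auto
  qed
  then show ?thesis using A B by auto
qed

text \<open>
  \<open>X\<close> converges to a point of the compact set \<open>C n\<close> from the left iff for every \<open>k\<close> it eventually
  stays within \<open>1 / (k + 1)\<close> of one point \<open>a\<close> of \<open>C n\<close>. By total boundedness the point can be taken
  from a finite net \<open>A n k\<close>, so only countably many conditions occur. Conversely, a subsequence of the
  centres \<open>a k\<close> converges in \<open>C n\<close>, and its limit is the left limit. Compactness of \<open>C n\<close> replaces
  completeness and separability of the whole space.
\<close>

lemma predictable_left_limit:
  fixes \<pi> :: "'e::topological_space \<Rightarrow> 'd::topological_space" and C :: "nat \<Rightarrow> 'd set"
  assumes D: "metrizable_space (euclidean :: 'd topology)"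
    and \<pi>: "continuous_on UNIV \<pi>" and C: "\<And>n. compact (C n)"
  shows "{(t, \<omega>). 0 < t \<and> \<omega> \<in> path_space \<and>
      (\<exists>x\<in>\<Union>n. C n. ((\<lambda>s. image_process \<pi> s \<omega>) \<longlongrightarrow> Some x) (at_left t))}
    \<in> sets (predictable_sigma path_space (image_filtration \<pi>))" (is "?L \<in> sets ?P")
proof -
  obtain M d where Md: "Metric_space M d" "(euclidean :: 'd topology) = Metric_space.mtopology M d"
    using D unfolding metrizable_space_def by blast
  interpret Metric_space M d by fact
  have M: "M = UNIV" using topspace_mtopology unfolding Md(2)[symmetric] by simp
  have op: "open (mball a e)" for a e unfolding open_openin Md(2) by (rule openin_mball)
  have cl: "closed (mcball a e)" for a e unfolding closed_closedin Md(2) by (rule closedin_mcball)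
  have cmp: "compactin mtopology (C n)" for n using C[of n] unfolding Md(2)[symmetric] by simp
  then have "mtotally_bounded (C n)" for n by (rule compactin_imp_mtotally_bounded)
  then have "\<exists>A. finite A \<and> A \<subseteq> C n \<and> C n \<subseteq> (\<Union>a\<in>A. mball a (1 / real (Suc k)))" for n k
    unfolding mtotally_bounded_def by (auto elim!: allE[of _ "1 / real (Suc k)"])
  then obtain A where A: "\<And>n k. finite (A n k)" "\<And>n k. A n k \<subseteq> C n"
      "\<And>n k. C n \<subseteq> (\<Union>a\<in>A n k. mball a (1 / real (Suc k)))"
    by metis
  define W where "W a k = Some ` mcball a (1 / real (Suc k))" for a k
  \<comment> \<open>Closed balls are used because membership at rational times then extends to all times by right
    continuity.\<close>
  have W: "closed (W a k)" for a k
  proof -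
    have "Some -` (- W a k) = - mcball a (1 / real (Suc k))" by (auto simp: W_def)
    then show ?thesis unfolding closed_def open_option_def using cl by (simp add: open_Compl)
  qed
  define near where "near a k m = {(t, \<omega>). 0 < t \<and> \<omega> \<in> path_space \<and>
      (\<forall>q\<in>\<rat>. 0 \<le> q \<and> t - 1 / real (Suc m) \<le> q \<and> q < t \<longrightarrow> image_process \<pi> q \<omega> \<in> W a k)}" for a k m
  have near: "near a k m \<in> sets ?P" for a k m
    unfolding near_def by (rule predictable_left_window[OF W])
  have "(\<Union>n. \<Inter>k. \<Union>a\<in>A n k. \<Union>m. near a k m) \<in> sets ?P"
    using near A(1) by (intro sets.countable_UN sets.countable_INT sets.finite_UN image_subsetI) auto
  also have "(\<Union>n. \<Inter>k. \<Union>a\<in>A n k. \<Union>m. near a k m) = ?L"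
  proof (intro set_eqI iffI)
    fix x assume x: "x \<in> ?L"
    then obtain t \<omega> n l where *: "x = (t, \<omega>)" "0 < t" "\<omega> \<in> path_space" "l \<in> C n"
        "((\<lambda>s. image_process \<pi> s \<omega>) \<longlongrightarrow> Some l) (at_left t)"
      by auto
    have "\<exists>a\<in>A n k. \<exists>m. x \<in> near a k m" for k
    proof -
      obtain a where a: "a \<in> A n k" "l \<in> mball a (1 / real (Suc k))" using A(3) *(4) by blast
      have "open (Some ` mball a (1 / real (Suc k)))"
        using op by (simp add: open_option_def inj_vimage_image_eq)
      then have "eventually (\<lambda>s. image_process \<pi> s \<omega> \<in> Some ` mball a (1 / real (Suc k))) (at_left t)"
        using *(5) a(2) by (auto dest: topological_tendstoD)
      then obtain b where b: "b < t" "\<And>s. b < s \<Longrightarrow> s < t \<Longrightarrow> image_process \<pi> s \<omega> \<in> Some ` mball a (1 / real (Suc k))"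
        unfolding eventually_at_left_field by blast
      obtain m where m: "1 / real (Suc m) < t - b"
        using b(1) by (metis diff_gt_0_iff_gt nat_approx_posE)
      have "image_process \<pi> q \<omega> \<in> W a k" if "t - 1 / real (Suc m) \<le> q" "q < t" for q
      proof -
        have "b < q" using that m by linarith
        then have "image_process \<pi> q \<omega> \<in> Some ` mball a (1 / real (Suc k))" using b(2) that by blast
        then show ?thesis unfolding W_def using mball_subset_mcball by blast
      qed
      then have "x \<in> near a k m"
        unfolding near_def *(1) using *(2,3) by blast
      then show ?thesis using a by blast
    qed
    then have "x \<in> (\<Inter>k. \<Union>a\<in>A n k. \<Union>m. near a k m)" by simp
    then show "x \<in> (\<Union>n. \<Inter>k. \<Union>a\<in>A n k. \<Union>m. near a k m)" by (rule UN_I[OF UNIV_I])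
  next
    fix x assume "x \<in> (\<Union>n. \<Inter>k. \<Union>a\<in>A n k. \<Union>m. near a k m)"
    then obtain n where "x \<in> (\<Inter>k. \<Union>a\<in>A n k. \<Union>m. near a k m)" by (rule UN_E)
    then have n: "\<exists>a\<in>A n k. \<exists>m. x \<in> near a k m" for k by simp
    obtain t \<omega> where x: "x = (t, \<omega>)" by (cases x)
    from n[of 0] have t: "0 < t" and \<omega>: "\<omega> \<in> path_space" by (auto simp: near_def x)
    have "\<forall>k. \<exists>a. a \<in> A n k \<and> (\<exists>m. x \<in> near a k m)" using n by (simp add: Bex_def)
    from choice[OF this] obtain a where a: "\<And>k. a k \<in> A n k" "\<forall>k. \<exists>m. x \<in> near (a k) k m" by blast
    from choice[OF a(2)] obtain m where m: "\<And>k. x \<in> near (a k) k (m k)" by blast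
    note am = a(1) m
    have stays: "eventually (\<lambda>s. image_process \<pi> s \<omega> \<in> W (a k) k) (at_left t)" for k
      unfolding eventually_at_left_field
    proof (intro exI conjI allI impI)
      show "max 0 (t - 1 / real (Suc (m k))) < t" using t by auto
      fix s assume s: "max 0 (t - 1 / real (Suc (m k))) < s" "s < t"
      have lim: "(\<lambda>j. image_process \<pi> (grid j s) \<omega>) \<longlonglongrightarrow> image_process \<pi> s \<omega>"
        by (rule right_continuous_along_sequence[where f = "\<lambda>t. image_process \<pi> t \<omega>"])
          (use s image_process_right_continuous[OF \<pi> \<omega>] grid_tendsto grid_ge in auto)
      have "eventually (\<lambda>j. grid j s < t) sequentially"
        using order_tendstoD(2)[OF grid_tendsto s(2)] .
      then have "eventually (\<lambda>j. image_process \<pi> (grid j s) \<omega> \<in> W (a k) k) sequentially"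
      proof eventually_elim
        case (elim j)
        have "s \<le> grid j s" by (rule grid_ge)
        then have "0 \<le> grid j s" "t - 1 / real (Suc (m k)) \<le> grid j s" using s by linarith+
        then show ?case using am(2)[of k] elim grid_rational[of j s] unfolding x near_def by blast
      qed
      then show "image_process \<pi> s \<omega> \<in> W (a k) k"
        using Lim_in_closed_set[OF W _ _ lim] by simp
    qed
    have "range a \<subseteq> C n" using am(1) A(2) by blast
    then obtain l r where l: "l \<in> C n" "strict_mono r" "limitin mtopology (a \<circ> r) l sequentially"
      using cmp unfolding compactin_sequentially by blast
    have "((\<lambda>s. image_process \<pi> s \<omega>) \<longlongrightarrow> Some l) (at_left t)"
    proof (rule topological_tendstoI)
      fix U :: "'d option set" assume U: "open U" "Some l \<in> U"
      then have "openin mtopology (Some -` U)" unfolding Md(2)[symmetric] open_openin[symmetric] open_option_def by blast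
      then obtain e where e: "e > 0" "mball l e \<subseteq> Some -` U"
        using U(2) unfolding openin_mtopology by auto
      have "eventually (\<lambda>j. d ((a \<circ> r) j) l < e / 2) sequentially"
        using l(3) e(1) by (auto simp: limitin_metric elim!: allE[of _ "e / 2"] eventually_mono)
      moreover have "eventually (\<lambda>j. 1 / real (Suc j) < e / 2) sequentially"
        using order_tendstoD(2)[OF LIMSEQ_inverse_real_of_nat, of "e / 2"] e(1) by (simp add: inverse_eq_divide)
      ultimately have "eventually (\<lambda>j. d (a (r j)) l < e / 2 \<and> 1 / real (Suc j) < e / 2) sequentially"
        by eventually_elim simp
      then obtain j where j: "d (a (r j)) l < e / 2" "1 / real (Suc j) < e / 2"
        by (auto simp: eventually_sequentially)
      have "1 / real (Suc (r j)) \<le> 1 / real (Suc j)"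
        using seq_suble[OF l(2), of j] by (intro divide_left_mono) auto
      then have rj: "1 / real (Suc (r j)) < e / 2" using j(2) by linarith
      from stays[of "r j"] show "eventually (\<lambda>s. image_process \<pi> s \<omega> \<in> U) (at_left t)"
      proof eventually_elim
        case (elim s)
        then obtain y where y: "image_process \<pi> s \<omega> = Some y" "d (a (r j)) y \<le> 1 / real (Suc (r j))"
          by (auto simp: W_def)
        have "d l y \<le> d l (a (r j)) + d (a (r j)) y" by (intro triangle) (auto simp: M)
        also have "\<dots> < e" using j(1) rj y(2) by (simp add: commute)
        finally have "y \<in> mball l e" unfolding in_mball by (simp add: M)
        then show ?case using e(2) y(1) by auto
      qed
    qed
    then show "x \<in> ?L" using l(1) t \<omega> by (auto simp: x)
  qed
  finally show ?thesis .
qed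

section \<open>The extended measure before the explosion time\<close>

lemma tau_n_le_index: "tau_n h n \<omega> \<le> of_nat n"
  by (simp add: tau_n_def)

lemma tau_n_mono:
  assumes "1 \<le> m" "m \<le> n"
  shows "tau_n h m \<omega> \<le> tau_n h n \<omega>"
proof -
  have "1 / real n \<le> 1 / real m" using assms by (intro divide_left_mono) auto
  then have "Inf (ennreal ` {t. 0 \<le> t \<and> h (\<omega> t) \<le> 1 / real m}) \<le>
      Inf (ennreal ` {t. 0 \<le> t \<and> h (\<omega> t) \<le> 1 / real n})"
    by (intro Inf_superset_mono image_mono) auto
  moreover have "(of_nat m :: ennreal) \<le> of_nat n" using assms by simp
  ultimately show ?thesis unfolding tau_n_def by (intro min.mono)
qed

lemma tau_n_le_tau: "1 \<le> n \<Longrightarrow> tau_n h n \<omega> \<le> tau h \<omega>"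
  unfolding tau_def by (rule SUP_upper) simp

text \<open>
  Together with the next lemma this identifies \<open>{t < \<tau>}\<close> with \<open>{N\<^sub>t > 0}\<close>. Adaptedness of \<open>N\<close>
  therefore makes \<open>\<tau>\<close> measurable, although the hitting times of closed sets need not be.
\<close>

lemma positive_before_tau:
  assumes "0 \<le> t" "ennreal t < tau h \<omega>"
  shows "0 < h (\<omega> t)"
proof -
  obtain n where n: "1 \<le> n" "ennreal t < tau_n h n \<omega>"
    using assms(2) unfolding tau_def by (auto simp: less_SUP_iff)
  have "\<not> h (\<omega> t) \<le> 1 / real n"
  proof
    assume "h (\<omega> t) \<le> 1 / real n"
    then have "Inf (ennreal ` {t. 0 \<le> t \<and> h (\<omega> t) \<le> 1 / real n}) \<le> ennreal t"
      using assms(1) by (intro Inf_lower) auto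
    with n(2) show False by (auto simp: tau_n_def)
  qed
  moreover have "0 < 1 / real n" using n(1) by simp
  ultimately show ?thesis by linarith
qed

lemma recip_process_pos_iff:
  assumes "0 \<le> t"
  shows "0 < recip_process h t \<omega> \<longleftrightarrow> ennreal t < tau h \<omega>"
  using positive_before_tau[OF assms, of h \<omega>] by (auto simp: recip_process_def)

text \<open>
  Right continuity holds on every path, not only almost surely: \<open>h\<close> is positive up to \<open>\<tau>\<close>, and \<open>N\<close>
  vanishes from \<open>\<tau>\<close> on. This gives \<open>N\<close> at a stopping time \<open>T\<close> exact measurability at \<open>T\<close>, without
  completing the \<open>\<sigma>\<close>-algebras.
\<close>

lemma recip_process_right_continuous:
  fixes h :: "'e::topological_space option \<Rightarrow> real"
  assumes h: "continuous_on UNIV h" and \<omega>: "\<omega> \<in> path_space" and s: "0 \<le> s"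
  shows "((\<lambda>t. recip_process h t \<omega>) \<longlongrightarrow> recip_process h s \<omega>) (at_right s)"
proof (cases "ennreal s < tau h \<omega>")
  case True
  have "((\<lambda>t. ennreal t) \<longlongrightarrow> ennreal s) (at_right s)" by (intro tendsto_ennrealI tendsto_ident_at)
  from order_tendstoD(2)[OF this True]
  have ev: "eventually (\<lambda>t. 1 / h (\<omega> t) = recip_process h t \<omega>) (at_right s)"
    by eventually_elim (simp add: recip_process_def)
  have "(\<omega> \<longlongrightarrow> \<omega> s) (at_right s)" using \<omega> s by (auto simp: path_space_def)
  then have "((\<lambda>t. h (\<omega> t)) \<longlongrightarrow> h (\<omega> s)) (at_right s)" by (rule tendsto_continuous_UNIV[OF h])
  then have "((\<lambda>t. 1 / h (\<omega> t)) \<longlongrightarrow> 1 / h (\<omega> s)) (at_right s)"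
    using positive_before_tau[OF s True] by (intro tendsto_divide) auto
  then show ?thesis using ev True by (auto intro: Lim_transform_eventually simp: recip_process_def)
next
  case False
  have "recip_process h t \<omega> = recip_process h s \<omega>" if "s < t" for t
  proof -
    have "ennreal s \<le> ennreal t" using that by (intro ennreal_leI) simp
    then have "\<not> ennreal t < tau h \<omega>" using False by (meson le_less_trans)
    then show ?thesis using False by (simp add: recip_process_def)
  qed
  then have "eventually (\<lambda>t. recip_process h t \<omega> = recip_process h s \<omega>) (at_right s)"
    by (intro eventually_at_right_less[THEN eventually_mono]) auto
  then show ?thesis by (rule tendsto_eventually)
qed

text \<open>
  The hypotheses on \<open>P\<close>, \<open>Q\<close> and \<open>N\<close> that concern the situation before \<open>\<tau>\<close> and the comparison of
  \<open>P\<close> and \<open>Q\<close> on the filtration of \<open>X\<close>.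
\<close>

locale foellmer_extension =
  fixes h :: "'e::topological_space option \<Rightarrow> real"
    and \<pi> :: "'e \<Rightarrow> 'd::topological_space"
    and P Q Q0 :: "(real \<Rightarrow> 'e option) measure"
    and T :: "nat \<Rightarrow> (real \<Rightarrow> 'e option) \<Rightarrow> ennreal"
  assumes \<pi>: "continuous_on UNIV \<pi>"
    and P: "prob_space P" "sets P = sets (path_filtration \<infinity> :: (real \<Rightarrow> 'e option) measure)"
    and h_nonneg: "\<And>y. 0 \<le> h y"
    and h_cont: "continuous_on UNIV h"
    and N_adapted: "adapted path_filtration (recip_process h)"
    and N_pos: "AE \<omega> in P. \<forall>t\<ge>0. 0 < recip_process h t \<omega>"
    and T: "\<And>n. 1 \<le> n \<Longrightarrow> stopping_time path_filtration (T n)"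
    and T_P: "\<And>n. 1 \<le> n \<Longrightarrow> AE \<omega> in P. T n \<omega> = tau_n h n \<omega>"
    and T_Q: "\<And>n. 1 \<le> n \<Longrightarrow> AE \<omega> in Q. T n \<omega> = tau_n h n \<omega>"
    and Q0: "foellmer_measure P h T Q0"
    and Q: "equivalent_measure_extension P T \<pi> Q0 Q"
begin

lemma space_P: "space P = path_space"
  using sets_eq_imp_space_eq[OF P(2)] by (simp add: filtration.space_F[OF filtration_path])

lemma prob_Q: "prob_space Q" and sets_Q: "sets Q = sets (path_filtration \<infinity> :: (real \<Rightarrow> 'e option) measure)"
  using Q by (auto simp: equivalent_measure_extension_def)

lemma space_Q: "space Q = path_space"
  using sets_eq_imp_space_eq[OF sets_Q] by (simp add: filtration.space_F[OF filtration_path])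

lemma sets_path_filtration_top: "A \<in> sets (path_filtration t) \<Longrightarrow> A \<in> sets (path_filtration \<infinity>)"
  using filtration.sets_F_mono[OF filtration_path, of t \<infinity>] by auto

lemma tau_measurable: "tau h \<in> borel_measurable Q"
proof (rule borel_measurableI_greater)
  fix y :: ennreal
  show "{\<omega>\<in>space Q. y < tau h \<omega>} \<in> sets Q"
  proof (cases y)
    case (real r)
    have "recip_process h r \<in> borel_measurable (path_filtration (ennreal r))"
      using N_adapted real by (simp add: adapted_def)
    then have "recip_process h r -` {0<..} \<inter> space (path_filtration (ennreal r)) \<in> sets (path_filtration (ennreal r))"
      by (rule measurable_sets) simp
    moreover have "recip_process h r -` {0<..} \<inter> space (path_filtration (ennreal r)) = {\<omega>\<in>space Q. y < tau h \<omega>}"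
      using recip_process_pos_iff[of r h] real
      by (auto simp: space_Q filtration.space_F[OF filtration_path])
    ultimately show ?thesis unfolding sets_Q using sets_path_filtration_top by auto
  qed simp
qed

lemma tau_infinite_P: "AE \<omega> in P. tau h \<omega> = \<infinity>"
  using N_pos
proof eventually_elim
  case (elim \<omega>)
  have "ennreal t < tau h \<omega>" if "0 \<le> t" for t
    using elim recip_process_pos_iff[OF that, of h \<omega>] that by blast
  then show ?case by (cases "tau h \<omega>") auto
qed

lemma subalgebra_stopping_sigma:
  assumes "1 \<le> n"
  shows "subalgebra P (stopping_sigma (T n))"
proof -
  have "A \<in> sets P" if "A \<in> sets (stopping_sigma (T n))" for A
  proof -
    have "{\<omega>\<in>A. T n \<omega> \<le> \<infinity>} \<in> sets (path_filtration \<infinity>)"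
      using that unfolding stopping_sigma_def
      by (rule filtration.sets_pre_sigmaD[OF filtration_path T[OF assms]])
    moreover have "{\<omega>\<in>A. T n \<omega> \<le> \<infinity>} = A" by auto
    ultimately show ?thesis using P(2) by metis
  qed
  then show ?thesis
    by (auto simp: subalgebra_def space_P stopping_sigma_def filtration.space_pre_sigma[OF filtration_path])
qed

lemma recip_process_measurable_stopped:
  assumes "1 \<le> n"
  shows "(\<lambda>\<omega>. recip_process h (enn2real (T n \<omega>)) \<omega>) \<in> borel_measurable (stopping_sigma (T n))"
  unfolding stopping_sigma_def
proof (rule measurable_at_stopping_time[where V = "recip_process h", OF filtration_path N_adapted _ T[OF assms]])
  show "((\<lambda>t. recip_process h t \<omega>) \<longlongrightarrow> recip_process h s \<omega>) (at_right s)"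
    if "\<omega> \<in> path_space" "0 \<le> s" for \<omega> s
    by (rule recip_process_right_continuous[OF h_cont that])
qed

text \<open>
  The only access to \<open>Q\<close> before \<open>\<tau>\<close>: the extension property, the definition of the Foellmer measure
  and the density \<open>N\<close> at \<open>T\<^sub>n\<close> combined into one formula.
\<close>

lemma emeasure_Q_strict_past:
  assumes n: "1 \<le> n" and A: "A \<in> sets (strict_past path_space path_filtration (T n))"
  shows "emeasure Q A = (\<integral>\<^sup>+\<omega>. ennreal (recip_process h (enn2real (T n \<omega>)) \<omega>) * indicator A \<omega> \<partial>P)"
proof -
  let ?f = "\<lambda>\<omega>. ennreal (recip_process h (enn2real (T n \<omega>)) \<omega>)"
  have A': "A \<in> sets (stopping_sigma (T n))"
    using sets_strict_past_subset_pre_sigma[OF filtration_path T[OF n]] A by (auto simp: stopping_sigma_def)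
  have "(\<Union>n\<in>{1..}. sets (stopping_sigma (T n))) \<subseteq> Pow path_space"
    using sets.sets_into_space by (fastforce simp: stopping_sigma_def filtration.space_pre_sigma[OF filtration_path])
  then have "A \<in> sets (limit_sigma T)"
    unfolding limit_sigma_def using A' n by (auto simp: sets_measure_of intro!: sigma_sets.Basic)
  then have "emeasure Q A = emeasure Q0 A"
    using Q by (simp add: equivalent_measure_extension_def)
  also have "\<dots> = emeasure (changed_measure P h (T n)) A"
    using Q0 n A by (simp add: foellmer_measure_def)
  also have "\<dots> = (\<integral>\<^sup>+\<omega>. ?f \<omega> * indicator A \<omega> \<partial>restr_to_subalg P (stopping_sigma (T n)))"
    unfolding changed_measure_def
  proof (rule emeasure_density)
    have "?f \<in> borel_measurable (stopping_sigma (T n))"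
      using recip_process_measurable_stopped[OF n] by measurable
    then show "?f \<in> borel_measurable (restr_to_subalg P (stopping_sigma (T n)))"
      by (rule measurable_in_subalg[OF subalgebra_stopping_sigma[OF n]])
    show "A \<in> sets (restr_to_subalg P (stopping_sigma (T n)))"
      using A' subalgebra_stopping_sigma[OF n] by (simp add: sets_restr_to_subalg)
  qed
  also have "\<dots> = (\<integral>\<^sup>+\<omega>. ?f \<omega> * indicator A \<omega> \<partial>P)"
  proof (rule nn_integral_subalgebra2[OF subalgebra_stopping_sigma[OF n]])
    note [measurable] = A' recip_process_measurable_stopped[OF n]
    show "(\<lambda>\<omega>. ?f \<omega> * indicator A \<omega>) \<in> borel_measurable (stopping_sigma (T n))" by measurable
  qed
  finally show ?thesis .
qed

text \<open>
  Under \<open>P\<close> the times \<open>T\<^sub>m\<close> increase, so on \<open>{T\<^sub>m \<le> T\<^sub>n}\<close> with \<open>m \<ge> n\<close> they coincide and the density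
  at \<open>T\<^sub>m\<close> may be replaced by the density at \<open>T\<^sub>n\<close>. The latter is integrable and does not depend on
  \<open>m\<close>, while the events shrink to a \<open>P\<close>-null set because \<open>\<tau> = \<infinity>\<close> under \<open>P\<close>. Integrability comes
  from the total mass of the Foellmer measure.
\<close>

lemma T_less_tau:
  assumes n: "1 \<le> n"
  shows "AE \<omega> in Q. T n \<omega> < tau h \<omega>"
proof -
  interpret Q: prob_space Q by (rule prob_Q)
  let ?f = "\<lambda>m \<omega>. ennreal (recip_process h (enn2real (T m \<omega>)) \<omega>)"
  define A where "A m = {\<omega>\<in>path_space. T m \<omega> \<le> T n \<omega>}" for m
  have A_strict: "A m \<in> sets (strict_past path_space path_filtration (T m))" if m: "1 \<le> m" for m
  proof -
    let ?q = "\<lambda>q::rat. ennreal (real_of_rat q)"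
    have "{\<omega>\<in>path_space. T n \<omega> \<le> ?q q} \<in> sets (path_filtration (?q q))" for q
      using stopping_timeD[OF T[OF n]] by (simp add: pred_def filtration.space_F[OF filtration_path])
    \<comment> \<open>Rational times separate \<open>T n < T m\<close>, which puts this event into the strict past of \<open>T m\<close>.\<close>
    from sets_strict_pastI[OF filtration_path this]
    have "(\<Union>q. {\<omega>\<in>path_space. T n \<omega> \<le> ?q q} \<inter> {\<omega>\<in>path_space. ?q q < T m \<omega>})
        \<in> sets (strict_past path_space path_filtration (T m))"
      by blast
    then have "path_space - (\<Union>q. {\<omega>\<in>path_space. T n \<omega> \<le> ?q q} \<inter> {\<omega>\<in>path_space. ?q q < T m \<omega>})
        \<in> sets (strict_past path_space path_filtration (T m))"
      using sets.compl_sets by (fastforce simp: space_strict_past[OF filtration_path])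
    also have "path_space - (\<Union>q. {\<omega>\<in>path_space. T n \<omega> \<le> ?q q} \<inter> {\<omega>\<in>path_space. ?q q < T m \<omega>}) = A m"
    proof -
      have "\<exists>q. x \<le> ?q q \<and> ?q q < y" if "x < y" for x y
        using ennreal_rat_dense[OF that] less_imp_le by blast
      then show ?thesis by (force simp: A_def not_le)
    qed
    finally show ?thesis .
  qed
  have meas: "?f m \<in> borel_measurable P" "A m \<in> sets P" if "1 \<le> m" for m
  proof -
    show "?f m \<in> borel_measurable P"
      using measurable_from_subalg[OF subalgebra_stopping_sigma[OF that] recip_process_measurable_stopped[OF that]]
      by measurable
    show "A m \<in> sets P"
      using A_strict[OF that] sets_strict_past_subset_pre_sigma[OF filtration_path T[OF that]]
        subalgebra_stopping_sigma[OF that] by (auto simp: stopping_sigma_def subalgebra_def)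
  qed
  have QA: "emeasure Q (A m) = (\<integral>\<^sup>+\<omega>. ?f n \<omega> * indicator (A m) \<omega> \<partial>P)" if m: "n \<le> m" for m
  proof -
    have m1: "1 \<le> m" using n m by simp
    have "emeasure Q (A m) = (\<integral>\<^sup>+\<omega>. ?f m \<omega> * indicator (A m) \<omega> \<partial>P)"
      by (rule emeasure_Q_strict_past[OF m1 A_strict[OF m1]])
    also have "\<dots> = (\<integral>\<^sup>+\<omega>. ?f n \<omega> * indicator (A m) \<omega> \<partial>P)"
      using T_P[OF n] T_P[OF m1]
    proof (intro nn_integral_cong_AE, eventually_elim)
      case (elim \<omega>)
      then have "T n \<omega> \<le> T m \<omega>" using tau_n_mono[OF n m, of h \<omega>] by simp
      then have "T m \<omega> = T n \<omega>" if "\<omega> \<in> A m" using that by (simp add: A_def)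
      then show ?case by (cases "\<omega> \<in> A m") simp_all
    qed
    finally show ?thesis .
  qed
  have "(\<lambda>m. \<integral>\<^sup>+\<omega>. ?f n \<omega> * indicator (A (n + m)) \<omega> \<partial>P) \<longlonglongrightarrow> (\<integral>\<^sup>+\<omega>. 0 \<partial>P)"
  proof (rule nn_integral_dominated_convergence[where w = "?f n"])
    have "A n \<in> sets (strict_past path_space path_filtration (T n))" by (rule A_strict[OF n])
    moreover have "A n = path_space" by (auto simp: A_def)
    ultimately have "emeasure Q path_space = (\<integral>\<^sup>+\<omega>. ?f n \<omega> * indicator path_space \<omega> \<partial>P)"
      using emeasure_Q_strict_past[OF n] by simp
    also have "\<dots> = (\<integral>\<^sup>+\<omega>. ?f n \<omega> \<partial>P)"
      by (intro nn_integral_cong) (simp add: space_P)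
    finally have "(\<integral>\<^sup>+\<omega>. ?f n \<omega> \<partial>P) = 1"
      using Q.emeasure_space_1 by (simp add: space_Q)
    then show "(\<integral>\<^sup>+\<omega>. ?f n \<omega> \<partial>P) < \<infinity>" by simp
    show "AE \<omega> in P. ?f n \<omega> * indicator (A (n + m)) \<omega> \<le> ?f n \<omega>" for m
      by (intro AE_I2) (auto simp: indicator_def)
    have "AE \<omega> in P. \<forall>m. T (n + m) \<omega> = tau_n h (n + m) \<omega>"
      using n T_P by (subst AE_all_countable) auto
    with tau_infinite_P show "AE \<omega> in P. (\<lambda>m. ?f n \<omega> * indicator (A (n + m)) \<omega>) \<longlonglongrightarrow> 0"
    proof eventually_elim
      case (elim \<omega>)
      have Tn: "T n \<omega> \<le> of_nat n" using elim(2)[rule_format, of 0] tau_n_le_index[of h n \<omega>] by simp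
      have "(of_nat n :: ennreal) < tau h \<omega>" using elim(1) by (simp add: of_nat_less_top)
      then obtain m0 where m0: "1 \<le> m0" "of_nat n < tau_n h m0 \<omega>"
        unfolding tau_def by (auto simp: less_SUP_iff)
      have "\<omega> \<notin> A (n + m)" if "m0 \<le> m" for m
      proof -
        have "tau_n h m0 \<omega> \<le> T (n + m) \<omega>"
          using elim(2)[rule_format, of m] tau_n_mono[OF m0(1), of "n + m" h \<omega>] that by simp
        then have "T n \<omega> < T (n + m) \<omega>" using Tn m0(2) by (meson le_less_trans less_le_trans)
        then show ?thesis by (simp add: A_def not_le)
      qed
      then have "eventually (\<lambda>m. ?f n \<omega> * indicator (A (n + m)) \<omega> = 0) sequentially"
        unfolding eventually_sequentially by (intro exI[of _ m0]) simp
      then show ?case by (rule tendsto_eventually)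
    qed
    show "(\<lambda>\<omega>. ?f n \<omega> * indicator (A (n + m)) \<omega>) \<in> borel_measurable P" for m
    proof -
      have "1 \<le> n + m" using n by simp
      note [measurable] = meas(1)[OF n] meas(2)[OF this]
      show ?thesis by measurable
    qed
  qed (use meas(1)[OF n] in auto)
  then have lim: "(\<lambda>m. emeasure Q (A (n + m))) \<longlonglongrightarrow> 0" using QA by simp
  define L where "L = {\<omega>\<in>space Q. tau h \<omega> \<le> T n \<omega>}"
  have Tm: "T n \<in> borel_measurable Q"
  proof (rule measurable_stopping_time[OF T[OF n]])
    show "sets (path_filtration t) \<subseteq> sets Q" for t
      using sets_path_filtration_top unfolding sets_Q by blast
  qed (simp add: space_Q filtration.space_F[OF filtration_path])
  have AQ: "A m \<in> sets Q" if "1 \<le> m" for m using meas(2)[OF that] by (simp add: P(2) sets_Q)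
  have le: "emeasure Q L \<le> emeasure Q (A (n + m))" for m
  proof (rule emeasure_mono_AE)
    have m1: "1 \<le> n + m" using n by simp
    show "AE \<omega> in Q. \<omega> \<in> L \<longrightarrow> \<omega> \<in> A (n + m)"
      using T_Q[OF m1]
    proof eventually_elim
      case (elim \<omega>)
      then show ?case using tau_n_le_tau[OF m1, of h \<omega>] by (auto simp: L_def A_def space_Q)
    qed
    show "A (n + m) \<in> sets Q" by (rule AQ[OF m1])
  qed
  have "emeasure Q L \<le> 0"
    using LIMSEQ_le_const[OF lim] le by blast
  moreover have "L \<in> sets Q" unfolding L_def using tau_measurable Tm by measurable
  ultimately have "AE \<omega> in Q. \<omega> \<notin> L" by (intro AE_not_in) auto
  then show ?thesis using AE_space by eventually_elim (auto simp: L_def)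
qed

lemma null_sets_P_imp_Q:
  assumes t: "0 \<le> t" and A: "A \<in> sets (image_filtration \<pi> (ennreal t))" "A \<in> null_sets P"
  shows "A \<in> null_sets Q"
proof -
  have subP: "subalgebra P (image_filtration \<pi> (ennreal t))" and subQ: "subalgebra Q (image_filtration \<pi> (ennreal t))"
    using sets_image_filtration_subset[OF \<pi>, of "ennreal t"] sets_path_filtration_top
    by (auto simp: subalgebra_def space_P space_Q P(2) sets_Q filtration.space_F[OF filtration_image])
  have "A \<in> null_sets (restr_to_subalg P (image_filtration \<pi> (ennreal t)))"
    using A by (auto simp: null_sets_def sets_restr_to_subalg[OF subP] emeasure_restr_to_subalg[OF subP])
  then have "A \<in> null_sets (restr_to_subalg Q (image_filtration \<pi> (ennreal t)))"
    using Q t unfolding equivalent_measure_extension_def absolutely_continuous_def by blast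
  then show ?thesis
    using A(1) subQ
    by (auto simp: null_sets_def sets_restr_to_subalg[OF subQ] emeasure_restr_to_subalg[OF subQ] subalgebra_def)
qed

text \<open>
  Strict positivity of \<open>Z\<close> in terms of events: an event of \<open>X\<close> cannot force explosion by time \<open>t\<close>
  with positive probability. On \<open>{t < T\<^sub>n}\<close> the density of \<open>Q\<close> is positive, so the event is
  \<open>P\<close>-null there; these sets exhaust the space under \<open>P\<close>, and equivalence on \<open>F\<^sub>t\<close> returns to \<open>Q\<close>.
\<close>

lemma null_sets_Q_if_no_survivors:
  assumes t: "0 \<le> t" and A: "A \<in> sets (image_filtration \<pi> (ennreal t))"
    and null: "emeasure Q {\<omega>\<in>A. ennreal t < tau h \<omega>} = 0"
  shows "emeasure Q A = 0"
proof -
  interpret P: prob_space P by (rule P(1))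
  let ?f = "\<lambda>m \<omega>. ennreal (recip_process h (enn2real (T m \<omega>)) \<omega>)"
  have A': "A \<in> sets (path_filtration (ennreal t))"
    using sets_image_filtration_subset[OF \<pi>] A by blast
  have AP: "A \<in> sets P" "A \<in> sets Q" "A \<subseteq> path_space"
    using sets_path_filtration_top[OF A'] sets.sets_into_space[OF A']
    by (auto simp: P(2) sets_Q filtration.space_F[OF filtration_path])
  have "AE \<omega> in P. \<not> (\<omega> \<in> A \<and> ennreal t < T n \<omega>)" if n: "1 \<le> n" for n
  proof -
    let ?B = "A \<inter> {\<omega>\<in>path_space. ennreal t < T n \<omega>}"
    have B: "?B \<in> sets (strict_past path_space path_filtration (T n))"
      by (rule sets_strict_pastI[OF filtration_path A'])
    have BP: "?B \<in> sets P"
      using B sets_strict_past_subset_pre_sigma[OF filtration_path T[OF n]]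
        subalgebra_stopping_sigma[OF n] by (auto simp: stopping_sigma_def subalgebra_def)
    have "emeasure Q ?B \<le> emeasure Q {\<omega>\<in>A. ennreal t < tau h \<omega>}"
    proof (rule emeasure_mono_AE)
      show "AE \<omega> in Q. \<omega> \<in> ?B \<longrightarrow> \<omega> \<in> {\<omega>\<in>A. ennreal t < tau h \<omega>}"
        using T_less_tau[OF n] by eventually_elim auto
      have "{\<omega>\<in>A. ennreal t < tau h \<omega>} = A \<inter> {\<omega>\<in>space Q. ennreal t < tau h \<omega>}"
        using AP(3) by (auto simp: space_Q)
      moreover have "{\<omega>\<in>space Q. ennreal t < tau h \<omega>} \<in> sets Q" using tau_measurable by measurable
      ultimately show "{\<omega>\<in>A. ennreal t < tau h \<omega>} \<in> sets Q" using AP(2) by auto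
    qed
    then have "(\<integral>\<^sup>+\<omega>. ?f n \<omega> * indicator ?B \<omega> \<partial>P) = 0"
      using emeasure_Q_strict_past[OF n B] null by simp
    moreover have "(\<lambda>\<omega>. ?f n \<omega> * indicator ?B \<omega>) \<in> borel_measurable P"
    proof -
      have "?f n \<in> borel_measurable P"
        using measurable_from_subalg[OF subalgebra_stopping_sigma[OF n] recip_process_measurable_stopped[OF n]]
        by measurable
      then show ?thesis using BP by measurable
    qed
    ultimately have "AE \<omega> in P. ?f n \<omega> * indicator ?B \<omega> = 0"
      by (simp add: nn_integral_0_iff_AE)
    then show ?thesis using N_pos
    proof eventually_elim
      case (elim \<omega>)
      have "0 < recip_process h (enn2real (T n \<omega>)) \<omega>" using elim(2) enn2real_nonneg by blast
      then have "\<omega> \<notin> ?B" using elim(1) by (auto simp: indicator_def)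
      then show ?case using AP(3) by auto
    qed
  qed
  then have "AE \<omega> in P. \<forall>n. 1 \<le> n \<longrightarrow> \<not> (\<omega> \<in> A \<and> ennreal t < T n \<omega>)"
    by (simp add: AE_all_countable)
  moreover have "AE \<omega> in P. \<forall>n. 1 \<le> n \<longrightarrow> T n \<omega> = tau_n h n \<omega>"
    using T_P by (simp add: AE_all_countable)
  ultimately have "AE \<omega> in P. \<omega> \<notin> A"
    using tau_infinite_P
  proof eventually_elim
    case (elim \<omega>)
    have "ennreal t < tau h \<omega>" using elim(3) by simp
    then obtain n where "1 \<le> n" "ennreal t < tau_n h n \<omega>"
      unfolding tau_def by (auto simp: less_SUP_iff)
    then show ?case using elim(1,2) by auto
  qed
  then have "A \<in> null_sets P" using AP(1) AE_iff_null_sets by blast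
  then show ?thesis using null_sets_P_imp_Q[OF t A] by auto
qed

text \<open>
  Since \<open>T\<^sub>n < \<tau>\<close>, for every large \<open>n\<close> there is a time in \<open>[T\<^sub>n, \<tau>)\<close> at which \<open>h \<le> 1 / n\<close>. These times
  converge to \<open>\<tau>\<close> from the left, so continuity of \<open>h\<close> passes the bound on to the left limit. A path
  that jumps into the region of small \<open>h\<close> exactly at \<open>\<tau>\<close> is what \<open>T\<^sub>n < \<tau>\<close> excludes.
\<close>

lemma left_limit_at_tau_is_zero:
  "AE \<omega> in Q. \<forall>y. tau h \<omega> < \<infinity> \<longrightarrow>
    (\<omega> \<longlongrightarrow> Some y) (at_left (enn2real (tau h \<omega>))) \<longrightarrow> h (Some y) = 0"
proof -
  have "AE \<omega> in Q. \<forall>n. 1 \<le> n \<longrightarrow> T n \<omega> < tau h \<omega> \<and> T n \<omega> = tau_n h n \<omega>"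
    using T_less_tau T_Q by (simp add: AE_all_countable)
  then show ?thesis
  proof eventually_elim
    case (elim \<omega>)
    have less: "tau_n h n \<omega> < tau h \<omega>" if "1 \<le> n" for n using elim that by force
    have "0 < tau h \<omega>" using less[of 1] by (auto simp: zero_less_iff_neq_zero)
    moreover have "h (Some y) = 0"
      if fin: "tau h \<omega> < \<infinity>" and lim: "(\<omega> \<longlongrightarrow> Some y) (at_left (enn2real (tau h \<omega>)))" for y
    proof -
      obtain b where b: "tau h \<omega> = ennreal b" "0 \<le> b" using fin by (cases "tau h \<omega>") auto
      have hl: "((\<lambda>t. h (\<omega> t)) \<longlongrightarrow> h (Some y)) (at_left b)"
        using tendsto_continuous_UNIV[OF h_cont lim] b by simp
      have "h (Some y) \<le> e" if e: "0 < e" for e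
      proof (rule ccontr)
        assume "\<not> h (Some y) \<le> e"
        then have "eventually (\<lambda>t. e < h (\<omega> t)) (at_left b)"
          using order_tendstoD(1)[OF hl, of e] by simp
        then obtain a where a: "a < b" "\<And>t. a < t \<Longrightarrow> t < b \<Longrightarrow> e < h (\<omega> t)"
          unfolding eventually_at_left_field by blast
        have "ennreal (max 0 a) < tau h \<omega>"
          using a(1) \<open>0 < tau h \<omega>\<close> b by (auto simp: max_def ennreal_less_iff)
        then obtain n0 where n0: "1 \<le> n0" "ennreal (max 0 a) < tau_n h n0 \<omega>"
          unfolding tau_def by (auto simp: less_SUP_iff)
        obtain n1 :: nat where n1: "max b (1 / e) < real n1" using reals_Archimedean2 by blast
        define n where "n = max n0 n1"
        have n: "1 \<le> n" "b < real n" "1 / e < real n" using n0(1) n1 by (auto simp: n_def)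
        have late: "ennreal (max 0 a) < tau_n h n \<omega>"
          using n0 tau_n_mono[OF n0(1), of n h \<omega>] by (auto simp: n_def intro: less_le_trans)
        have "tau h \<omega> < of_nat n"
          using n(2) b by (simp add: ennreal_of_nat_eq_real_of_nat ennreal_less_iff)
        then have "tau_n h n \<omega> < of_nat n" using less[OF n(1)] by simp
        then have inf: "tau_n h n \<omega> = Inf (ennreal ` {t. 0 \<le> t \<and> h (\<omega> t) \<le> 1 / real n})"
          unfolding tau_n_def by (auto simp: min_def split: if_splits)
        then have "Inf (ennreal ` {t. 0 \<le> t \<and> h (\<omega> t) \<le> 1 / real n}) < tau h \<omega>" using less[OF n(1)] by simp
        then obtain t where t: "0 \<le> t" "h (\<omega> t) \<le> 1 / real n" "ennreal t < tau h \<omega>"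
          by (auto simp: Inf_less_iff)
        have "tau_n h n \<omega> \<le> ennreal t" unfolding inf using t by (intro Inf_lower) auto
        then have "ennreal (max 0 a) < ennreal t" using late by simp
        then have "max 0 a < t" by (subst (asm) ennreal_less_iff) auto
        then have "a < t" by simp
        moreover have "t < b" using t b by (simp add: ennreal_less_iff)
        ultimately have "e < 1 / real n" using a(2) t(2) by fastforce
        moreover have "1 / real n < e" using n(3) e n(1) by (simp add: field_simps)
        ultimately show False by simp
      qed
      then have "h (Some y) \<le> 0" by (rule field_le_epsilon[of _ 0, simplified])
      then show ?thesis using h_nonneg[of "Some y"] by simp
    qed
    ultimately show ?case by blast
  qed
qed

text \<open>
  The event that the path is dead at time \<open>n\<close> is visible in \<open>X\<close>, hence null under \<open>Q\<close> as under \<open>P\<close>.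
\<close>

lemma lifetime_infinite_Q:
  assumes "AE \<omega> in P. lifetime \<omega> = \<infinity>"
  shows "AE \<omega> in Q. lifetime \<omega> = \<infinity>"
proof -
  have alive: "\<omega> t \<noteq> None" if "lifetime \<omega> = \<infinity>" "0 \<le> t" for \<omega> :: "real \<Rightarrow> 'e option" and t
  proof
    assume "\<omega> t = None"
    then have "lifetime \<omega> \<le> ennreal t" unfolding lifetime_def using that(2) by (intro Inf_lower) auto
    then show False using that(1) by (simp add: top_unique)
  qed
  have "AE \<omega> in Q. \<omega> (real n) \<noteq> None" for n :: nat
  proof -
    let ?F = "image_filtration \<pi> (ennreal (real n)) :: (real \<Rightarrow> 'e option) measure"
    define D where "D = {\<omega>\<in>path_space. image_process \<pi> (real n) \<omega> \<in> {None}}"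
    have D: "D \<in> sets ?F"
      unfolding D_def image_filtration_def
      by (intro sets_right_filtration_coordinate borel_open open_singleton_None) simp
    have "AE \<omega> in P. \<omega> \<notin> D"
      using assms by eventually_elim (use alive in \<open>auto simp: D_def image_process_def\<close>)
    moreover have "D \<in> sets P"
      using D sets_image_filtration_subset[OF \<pi>, of "ennreal (real n)"] sets_path_filtration_top
      by (auto simp: P(2))
    ultimately have "D \<in> null_sets P" using AE_iff_null_sets by blast
    then have "D \<in> null_sets Q" by (rule null_sets_P_imp_Q[OF of_nat_0_le_iff D])
    from AE_not_in[OF this] AE_space show ?thesis
      by eventually_elim (auto simp: D_def image_process_def space_Q)
  qed
  then have "AE \<omega> in Q. \<forall>n::nat. \<omega> (real n) \<noteq> None" by (simp add: AE_all_countable)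
  with AE_space show ?thesis
  proof eventually_elim
    case (elim \<omega>)
    have "\<omega> t \<noteq> None" if "0 \<le> t" for t
    proof -
      obtain n where n: "t \<le> real n" using real_arch_simple by blast
      have "\<forall>s t. 0 \<le> s \<and> s \<le> t \<and> \<omega> s = None \<longrightarrow> \<omega> t = None"
        using elim(1) by (simp add: space_Q path_space_def)
      then have "\<omega> (real n) = None" if "\<omega> t = None"
        using that \<open>0 \<le> t\<close> n by simp
      then show ?thesis using elim(2)[rule_format, of n] by metis
    qed
    then have "{t. 0 \<le> t \<and> \<omega> t = None} = {}" by blast
    then show ?case by (simp add: lifetime_def)
  qed
qed

lemma left_limit_before_lifetime:
  assumes \<omega>: "\<omega> \<in> path_space" and t: "0 < t" "ennreal t < lifetime \<omega>"
  shows "\<exists>y. (\<omega> \<longlongrightarrow> Some y) (at_left t)"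
proof -
  obtain l where l: "(\<omega> \<longlongrightarrow> l) (at_left t)" using \<omega> t by (auto simp: path_space_def)
  have "l \<noteq> None"
  proof
    assume "l = None"
    with l have "eventually (\<lambda>s. \<omega> s \<in> {None}) (at_left t)"
      by (intro topological_tendstoD[OF _ open_singleton_None]) auto
    then obtain b where b: "b < t" "\<And>s. b < s \<Longrightarrow> s < t \<Longrightarrow> \<omega> s = None"
      unfolding eventually_at_left_field by auto
    define s where "s = (max b 0 + t) / 2"
    have s: "b < s" "s < t" "0 \<le> s" using b(1) t(1) by (auto simp: s_def)
    then have "lifetime \<omega> \<le> ennreal s"
      unfolding lifetime_def using b(2) by (intro Inf_lower) auto
    also have "\<dots> \<le> ennreal t" using s by (intro ennreal_leI) simp
    finally show False using t(2) by simp
  qed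
  then show ?thesis using l by (cases l) auto
qed

end

section \<open>The support of the compensator\<close>

theorem theorem2:
  fixes h :: "'e::second_countable_topology option \<Rightarrow> real"
    and \<pi> :: "'e \<Rightarrow> 'd::topological_space"
    and P Q Q0 :: "(real \<Rightarrow> 'e option) measure"
    and T :: "nat \<Rightarrow> (real \<Rightarrow> 'e option) \<Rightarrow> ennreal"
    and Z \<Lambda> K :: "real \<Rightarrow> (real \<Rightarrow> 'e option) \<Rightarrow> real"
  assumes E: "locally_compact_space (euclidean :: 'e topology)"
    and D: "metrizable_space (euclidean :: 'd topology)"
    and \<pi>: "continuous_on UNIV \<pi>"
    and P: "prob_space P" "sets P = sets (path_filtration \<infinity> :: (real \<Rightarrow> 'e option) measure)"
    and h_nonneg: "\<And>y. 0 \<le> h y"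
    and h_cont: "continuous_on UNIV (\<lambda>y. h (Some y))"
    and h_init: "AE \<omega> in P. h (\<omega> 0) = 1"
    and N_local_martingale: "local_martingale P path_filtration (recip_process h)"
    and N_pos: "AE \<omega> in P. \<forall>t\<ge>0. 0 < recip_process h t \<omega>"
    and T: "\<And>n. 1 \<le> n \<Longrightarrow> stopping_time path_filtration (T n)"
      "\<And>n. 1 \<le> n \<Longrightarrow> AE \<omega> in P. T n \<omega> = tau_n h n \<omega>"
      "\<And>n. 1 \<le> n \<Longrightarrow> AE \<omega> in Q. T n \<omega> = tau_n h n \<omega>"
    and Q0: "foellmer_measure P h T Q0"
    and Q: "equivalent_measure_extension P T \<pi> Q0 Q"
    and explosion: "(AE \<omega> in P. lifetime \<omega> = \<infinity>) \<or>
      (AE \<omega> in Q. tau h \<omega> < \<infinity> \<longrightarrow> (\<exists>y. (\<omega> \<longlongrightarrow> Some y) (at_left (enn2real (tau h \<omega>)))))"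
    and Z: "survival_process Q h \<pi> Z"
    and decomposition: "multiplicative_decomposition Q (image_filtration \<pi>) Z \<Lambda> K"
  shows "AE \<omega> in Q. AE t in increment_measure \<Lambda> \<omega>. 0 < t \<longrightarrow>
    (\<exists>x \<in> closure (zero_image \<pi> h).
       ((\<lambda>s. image_process \<pi> s \<omega>) \<longlongrightarrow> Some x) (at_left t))"
proof -
  have closed_zeros: "closed {y. h (Some y) = 0}"
    using h_cont by (intro closed_Collect_eq continuous_on_const)
  interpret foellmer_extension h \<pi> P Q Q0 T
  proof (intro foellmer_extension.intro \<pi> P h_nonneg N_pos T Q0 Q)
    show "continuous_on UNIV h" by (rule continuous_on_option[OF h_cont])
    show "adapted path_filtration (recip_process h)"
      using N_local_martingale unfolding local_martingale_def by blast
  qed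
  interpret F: filtered_prob_space Q "image_filtration \<pi>"
  proof -
    interpret prob_space Q by (rule prob_Q)
    show "filtered_prob_space Q (image_filtration \<pi>)"
    proof unfold_locales
      fix s t :: ennreal
      show "space (image_filtration \<pi> t) = space Q"
        by (simp add: space_Q filtration.space_F[OF filtration_image])
      show "sets (image_filtration \<pi> s) \<subseteq> sets (image_filtration \<pi> t)" if "s \<le> t"
        by (rule filtration.sets_F_mono[OF filtration_image that])
      show "sets (image_filtration \<pi> t) \<subseteq> sets Q"
        using sets_image_filtration_subset[OF \<pi>, of t] sets_path_filtration_top by (auto simp: sets_Q)
    qed
  qed
  let ?F = "\<lambda>t. image_filtration \<pi> (ennreal t) :: (real \<Rightarrow> 'e option) measure"
  let ?alive = "\<lambda>t. indicator {\<omega>. ennreal t < tau h \<omega>} :: (real \<Rightarrow> 'e option) \<Rightarrow> real"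

  have Z_adapted: "adapted (image_filtration \<pi>) Z"
    and Z_rc: "AE \<omega> in Q. \<forall>t\<ge>0. ((\<lambda>s. Z s \<omega>) \<longlongrightarrow> Z t \<omega>) (at_right t)"
    and Z_cond: "\<And>t. 0 \<le> t \<Longrightarrow> AE \<omega> in Q. Z t \<omega> = real_cond_exp Q (?F t) (?alive t) \<omega>"
    using Z by (auto simp: survival_process_def cadlag_def)
  have alive_meas: "?alive t \<in> borel_measurable Q" for t
    using tau_measurable by measurable
  have Z_each: "AE \<omega> in Q. Z t \<omega> \<in> {0..1}" if "0 \<le> t" for t
    using Z_cond[OF that] F.real_cond_exp_indicator_bounds[OF alive_meas[of t], of "ennreal t"]
    by eventually_elim simp
  have Z_bounds: "AE \<omega> in Q. \<forall>t\<ge>0. 0 \<le> Z t \<omega> \<and> Z t \<omega> \<le> 1"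
    by (rule F.right_continuous_AE_bounds[OF Z_each Z_rc])
  have Z_int: "(\<integral>\<omega>. indicator A \<omega> * Z t \<omega> \<partial>Q) = measure Q {\<omega>\<in>A. ennreal t < tau h \<omega>}"
    if t: "0 \<le> t" and A: "A \<in> sets (?F t)" for t A
  proof -
    have AQ: "A \<in> sets Q" "A \<subseteq> space Q" using F.sets_F_D[OF A] sets.sets_into_space by auto
    have "(\<integral>\<omega>. indicator A \<omega> * Z t \<omega> \<partial>Q) = (\<integral>\<omega>. indicator A \<omega> * real_cond_exp Q (?F t) (?alive t) \<omega> \<partial>Q)"
    proof (rule integral_cong_AE)
      show "AE \<omega> in Q. indicator A \<omega> * Z t \<omega> = indicator A \<omega> * real_cond_exp Q (?F t) (?alive t) \<omega>"
        using Z_cond[OF t] by eventually_elim simp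
      have "Z t \<in> borel_measurable Q"
        using Z_adapted t by (intro F.measurable_F[of _ "ennreal t"]) (auto simp: adapted_def)
      then show "(\<lambda>\<omega>. indicator A \<omega> * Z t \<omega>) \<in> borel_measurable Q" using AQ(1) by measurable
      show "(\<lambda>\<omega>. indicator A \<omega> * real_cond_exp Q (?F t) (?alive t) \<omega>) \<in> borel_measurable Q"
        using AQ(1) by measurable
    qed
    also have "\<dots> = (\<integral>\<omega>. indicator A \<omega> * ?alive t \<omega> \<partial>Q)"
    proof (rule F.integral_real_cond_exp_mult)
      show "integrable Q (\<lambda>\<omega>. indicator A \<omega> * ?alive t \<omega>)"
      proof (rule F.integrable_const_bound[where B = 1])
        note [measurable] = AQ(1) alive_meas[of t]
        show "(\<lambda>\<omega>. indicator A \<omega> * ?alive t \<omega>) \<in> borel_measurable Q" by measurable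
      qed (simp add: indicator_def)
    qed (use A alive_meas in auto)
    also have "\<dots> = (\<integral>\<omega>. indicator {\<omega>\<in>A. ennreal t < tau h \<omega>} \<omega> \<partial>Q)"
      by (intro Bochner_Integration.integral_cong) (auto simp: indicator_def)
    also have "\<dots> = measure Q {\<omega>\<in>A. ennreal t < tau h \<omega>}"
    proof -
      have "{\<omega>\<in>A. ennreal t < tau h \<omega>} \<inter> space Q = {\<omega>\<in>A. ennreal t < tau h \<omega>}" using AQ(2) by auto
      then show ?thesis by simp
    qed
    finally show ?thesis .
  qed
  have Z_pos: "AE \<omega> in Q. 0 < Z t \<omega>" if t: "0 \<le> t" for t
  proof -
    define A where "A = {\<omega>\<in>space (?F t). Z t \<omega> \<le> 0}"
    have "Z t \<in> borel_measurable (?F t)" using Z_adapted t by (auto simp: adapted_def)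
    then have A: "A \<in> sets (?F t)" unfolding A_def by measurable
    have "measure Q {\<omega>\<in>A. ennreal t < tau h \<omega>} = (\<integral>\<omega>. indicator A \<omega> * Z t \<omega> \<partial>Q)"
      using Z_int[OF t A] by simp
    also have "\<dots> \<le> 0"
      using Bochner_Integration.integral_nonneg[of Q "\<lambda>\<omega>. - (indicator A \<omega> * Z t \<omega>)"]
      by (simp add: A_def indicator_def)
    finally have "emeasure Q {\<omega>\<in>A. ennreal t < tau h \<omega>} = 0"
      by (simp add: F.emeasure_eq_measure measure_le_0_iff)
    then have "emeasure Q A = 0" by (rule null_sets_Q_if_no_survivors[OF t A])
    then have "A \<in> null_sets Q" using F.sets_F_D[OF A] by auto
    from AE_not_in[OF this] AE_space show ?thesis
      by eventually_elim (auto simp: A_def F.space_F)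
  qed

  obtain C :: "nat \<Rightarrow> 'e set" where C: "\<And>n. compact (C n)" "(\<Union>n. C n) = UNIV"
    using sigma_compact_second_countable[OF E] by blast
  define G where "G n = \<pi> ` (C n \<inter> {y. h (Some y) = 0})" for n
  have G: "compact (G n)" for n
    unfolding G_def
    by (intro compact_continuous_image compact_Int_closed continuous_on_subset[OF \<pi>] C(1) closed_zeros) auto
  have G_Union: "(\<Union>n. G n) = zero_image \<pi> h"
  proof -
    have "(\<Union>n. G n) = \<pi> ` ((\<Union>n. C n) \<inter> {y. h (Some y) = 0})" unfolding G_def by blast
    then show ?thesis by (simp add: C(2) zero_image_def)
  qed
  define good where "good = {(t, \<omega>). 0 < t \<and> \<omega> \<in> path_space \<and>
      (\<exists>x\<in>zero_image \<pi> h. ((\<lambda>s. image_process \<pi> s \<omega>) \<longlongrightarrow> Some x) (at_left t))}"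
  have good: "good \<in> sets (predictable_sigma path_space (image_filtration \<pi>))"
    using predictable_left_limit[OF D \<pi>, of G, OF G] unfolding G_Union good_def .
  \<comment> \<open>Time \<open>0\<close> belongs to \<open>bad\<close>, which is harmless because only positive times are compared.\<close>
  define bad where "bad = {0..} \<times> path_space - good"
  have bad: "bad \<in> sets (predictable_sigma (space Q) (image_filtration \<pi>))"
    using sets.compl_sets[OF good] by (simp add: bad_def space_Q sets_predictable_sigma(2)[OF filtration_image])
  have limit: "AE \<omega> in Q. 0 < tau h \<omega> \<and> tau h \<omega> < \<infinity> \<longrightarrow>
      (\<exists>y. (\<omega> \<longlongrightarrow> Some y) (at_left (enn2real (tau h \<omega>))))"
    using explosion
  proof
    assume "AE \<omega> in P. lifetime \<omega> = \<infinity>"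
    from lifetime_infinite_Q[OF this] AE_space show ?thesis
    proof eventually_elim
      case (elim \<omega>)
      then show ?case
        by (auto intro!: left_limit_before_lifetime simp: space_Q enn2real_positive_iff zero_less_iff_neq_zero)
    qed
  qed auto
  have avoid: "AE \<omega> in Q. 0 < tau h \<omega> \<and> tau h \<omega> < \<infinity> \<longrightarrow> (enn2real (tau h \<omega>), \<omega>) \<notin> bad"
    using limit left_limit_at_tau_is_zero AE_space
  proof eventually_elim
    case (elim \<omega>)
    show ?case
    proof
      assume \<tau>: "0 < tau h \<omega> \<and> tau h \<omega> < \<infinity>"
      then obtain y where y: "(\<omega> \<longlongrightarrow> Some y) (at_left (enn2real (tau h \<omega>)))" using elim(1) by blast
      then have "h (Some y) = 0" using elim(2) \<tau> by blast
      then have "\<pi> y \<in> zero_image \<pi> h" by (auto simp: zero_image_def)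
      moreover have "((\<lambda>s. image_process \<pi> s \<omega>) \<longlongrightarrow> Some (\<pi> y)) (at_left (enn2real (tau h \<omega>)))"
        using tendsto_continuous_UNIV[OF continuous_on_map_option[OF \<pi>] y] by (simp add: image_process_def)
      moreover have "0 < enn2real (tau h \<omega>)" using \<tau> by (simp add: enn2real_positive_iff)
      ultimately have "(enn2real (tau h \<omega>), \<omega>) \<in> good"
        using elim(3) by (auto simp: good_def space_Q)
      then show "(enn2real (tau h \<omega>), \<omega>) \<notin> bad" by (simp add: bad_def)
    qed
  qed
  have "AE \<omega> in Q. AE t in increment_measure \<Lambda> \<omega>. 0 < t \<longrightarrow> (t, \<omega>) \<notin> bad"
    by (rule F.compensator_null_on_avoided_set[OF tau_measurable Z_adapted Z_bounds Z_rc Z_int Z_pos decomposition bad avoid])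
  with AE_space show ?thesis
  proof eventually_elim
    case (elim \<omega>)
    from elim(2) show ?case
    proof eventually_elim
      case (elim t)
      show ?case
      proof
        assume "0 < t"
        with elim \<open>\<omega> \<in> space Q\<close> have "(t, \<omega>) \<in> good" by (auto simp: bad_def space_Q)
        then show "\<exists>x\<in>closure (zero_image \<pi> h). ((\<lambda>s. image_process \<pi> s \<omega>) \<longlongrightarrow> Some x) (at_left t)"
          using closure_subset[of "zero_image \<pi> h"] by (auto simp: good_def)
      qed
    qed
  qed
qed

end
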